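(* For every $p\in(1,\infty)$ there exists a Banach space $X$ of finite cotype such that the projective tensor product $\ell_p\widehat{\otimes}X$ does not have finite cotype.
   Context: All Banach spaces are over $\mathbb{R}$. Projective tensor product: for Banach spaces $X,Y$, $X\widehat{\otimes}Y$ is the completion of the algebraic tensor product $X\otimes Y$ under the norm $\|z\|_{X\widehat{\otimes}Y}=\inf\{\sum_{i=1}^N\|x_i\|_X\|y_i\|_Y:\ N\in\mathbb{N},\ x_i\in X,\ y_i\in Y,\ z=\sum_{i=1}^N x_i\otimes y_i\}$. Cotype: for $q\in[2,\infty)$, a Banach space $X$ has cotype $q$ if there is $C\in(0,\infty)$ such that for every $N\in\mathbb{N}$ and all $x_1,\dots,x_N\in X$, $$\left(\sum_{i=1}^N\|x_i\|_X^q\right)^{1/q}\le C\left(\mathbb{E}\left[\left\|\sum_{i=1}^N\varepsilon_ix_i\right\|_X^2\right]\right)^{1/2},$$ with $\varepsilon=(\varepsilon_1,\dots,\varepsilon_N)$ uniform on $\{-1,1\}^N$. $X$ has finite cotype if it has cotype $q$ for some $q\in[2,\infty)$. *)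

theory Defs
  imports "HOL-Algebra.Module" "HOL-Probability.Probability"
begin

section \<open>Real Banach spaces with an explicit carrier\<close>

definition real_field :: "real ring" where
  "real_field = \<lparr>carrier = UNIV, monoid.mult = (*), one = 1, zero = 0, add = (+)\<rparr>"

text \<open>
  A real vector space is a \<^locale>\<open>Module.module\<close> over \<^term>\<open>real_field\<close>. The record type of modules
  extends that of rings, so it has fields \<^const>\<open>mult\<close> and \<^const>\<open>one\<close>; these are
  never used by the locale and are irrelevant here.

  Since carrier and operations are arbitrary, every Banach space of cardinality at most the
  continuum, in particular every separable one, has an isometric copy whose carrier is a
  set of elements of \<^typ>\<open>nat \<Rightarrow> real\<close>. This is the type used when a Banach space is quantified
  existentially.
\<close>

record 'a nspace = "(real, 'a) module" +
  vnorm :: "'a \<Rightarrow> real"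

definition mk_nspace ::
    "'a set \<Rightarrow> 'a \<Rightarrow> ('a \<Rightarrow> 'a \<Rightarrow> 'a) \<Rightarrow> (real \<Rightarrow> 'a \<Rightarrow> 'a) \<Rightarrow> ('a \<Rightarrow> real) \<Rightarrow> 'a nspace" where
  "mk_nspace C z a s n =
     \<lparr>carrier = C, monoid.mult = undefined, one = undefined, zero = z, add = a, module.smult = s, vnorm = n\<rparr>"

locale seminormed_space = Module.module real_field V for V :: "'a nspace" (structure) +
  assumes norm_triangle:
      "\<lbrakk>x \<in> carrier V; y \<in> carrier V\<rbrakk> \<Longrightarrow> vnorm V (x \<oplus> y) \<le> vnorm V x + vnorm V y"
    and norm_smult: "x \<in> carrier V \<Longrightarrow> vnorm V (c \<odot> x) = \<bar>c\<bar> * vnorm V x"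

locale normed_space = seminormed_space +
  assumes norm_definite: "\<lbrakk>x \<in> carrier V; vnorm V x = 0\<rbrakk> \<Longrightarrow> x = \<zero>"

definition cauchy_seq :: "'a nspace \<Rightarrow> (nat \<Rightarrow> 'a) \<Rightarrow> bool" where
  "cauchy_seq V a \<longleftrightarrow> (\<forall>n. a n \<in> carrier V) \<and>
     (\<forall>e>0. \<exists>N. \<forall>m\<ge>N. \<forall>n\<ge>N. vnorm V (a m \<ominus>\<^bsub>V\<^esub> a n) < e)"

locale banach_space = normed_space +
  assumes complete:
    "cauchy_seq V a \<Longrightarrow> \<exists>l\<in>carrier V. (\<lambda>n. vnorm V (a n \<ominus> l)) \<longlonglongrightarrow> 0"


section \<open>Cotype\<close>

definition has_cotype :: "'a nspace \<Rightarrow> real \<Rightarrow> bool" where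
  "has_cotype X q \<longleftrightarrow> (\<exists>C>0. \<forall>N::nat. \<forall>x. (\<forall>i<N. x i \<in> carrier X) \<longrightarrow>
     (\<Sum>i<N. vnorm X (x i) powr q) powr (1 / q)
       \<le> C * sqrt (measure_pmf.expectation (pmf_of_set ({..<N} \<rightarrow>\<^sub>E {-1, 1}))
             (\<lambda>\<epsilon>. (vnorm X (\<Oplus>\<^bsub>X\<^esub>i\<in>{..<N}. \<epsilon> i \<odot>\<^bsub>X\<^esub> x i))\<^sup>2)))"

definition finite_cotype :: "'a nspace \<Rightarrow> bool" where
  "finite_cotype X \<longleftrightarrow> (\<exists>q\<ge>2. has_cotype X q)"


section \<open>The sequence spaces\<close>

definition lp_space :: "real \<Rightarrow> (nat \<Rightarrow> real) nspace" where
  "lp_space p = mk_nspace {x. summable (\<lambda>n. \<bar>x n\<bar> powr p)}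
     (\<lambda>n. 0) (\<lambda>x y n. x n + y n) (\<lambda>c x n. c * x n)
     (\<lambda>x. (\<Sum>n. \<bar>x n\<bar> powr p) powr (1 / p))"


section \<open>The algebraic tensor product with the projective norm\<close>

definition bilinear_forms :: "'a nspace \<Rightarrow> 'b nspace \<Rightarrow> ('a \<Rightarrow> 'b \<Rightarrow> real) set" where
  "bilinear_forms X Y = {A.
     (\<forall>x\<in>carrier X. \<forall>x'\<in>carrier X. \<forall>y\<in>carrier Y. A (x \<oplus>\<^bsub>X\<^esub> x') y = A x y + A x' y) \<and>
     (\<forall>x\<in>carrier X. \<forall>y\<in>carrier Y. \<forall>y'\<in>carrier Y. A x (y \<oplus>\<^bsub>Y\<^esub> y') = A x y + A x y') \<and>
     (\<forall>c. \<forall>x\<in>carrier X. \<forall>y\<in>carrier Y. A (c \<odot>\<^bsub>X\<^esub> x) y = c * A x y \<and> A x (c \<odot>\<^bsub>Y\<^esub> y) = c * A x y)}"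

text \<open>
  As in Ryan, Introduction to Tensor Products of Banach Spaces, Section 1.1, the elementary tensor
  of x and y is evaluation at (x, y), as a linear functional on the space of all (not necessarily
  bounded) bilinear forms, and the algebraic tensor product is the span of these functionals. Its
  universal property is proved as \<open>tensor_universal\<close> below. The functionals are set to 0
  outside the bilinear forms so that equality of tensors is equality of functions.
\<close>

type_synonym ('a, 'b) tensor = "('a \<Rightarrow> 'b \<Rightarrow> real) \<Rightarrow> real"

definition elem_tensor :: "'a nspace \<Rightarrow> 'b nspace \<Rightarrow> 'a \<Rightarrow> 'b \<Rightarrow> ('a, 'b) tensor" where
  "elem_tensor X Y x y = (\<lambda>A. if A \<in> bilinear_forms X Y then A x y else 0)"

text \<open>
  A representation of z by N elementary tensors; scalar coefficients are absorbed in the factors.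
\<close>

definition represents ::
    "'a nspace \<Rightarrow> 'b nspace \<Rightarrow> nat \<Rightarrow> (nat \<Rightarrow> 'a) \<Rightarrow> (nat \<Rightarrow> 'b) \<Rightarrow> ('a, 'b) tensor \<Rightarrow> bool" where
  "represents X Y N x y z \<longleftrightarrow>
     (\<forall>i<N. x i \<in> carrier X \<and> y i \<in> carrier Y) \<and>
     z = (\<lambda>A. \<Sum>i<N. elem_tensor X Y (x i) (y i) A)"

definition proj_norm :: "'a nspace \<Rightarrow> 'b nspace \<Rightarrow> ('a, 'b) tensor \<Rightarrow> real" where
  "proj_norm X Y z =
     Inf {(\<Sum>i<N. vnorm X (x i) * vnorm Y (y i)) | N x y. represents X Y N x y z}"

definition alg_tensor :: "'a nspace \<Rightarrow> 'b nspace \<Rightarrow> ('a, 'b) tensor nspace" where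
  "alg_tensor X Y = mk_nspace {z. \<exists>N x y. represents X Y N x y z}
     (\<lambda>A. 0) (\<lambda>z w A. z A + w A) (\<lambda>c z A. c * z A) (proj_norm X Y)"


section \<open>Completion\<close>

text \<open>
  Cauchy sequences modulo null sequences. Operations and norm are given on chosen representatives.
\<close>

definition completion_rel :: "'a nspace \<Rightarrow> ((nat \<Rightarrow> 'a) \<times> (nat \<Rightarrow> 'a)) set" where
  "completion_rel V = {(a, b). cauchy_seq V a \<and> cauchy_seq V b \<and>
     (\<lambda>n. vnorm V (a n \<ominus>\<^bsub>V\<^esub> b n)) \<longlonglongrightarrow> 0}"

definition completion_class :: "'a nspace \<Rightarrow> (nat \<Rightarrow> 'a) \<Rightarrow> (nat \<Rightarrow> 'a) set" where
  "completion_class V a = completion_rel V `` {a}"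

definition class_rep :: "(nat \<Rightarrow> 'a) set \<Rightarrow> nat \<Rightarrow> 'a" where
  "class_rep S = (SOME a. a \<in> S)"

definition norm_completion :: "'a nspace \<Rightarrow> (nat \<Rightarrow> 'a) set nspace" where
  "norm_completion V = mk_nspace (Collect (cauchy_seq V) // completion_rel V)
     (completion_class V (\<lambda>n. \<zero>\<^bsub>V\<^esub>))
     (\<lambda>S T. completion_class V (\<lambda>n. class_rep S n \<oplus>\<^bsub>V\<^esub> class_rep T n))
     (\<lambda>c S. completion_class V (\<lambda>n. c \<odot>\<^bsub>V\<^esub> class_rep S n))
     (\<lambda>S. lim (\<lambda>n. vnorm V (class_rep S n)))"

definition proj_tensor :: "'a nspace \<Rightarrow> 'b nspace \<Rightarrow> (nat \<Rightarrow> ('a, 'b) tensor) set nspace" where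
  "proj_tensor X Y = norm_completion (alg_tensor X Y)"


section \<open>The completion is a Banach space\<close>

lemma real_field_simps [simp]:
  "carrier real_field = UNIV" "x \<otimes>\<^bsub>real_field\<^esub> y = x * y" "\<one>\<^bsub>real_field\<^esub> = 1"
  "\<zero>\<^bsub>real_field\<^esub> = 0" "x \<oplus>\<^bsub>real_field\<^esub> y = x + y"
  by (simp_all add: real_field_def)

lemma cring_real_field: "cring real_field"
proof (intro cringI abelian_groupI comm_monoidI)
  fix x :: real
  show "\<exists>y\<in>carrier real_field. y \<oplus>\<^bsub>real_field\<^esub> x = \<zero>\<^bsub>real_field\<^esub>"
    by (auto intro: exI[of _ "- x"])
qed (auto simp: algebra_simps)

lemma real_field_uminus [simp]: "\<ominus>\<^bsub>real_field\<^esub> x = - x"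
proof -
  interpret cring real_field by (rule cring_real_field)
  show ?thesis using minus_equality[of "- x" x] by simp
qed

lemma mk_nspace_simps [simp]:
  "carrier (mk_nspace C z a s n) = C" "\<zero>\<^bsub>mk_nspace C z a s n\<^esub> = z"
  "x \<oplus>\<^bsub>mk_nspace C z a s n\<^esub> y = a x y" "c \<odot>\<^bsub>mk_nspace C z a s n\<^esub> x = s c x"
  "vnorm (mk_nspace C z a s n) = n"
  by (simp_all add: mk_nspace_def)

lemma module_mk_nspace:
  assumes "z \<in> C" "\<And>x y. x \<in> C \<Longrightarrow> y \<in> C \<Longrightarrow> a x y \<in> C" "\<And>c x. x \<in> C \<Longrightarrow> s c x \<in> C"
    and "\<And>x y w. x \<in> C \<Longrightarrow> y \<in> C \<Longrightarrow> w \<in> C \<Longrightarrow> a (a x y) w = a x (a y w)"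
    and "\<And>x y. x \<in> C \<Longrightarrow> y \<in> C \<Longrightarrow> a x y = a y x"
    and "\<And>x. x \<in> C \<Longrightarrow> a z x = x"
    and "\<And>x. x \<in> C \<Longrightarrow> a (s (- 1) x) x = z"
    and "\<And>c d x. x \<in> C \<Longrightarrow> s (c + d) x = a (s c x) (s d x)"
    and "\<And>c x y. x \<in> C \<Longrightarrow> y \<in> C \<Longrightarrow> s c (a x y) = a (s c x) (s c y)"
    and "\<And>c d x. x \<in> C \<Longrightarrow> s (c * d) x = s c (s d x)"
    and "\<And>x. x \<in> C \<Longrightarrow> s 1 x = x"
  shows "Module.module real_field (mk_nspace C z a s n)"
proof (rule Module.moduleI[OF cring_real_field])
  show "abelian_group (mk_nspace C z a s n)"
  proof (rule abelian_groupI)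
    fix x assume "x \<in> carrier (mk_nspace C z a s n)"
    then show "\<exists>y\<in>carrier (mk_nspace C z a s n). y \<oplus>\<^bsub>mk_nspace C z a s n\<^esub> x = \<zero>\<^bsub>mk_nspace C z a s n\<^esub>"
      using assms(3,7)[of x] by (auto intro!: bexI[of _ "s (- 1) x"])
  qed (use assms in auto)
qed (use assms in auto)

lemma module_funs:
  assumes "(\<lambda>_. 0) \<in> C" "\<And>x y. x \<in> C \<Longrightarrow> y \<in> C \<Longrightarrow> (\<lambda>i. x i + y i) \<in> C"
    "\<And>c x. x \<in> C \<Longrightarrow> (\<lambda>i. c * x i) \<in> C"
  shows "Module.module real_field (mk_nspace C (\<lambda>_. 0) (\<lambda>x y i. x i + y i) (\<lambda>c x i. c * x i :: real) n)"
  by (rule module_mk_nspace) (use assms in \<open>auto simp: algebra_simps\<close>)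

lemma null_le:
  fixes f g :: "nat \<Rightarrow> real"
  assumes "g \<longlonglongrightarrow> 0 + 0" "\<And>n. 0 \<le> f n" "\<And>n. f n \<le> g n"
  shows "f \<longlonglongrightarrow> 0"
  by (rule Lim_null_comparison[OF _ assms(1)[simplified]]) (use assms in auto)

context seminormed_space
begin

lemma smult_closed' [simp, intro]: "x \<in> carrier V \<Longrightarrow> c \<odot> x \<in> carrier V"
  by (rule smult_closed) auto

lemma uminus_smult: "x \<in> carrier V \<Longrightarrow> \<ominus> x = (- 1) \<odot> x"
  using smult_l_minus[of 1 x] smult_one[of x] by simp

lemma norm_zero [simp]: "vnorm V \<zero> = 0"
  using norm_smult[of \<zero> 0] smult_l_null[of \<zero>] by simp

lemma norm_uminus [simp]: "x \<in> carrier V \<Longrightarrow> vnorm V (\<ominus> x) = vnorm V x"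
  by (simp add: uminus_smult norm_smult)

lemma norm_nonneg [simp]: "x \<in> carrier V \<Longrightarrow> 0 \<le> vnorm V x"
  using norm_triangle[of x "\<ominus> x"] by (simp add: M.r_neg)

lemma norm_minus_commute:
  "x \<in> carrier V \<Longrightarrow> y \<in> carrier V \<Longrightarrow> vnorm V (x \<ominus> y) = vnorm V (y \<ominus> x)"
  using norm_uminus[of "x \<ominus> y"] by (simp add: M.minus_eq M.minus_add M.a_comm)

lemma norm_minus_triangle:
  assumes "x \<in> carrier V" "y \<in> carrier V" "z \<in> carrier V"
  shows "vnorm V (x \<ominus> z) \<le> vnorm V (x \<ominus> y) + vnorm V (y \<ominus> z)"
proof -
  have "x \<ominus> z = (x \<ominus> y) \<oplus> (y \<ominus> z)"
    using assms by (simp add: M.minus_eq M.a_assoc M.r_neg2 M.r_neg1)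
  then show ?thesis using norm_triangle[of "x \<ominus> y" "y \<ominus> z"] assms by simp
qed

lemma norm_abs_diff:
  assumes "x \<in> carrier V" "y \<in> carrier V"
  shows "\<bar>vnorm V x - vnorm V y\<bar> \<le> vnorm V (x \<ominus> y)"
proof -
  have 1: "x \<ominus> \<zero> = x" "y \<ominus> \<zero> = y" using assms by (simp_all add: M.minus_eq)
  show ?thesis
    using norm_minus_triangle[of x y \<zero>] norm_minus_triangle[of y x \<zero>] norm_minus_commute[of x y] assms 1
    by simp
qed

lemma add_minus_add:
  assumes "x \<in> carrier V" "y \<in> carrier V" "x' \<in> carrier V" "y' \<in> carrier V"
  shows "vnorm V ((x \<oplus> y) \<ominus> (x' \<oplus> y')) \<le> vnorm V (x \<ominus> x') + vnorm V (y \<ominus> y')"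
proof -
  have "(x \<oplus> y) \<ominus> (x' \<oplus> y') = (x \<ominus> x') \<oplus> (y \<ominus> y')"
    using assms by (simp add: M.minus_eq M.minus_add M.a_ac)
  then show ?thesis using norm_triangle[of "x \<ominus> x'" "y \<ominus> y'"] assms by simp
qed

lemma smult_minus_smult:
  assumes "x \<in> carrier V" "x' \<in> carrier V"
  shows "vnorm V ((c \<odot> x) \<ominus> (c \<odot> x')) = \<bar>c\<bar> * vnorm V (x \<ominus> x')"
proof -
  have "(c \<odot> x) \<ominus> (c \<odot> x') = c \<odot> (x \<ominus> x')"
    using assms by (simp add: M.minus_eq smult_r_distr smult_r_minus)
  then show ?thesis using assms by (simp add: norm_smult)
qed

abbreviation "Cau \<equiv> cauchy_seq V"

lemma Cau_in [simp]: "Cau a \<Longrightarrow> a n \<in> carrier V"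
  by (simp add: cauchy_seq_def)

lemma CauD: "Cau a \<Longrightarrow> e > 0 \<Longrightarrow> \<exists>N. \<forall>m\<ge>N. \<forall>n\<ge>N. vnorm V (a m \<ominus> a n) < e"
  by (simp add: cauchy_seq_def)

lemma Cau_const [simp]: "x \<in> carrier V \<Longrightarrow> Cau (\<lambda>n. x)"
  by (simp add: cauchy_seq_def M.minus_eq M.r_neg)

lemma Cau_add:
  assumes "Cau a" "Cau b" shows "Cau (\<lambda>n. a n \<oplus> b n)"
  unfolding cauchy_seq_def
proof (intro conjI allI impI)
  show "a n \<oplus> b n \<in> carrier V" for n using assms by simp
  fix e :: real assume "e > 0"
  then obtain N M where
    N: "\<forall>m\<ge>N. \<forall>n\<ge>N. vnorm V (a m \<ominus> a n) < e/2" and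
    M: "\<forall>m\<ge>M. \<forall>n\<ge>M. vnorm V (b m \<ominus> b n) < e/2"
    using CauD[OF assms(1), of "e/2"] CauD[OF assms(2), of "e/2"] by auto
  have "vnorm V ((a m \<oplus> b m) \<ominus> (a n \<oplus> b n)) < e" if "m \<ge> max N M" "n \<ge> max N M" for m n
  proof -
    have "vnorm V (a m \<ominus> a n) < e/2" "vnorm V (b m \<ominus> b n) < e/2"
      using that N M by auto
    then show ?thesis using add_minus_add[of "a m" "b m" "a n" "b n"] assms by simp
  qed
  then show "\<exists>N. \<forall>m\<ge>N. \<forall>n\<ge>N. vnorm V ((a m \<oplus> b m) \<ominus> (a n \<oplus> b n)) < e" by blast
qed

lemma Cau_smult:
  assumes "Cau a" shows "Cau (\<lambda>n. c \<odot> a n)"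
  unfolding cauchy_seq_def
proof (intro conjI allI impI)
  show "c \<odot> a n \<in> carrier V" for n using assms by simp
  fix e :: real assume "e > 0"
  then have "e / (\<bar>c\<bar> + 1) > 0" by simp
  then obtain N where N: "\<forall>m\<ge>N. \<forall>n\<ge>N. vnorm V (a m \<ominus> a n) < e / (\<bar>c\<bar> + 1)"
    using CauD[OF assms] by blast
  have "vnorm V ((c \<odot> a m) \<ominus> (c \<odot> a n)) < e" if "m \<ge> N" "n \<ge> N" for m n
  proof -
    have "vnorm V (a m \<ominus> a n) < e / (\<bar>c\<bar> + 1)" using N that by blast
    then have "(\<bar>c\<bar> + 1) * vnorm V (a m \<ominus> a n) < e" by (simp add: field_simps)
    moreover have "vnorm V (a m \<ominus> a n) \<ge> 0" using assms by simp
    ultimately have "\<bar>c\<bar> * vnorm V (a m \<ominus> a n) < e" by (simp add: distrib_right)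
    then show ?thesis using assms by (simp add: smult_minus_smult)
  qed
  then show "\<exists>N. \<forall>m\<ge>N. \<forall>n\<ge>N. vnorm V ((c \<odot> a m) \<ominus> (c \<odot> a n)) < e" by blast
qed

lemma Cau_norm_convergent:
  assumes "Cau a" shows "convergent (\<lambda>n. vnorm V (a n))"
proof (rule Cauchy_convergent, rule metric_CauchyI)
  fix e :: real assume "e > 0"
  then obtain N where N: "\<forall>m\<ge>N. \<forall>n\<ge>N. vnorm V (a m \<ominus> a n) < e" using CauD[OF assms] by blast
  show "\<exists>N. \<forall>m\<ge>N. \<forall>n\<ge>N. dist (vnorm V (a m)) (vnorm V (a n)) < e"
  proof (intro exI[of _ N] allI impI)
    fix m n assume "m \<ge> N" "n \<ge> N"
    then have "vnorm V (a m \<ominus> a n) < e" using N by blast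
    then show "dist (vnorm V (a m)) (vnorm V (a n)) < e"
      using norm_abs_diff[of "a m" "a n"] assms by (simp add: dist_real_def)
  qed
qed

lemma rel_iff: "(a, b) \<in> completion_rel V \<longleftrightarrow> Cau a \<and> Cau b \<and> (\<lambda>n. vnorm V (a n \<ominus> b n)) \<longlonglongrightarrow> 0"
  by (simp add: completion_rel_def)

lemma rel_equiv: "equiv (Collect Cau) (completion_rel V)"
proof (rule equivI)
  show "completion_rel V \<subseteq> Collect Cau \<times> Collect Cau" by (auto simp: rel_iff)
  show "refl_on (Collect Cau) (completion_rel V)"
    by (auto simp: refl_on_def rel_iff M.minus_eq M.r_neg)
  show "sym (completion_rel V)"
    by (rule symI) (auto simp: rel_iff norm_minus_commute)
  show "trans (completion_rel V)"
  proof (rule transI)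
    fix a b c assume *: "(a, b) \<in> completion_rel V" "(b, c) \<in> completion_rel V"
    have "(\<lambda>n. vnorm V (a n \<ominus> b n) + vnorm V (b n \<ominus> c n)) \<longlonglongrightarrow> 0 + 0"
      using * by (intro tendsto_add) (auto simp: rel_iff)
    then have "(\<lambda>n. vnorm V (a n \<ominus> c n)) \<longlonglongrightarrow> 0"
      by (rule null_le) (use * in \<open>auto simp: rel_iff intro: norm_minus_triangle\<close>)
    then show "(a, c) \<in> completion_rel V" using * by (auto simp: rel_iff)
  qed
qed

abbreviation "cls \<equiv> completion_class V"

lemma cls_eq_iff: "Cau a \<Longrightarrow> Cau b \<Longrightarrow> cls a = cls b \<longleftrightarrow> (a, b) \<in> completion_rel V"
  unfolding completion_class_def by (rule eq_equiv_class_iff[OF rel_equiv]) auto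

lemma rep_cls: assumes "Cau a" shows "(a, class_rep (cls a)) \<in> completion_rel V"
proof -
  have "a \<in> cls a" unfolding completion_class_def
    using equiv_class_self[OF rel_equiv] assms by blast
  then have "class_rep (cls a) \<in> cls a" unfolding class_rep_def by (rule someI[of "\<lambda>x. x \<in> cls a"])
  then show ?thesis by (simp add: completion_class_def)
qed

lemma Cau_rep: "Cau a \<Longrightarrow> Cau (class_rep (cls a))"
  using rep_cls by (auto simp: rel_iff)

lemma completion_carrier: "S \<in> carrier (norm_completion V) \<longleftrightarrow> (\<exists>a. Cau a \<and> S = cls a)"
  by (auto simp: norm_completion_def quotient_def completion_class_def)

lemma completion_add:
  assumes "Cau a" "Cau b"
  shows "cls a \<oplus>\<^bsub>norm_completion V\<^esub> cls b = cls (\<lambda>n. a n \<oplus> b n)"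
proof -
  note ra = rep_cls[OF assms(1)] and rb = rep_cls[OF assms(2)]
  have "(\<lambda>n. vnorm V (a n \<ominus> class_rep (cls a) n) + vnorm V (b n \<ominus> class_rep (cls b) n)) \<longlonglongrightarrow> 0 + 0"
    using ra rb by (intro tendsto_add) (auto simp: rel_iff)
  then have "(\<lambda>n. vnorm V ((a n \<oplus> b n) \<ominus> (class_rep (cls a) n \<oplus> class_rep (cls b) n))) \<longlonglongrightarrow> 0"
    by (rule null_le) (use ra rb in \<open>auto simp: rel_iff intro: add_minus_add\<close>)
  then have "cls (\<lambda>n. a n \<oplus> b n) = cls (\<lambda>n. class_rep (cls a) n \<oplus> class_rep (cls b) n)"
    using assms by (subst cls_eq_iff) (auto intro!: Cau_add Cau_rep simp: rel_iff)
  then show ?thesis by (simp add: norm_completion_def)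
qed

lemma completion_smult:
  assumes "Cau a"
  shows "c \<odot>\<^bsub>norm_completion V\<^esub> cls a = cls (\<lambda>n. c \<odot> a n)"
proof -
  note ra = rep_cls[OF assms(1)]
  have "(\<lambda>n. \<bar>c\<bar> * vnorm V (a n \<ominus> class_rep (cls a) n)) \<longlonglongrightarrow> \<bar>c\<bar> * 0"
    using ra by (intro tendsto_mult tendsto_const) (auto simp: rel_iff)
  then have "(\<lambda>n. vnorm V ((c \<odot> a n) \<ominus> (c \<odot> class_rep (cls a) n))) \<longlonglongrightarrow> 0"
    using ra by (simp add: smult_minus_smult rel_iff)
  then have "cls (\<lambda>n. c \<odot> a n) = cls (\<lambda>n. c \<odot> class_rep (cls a) n)"
    using assms by (subst cls_eq_iff) (auto intro!: Cau_smult Cau_rep simp: rel_iff)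
  then show ?thesis by (simp add: norm_completion_def)
qed

lemma completion_zero: "\<zero>\<^bsub>norm_completion V\<^esub> = cls (\<lambda>n. \<zero>)"
  by (simp add: norm_completion_def)

lemma completion_norm:
  assumes "Cau a"
  shows "(\<lambda>n. vnorm V (a n)) \<longlonglongrightarrow> vnorm (norm_completion V) (cls a)"
proof -
  note ra = rep_cls[OF assms(1)]
  have 1: "(\<lambda>n. vnorm V (class_rep (cls a) n)) \<longlonglongrightarrow> vnorm (norm_completion V) (cls a)"
    using Cau_norm_convergent[OF Cau_rep[OF assms]]
    by (simp add: norm_completion_def convergent_LIMSEQ_iff)
  have 2: "(\<lambda>n. vnorm V (a n) - vnorm V (class_rep (cls a) n)) \<longlonglongrightarrow> 0"
    by (rule Lim_null_comparison[where g = "\<lambda>n. vnorm V (a n \<ominus> class_rep (cls a) n)"])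
      (use ra norm_abs_diff in \<open>auto simp: rel_iff\<close>)
  from tendsto_add[OF 2 1] show ?thesis by simp
qed

lemma module_completion: "Module.module real_field (norm_completion V)"
proof -
  have eq: "norm_completion V = mk_nspace (carrier (norm_completion V)) \<zero>\<^bsub>norm_completion V\<^esub>
     (\<lambda>x y. x \<oplus>\<^bsub>norm_completion V\<^esub> y) (\<lambda>c x. c \<odot>\<^bsub>norm_completion V\<^esub> x) (vnorm (norm_completion V))"
    by (simp add: norm_completion_def)
  show ?thesis
  proof (subst eq, rule module_mk_nspace)
    fix x assume "x \<in> carrier (norm_completion V)"
    then obtain a where a: "Cau a" "x = cls a" by (auto simp: completion_carrier)
    note [simp] = completion_zero completion_add completion_smult Cau_add Cau_smult
    show "\<zero>\<^bsub>norm_completion V\<^esub> \<oplus>\<^bsub>norm_completion V\<^esub> x = x"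
      "1 \<odot>\<^bsub>norm_completion V\<^esub> x = x"
      using a smult_one by simp_all
    show "(- 1) \<odot>\<^bsub>norm_completion V\<^esub> x \<oplus>\<^bsub>norm_completion V\<^esub> x = \<zero>\<^bsub>norm_completion V\<^esub>"
    proof -
      have "(- 1) \<odot>\<^bsub>norm_completion V\<^esub> x \<oplus>\<^bsub>norm_completion V\<^esub> x = cls (\<lambda>n. (- 1) \<odot> a n \<oplus> a n)"
        using a by simp
      moreover have "(- 1) \<odot> a n \<oplus> a n = \<zero>" for n
        using a by (simp add: uminus_smult[symmetric] M.l_neg)
      ultimately show ?thesis by simp
    qed
    show "c \<odot>\<^bsub>norm_completion V\<^esub> x \<in> carrier (norm_completion V)" for c
      using a by (auto simp: completion_carrier intro!: Cau_smult)
    show "(c + d) \<odot>\<^bsub>norm_completion V\<^esub> x =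
        c \<odot>\<^bsub>norm_completion V\<^esub> x \<oplus>\<^bsub>norm_completion V\<^esub> d \<odot>\<^bsub>norm_completion V\<^esub> x" for c d
      using a smult_l_distr by simp
    show "(c * d) \<odot>\<^bsub>norm_completion V\<^esub> x =
        c \<odot>\<^bsub>norm_completion V\<^esub> (d \<odot>\<^bsub>norm_completion V\<^esub> x)" for c d
      using a smult_assoc1 by simp
    fix y assume "y \<in> carrier (norm_completion V)"
    then obtain b where b: "Cau b" "y = cls b" by (auto simp: completion_carrier)
    show "x \<oplus>\<^bsub>norm_completion V\<^esub> y \<in> carrier (norm_completion V)"
      using a b by (auto simp: completion_carrier intro!: Cau_add)
    show "x \<oplus>\<^bsub>norm_completion V\<^esub> y = y \<oplus>\<^bsub>norm_completion V\<^esub> x"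
      using a b by (simp add: M.a_comm)
    show "c \<odot>\<^bsub>norm_completion V\<^esub> (x \<oplus>\<^bsub>norm_completion V\<^esub> y) =
        c \<odot>\<^bsub>norm_completion V\<^esub> x \<oplus>\<^bsub>norm_completion V\<^esub> c \<odot>\<^bsub>norm_completion V\<^esub> y" for c
      using a b smult_r_distr by simp
    fix w assume "w \<in> carrier (norm_completion V)"
    then obtain c where c: "Cau c" "w = cls c" by (auto simp: completion_carrier)
    show "x \<oplus>\<^bsub>norm_completion V\<^esub> y \<oplus>\<^bsub>norm_completion V\<^esub> w =
        x \<oplus>\<^bsub>norm_completion V\<^esub> (y \<oplus>\<^bsub>norm_completion V\<^esub> w)"
      using a b c by (simp add: M.a_assoc)
  qed (auto simp: completion_carrier completion_zero intro!: exI[of _ "\<lambda>n. \<zero>"])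
qed

lemma seminormed_completion: "seminormed_space (norm_completion V)"
proof (intro seminormed_space.intro module_completion seminormed_space_axioms.intro)
  fix x assume "x \<in> carrier (norm_completion V)"
  then obtain a where a: "Cau a" "x = cls a" by (auto simp: completion_carrier)
  show "vnorm (norm_completion V) (c \<odot>\<^bsub>norm_completion V\<^esub> x) = \<bar>c\<bar> * vnorm (norm_completion V) x" for c
  proof (rule LIMSEQ_unique)
    show "(\<lambda>n. vnorm V (c \<odot> a n)) \<longlonglongrightarrow> vnorm (norm_completion V) (c \<odot>\<^bsub>norm_completion V\<^esub> x)"
      using a completion_norm[of "\<lambda>n. c \<odot> a n"] by (simp add: completion_smult Cau_smult)
    show "(\<lambda>n. vnorm V (c \<odot> a n)) \<longlonglongrightarrow> \<bar>c\<bar> * vnorm (norm_completion V) x"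
      using a tendsto_mult[OF tendsto_const completion_norm[of a], of "\<bar>c\<bar>"] by (simp add: norm_smult)
  qed
  fix y assume "y \<in> carrier (norm_completion V)"
  then obtain b where b: "Cau b" "y = cls b" by (auto simp: completion_carrier)
  show "vnorm (norm_completion V) (x \<oplus>\<^bsub>norm_completion V\<^esub> y)
      \<le> vnorm (norm_completion V) x + vnorm (norm_completion V) y"
  proof (rule LIMSEQ_le)
    show "(\<lambda>n. vnorm V (a n \<oplus> b n)) \<longlonglongrightarrow> vnorm (norm_completion V) (x \<oplus>\<^bsub>norm_completion V\<^esub> y)"
      using a b completion_norm[of "\<lambda>n. a n \<oplus> b n"] by (simp add: completion_add Cau_add)
    show "(\<lambda>n. vnorm V (a n) + vnorm V (b n)) \<longlonglongrightarrow> vnorm (norm_completion V) x + vnorm (norm_completion V) y"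
      using a b by (auto intro!: tendsto_add completion_norm)
    show "\<exists>N. \<forall>n\<ge>N. vnorm V (a n \<oplus> b n) \<le> vnorm V (a n) + vnorm V (b n)"
      using a b norm_triangle by auto
  qed
qed

lemma completion_minus:
  assumes "Cau a" "Cau b"
  shows "cls a \<ominus>\<^bsub>norm_completion V\<^esub> cls b = cls (\<lambda>n. a n \<ominus> b n)"
proof -
  interpret W: seminormed_space "norm_completion V" by (rule seminormed_completion)
  have "cls b \<in> carrier (norm_completion V)" using assms by (auto simp: completion_carrier)
  then have "cls a \<ominus>\<^bsub>norm_completion V\<^esub> cls b = cls (\<lambda>n. a n \<oplus> (- 1) \<odot> b n)"
    using assms by (simp add: W.M.minus_eq W.uminus_smult completion_smult completion_add Cau_smult)
  then show ?thesis using assms by (simp add: M.minus_eq uminus_smult)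
qed

lemma Cau_minus: "Cau a \<Longrightarrow> Cau b \<Longrightarrow> Cau (\<lambda>n. a n \<ominus> b n)"
  using Cau_add[OF _ Cau_smult, of a b "- 1"] by (simp add: M.minus_eq uminus_smult)

theorem banach_completion: "banach_space (norm_completion V)"
proof (intro banach_space.intro normed_space.intro seminormed_completion
    normed_space_axioms.intro banach_space_axioms.intro)
  fix x assume "x \<in> carrier (norm_completion V)" and 0: "vnorm (norm_completion V) x = 0"
  then obtain a where a: "Cau a" "x = cls a" by (auto simp: completion_carrier)
  have "a n \<ominus> \<zero> = a n" for n using a by (simp add: M.minus_eq)
  then show "x = \<zero>\<^bsub>norm_completion V\<^esub>"
    using a 0 completion_norm[of a] by (simp add: completion_zero cls_eq_iff rel_iff)
next
  fix S assume S: "cauchy_seq (norm_completion V) S"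
  then have "\<forall>k. \<exists>a. Cau a \<and> S k = cls a" by (simp add: cauchy_seq_def completion_carrier)
  then obtain a where a: "\<And>k. Cau (a k)" "\<And>k. S k = cls (a k)" by metis
  have "\<exists>N. \<forall>m\<ge>N. \<forall>n\<ge>N. vnorm V (a k m \<ominus> a k n) < 1 / Suc k" for k
    using CauD[OF a(1)[of k], of "1 / Suc k"] by simp
  then obtain f where f: "\<And>k m n. m \<ge> f k \<Longrightarrow> n \<ge> f k \<Longrightarrow> vnorm V (a k m \<ominus> a k n) < 1 / Suc k"
    by metis
  define l where "l k = a k (f k)" for k
  have l_in [simp]: "l k \<in> carrier V" for k using a by (simp add: l_def)
  have al: "vnorm V (a k m \<ominus> l k) < 1 / Suc k" if "m \<ge> f k" for k m
    using f[OF that, of "f k"] by (simp add: l_def)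
  have ain [simp]: "a k m \<in> carrier V" for k m using a by simp
  have Cl: "Cau l"
    unfolding cauchy_seq_def
  proof (intro conjI allI impI)
    fix e :: real assume e: "e > 0"
    obtain N where N: "\<And>j k. j \<ge> N \<Longrightarrow> k \<ge> N \<Longrightarrow>
        vnorm (norm_completion V) (S j \<ominus>\<^bsub>norm_completion V\<^esub> S k) < e/3"
      using S e unfolding cauchy_seq_def by (meson zero_less_divide_iff zero_less_numeral)
    obtain M where M: "1 / Suc M < e/3"
      using reals_Archimedean[of "e/3"] e by (auto simp: inverse_eq_divide)
    have "vnorm V (l j \<ominus> l k) < e" if jk: "j \<ge> max N M" "k \<ge> max N M" for j k
    proof -
      have "(\<lambda>n. vnorm V (a j n \<ominus> a k n)) \<longlonglongrightarrow> vnorm (norm_completion V) (S j \<ominus>\<^bsub>norm_completion V\<^esub> S k)"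
        using completion_norm[OF Cau_minus[OF a(1) a(1)]] by (simp add: a completion_minus)
      then have "\<forall>\<^sub>F n in sequentially. vnorm V (a j n \<ominus> a k n) < e/3"
        by (rule order_tendstoD) (use N jk in auto)
      then have "\<forall>\<^sub>F n in sequentially. vnorm V (a j n \<ominus> a k n) < e/3 \<and> n \<ge> f j \<and> n \<ge> f k"
        by (intro eventually_conj eventually_ge_at_top)
      then obtain n where n: "vnorm V (a j n \<ominus> a k n) < e/3" "n \<ge> f j" "n \<ge> f k"
        by (auto simp: eventually_sequentially)
      have "1 / Suc j \<le> 1 / Suc M" "1 / Suc k \<le> 1 / Suc M"
        using jk by (auto intro!: divide_left_mono)
      then have "vnorm V (a j n \<ominus> l j) < e/3" "vnorm V (a k n \<ominus> l k) < e/3"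
        using al[OF n(2)] al[OF n(3)] M by linarith+
      then show ?thesis
        using n norm_minus_triangle[of "l j" "a j n" "l k"] norm_minus_triangle[of "a j n" "a k n" "l k"]
          norm_minus_commute[of "l j" "a j n"] by simp
    qed
    then show "\<exists>N. \<forall>m\<ge>N. \<forall>n\<ge>N. vnorm V (l m \<ominus> l n) < e" by blast
  qed simp
  show "\<exists>x\<in>carrier (norm_completion V).
      (\<lambda>n. vnorm (norm_completion V) (S n \<ominus>\<^bsub>norm_completion V\<^esub> x)) \<longlonglongrightarrow> 0"
  proof (rule bexI[of _ "cls l"])
    show "cls l \<in> carrier (norm_completion V)" using Cl by (auto simp: completion_carrier)
    have lim: "(\<lambda>m. vnorm V (a k m \<ominus> l m)) \<longlonglongrightarrow> vnorm (norm_completion V) (S k \<ominus>\<^bsub>norm_completion V\<^esub> cls l)" for k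
      using completion_norm[OF Cau_minus[OF a(1) Cl]] by (simp add: a Cl completion_minus)
    show "(\<lambda>n. vnorm (norm_completion V) (S n \<ominus>\<^bsub>norm_completion V\<^esub> cls l)) \<longlonglongrightarrow> 0"
    proof (rule LIMSEQ_I)
      fix e :: real assume e: "e > 0"
      obtain N where N: "\<And>j k. j \<ge> N \<Longrightarrow> k \<ge> N \<Longrightarrow> vnorm V (l j \<ominus> l k) < e/3"
        using CauD[OF Cl, of "e/3"] e by auto
      obtain M where M: "1 / Suc M < e/3"
        using reals_Archimedean[of "e/3"] e by (auto simp: inverse_eq_divide)
      have "norm (vnorm (norm_completion V) (S k \<ominus>\<^bsub>norm_completion V\<^esub> cls l) - 0) < e"
        if k: "k \<ge> max N M" for k
      proof -
        have kM: "1 / Suc k \<le> 1 / Suc M" using k by (auto intro!: divide_left_mono)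
        have bd: "vnorm V (a k m \<ominus> l m) \<le> 2 * e / 3" if m: "m \<ge> max N (f k)" for m
          using al[of k m] N[of k m] k m kM M norm_minus_triangle[of "a k m" "l k" "l m"] by simp
        have "vnorm (norm_completion V) (S k \<ominus>\<^bsub>norm_completion V\<^esub> cls l) \<le> 2 * e / 3"
          by (rule LIMSEQ_le_const2[OF lim]) (use bd in blast)
        moreover have "0 \<le> vnorm (norm_completion V) (S k \<ominus>\<^bsub>norm_completion V\<^esub> cls l)"
          by (rule LIMSEQ_le_const[OF lim]) simp
        ultimately show ?thesis using e by simp
      qed
      then show "\<exists>no. \<forall>n\<ge>no. norm (vnorm (norm_completion V) (S n \<ominus>\<^bsub>norm_completion V\<^esub> cls l) - 0) < e"
        by blast
    qed
  qed
qed

end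



section \<open>The projective tensor product is a Banach space; universal property\<close>

lemma sum_lessThan_append:
  fixes f g :: "nat \<Rightarrow> 'c::comm_monoid_add"
  shows "(\<Sum>i<N + M. if i < N then f i else g (i - N)) = (\<Sum>i<N. f i) + (\<Sum>i<M. g i)"
  by (induction M) (auto simp: add.assoc)

lemma represents_append:
  assumes "represents X Y N x y z" "represents X Y M x' y' z'"
  shows "represents X Y (N + M) (\<lambda>i. if i < N then x i else x' (i - N))
           (\<lambda>i. if i < N then y i else y' (i - N)) (\<lambda>A. z A + z' A)"
  using assms
  by (auto simp: represents_def fun_eq_iff if_distribR sum_lessThan_append[symmetric] intro!: sum.cong)

lemma elem_tensor_smult:
  assumes "x \<in> carrier X" "y \<in> carrier Y"
  shows "elem_tensor X Y (c \<odot>\<^bsub>X\<^esub> x) y A = c * elem_tensor X Y x y A"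
  using assms by (auto simp: elem_tensor_def bilinear_forms_def)

lemma represents_smult:
  assumes "seminormed_space X" "represents X Y N x y z"
  shows "represents X Y N (\<lambda>i. c \<odot>\<^bsub>X\<^esub> x i) y (\<lambda>A. c * z A)"
proof -
  interpret X: seminormed_space X by fact
  show ?thesis
    using assms(2) by (auto simp: represents_def fun_eq_iff sum_distrib_left elem_tensor_smult)
qed

lemma represents_zero: "represents X Y 0 x y (\<lambda>A. 0)"
  by (simp add: represents_def)

locale tensor_spaces = X: seminormed_space X + Y: seminormed_space Y
  for X :: "'a nspace" and Y :: "'b nspace"
begin

lemma cost_nonneg:
  "represents X Y N x y z \<Longrightarrow> 0 \<le> (\<Sum>i<N. vnorm X (x i) * vnorm Y (y i))"
  by (auto simp: represents_def intro!: sum_nonneg mult_nonneg_nonneg)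

lemma proj_norm_le:
  assumes "represents X Y N x y z"
  shows "proj_norm X Y z \<le> (\<Sum>i<N. vnorm X (x i) * vnorm Y (y i))"
  unfolding proj_norm_def
proof (rule cInf_lower)
  show "bdd_below {(\<Sum>i<N. vnorm X (x i) * vnorm Y (y i)) | N x y. represents X Y N x y z}"
    by (rule bdd_belowI[of _ 0]) (auto dest: cost_nonneg)
qed (use assms in blast)

lemma proj_norm_less:
  assumes "represents X Y N x y z" "proj_norm X Y z < r"
  obtains M x' y' where "represents X Y M x' y' z" "(\<Sum>i<M. vnorm X (x' i) * vnorm Y (y' i)) < r"
proof -
  have "{(\<Sum>i<N. vnorm X (x i) * vnorm Y (y i)) | N x y. represents X Y N x y z} \<noteq> {}"
    using assms by blast
  from cInf_lessD[OF this assms(2)[unfolded proj_norm_def]] that show ?thesis by auto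
qed

lemma proj_norm_smult_le:
  assumes "represents X Y N x y z"
  shows "proj_norm X Y (\<lambda>A. c * z A) \<le> \<bar>c\<bar> * proj_norm X Y z"
proof (cases "c = 0")
  case True
  then show ?thesis using proj_norm_le[OF represents_zero] by simp
next
  case False
  show ?thesis
  proof (rule field_le_epsilon)
    fix e :: real assume "e > 0"
    then have "proj_norm X Y z < proj_norm X Y z + e / \<bar>c\<bar>" using False by simp
    then obtain M x' y' where r: "represents X Y M x' y' z"
      and lt: "(\<Sum>i<M. vnorm X (x' i) * vnorm Y (y' i)) < proj_norm X Y z + e / \<bar>c\<bar>"
      using proj_norm_less[OF assms] by blast
    have "proj_norm X Y (\<lambda>A. c * z A) \<le> (\<Sum>i<M. vnorm X (c \<odot>\<^bsub>X\<^esub> x' i) * vnorm Y (y' i))"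
      by (rule proj_norm_le[OF represents_smult[OF X.seminormed_space_axioms r]])
    also have "\<dots> = \<bar>c\<bar> * (\<Sum>i<M. vnorm X (x' i) * vnorm Y (y' i))"
      using r by (auto simp: represents_def X.norm_smult sum_distrib_left mult.assoc)
    also have "\<dots> \<le> \<bar>c\<bar> * (proj_norm X Y z + e / \<bar>c\<bar>)"
      using lt by (intro mult_left_mono) auto
    finally show "proj_norm X Y (\<lambda>A. c * z A) \<le> \<bar>c\<bar> * proj_norm X Y z + e"
      using False by (simp add: distrib_left)
  qed
qed

lemma seminormed_alg_tensor: "seminormed_space (alg_tensor X Y)"
proof (intro seminormed_space.intro seminormed_space_axioms.intro)
  show "Module.module real_field (alg_tensor X Y)"
    unfolding alg_tensor_def
  proof (rule module_funs)
    show "(\<lambda>_. 0) \<in> {z. \<exists>N x y. represents X Y N x y z}"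
      using represents_zero by fast
    fix z assume "z \<in> {z. \<exists>N x y. represents X Y N x y z}"
    then obtain N x y where z: "represents X Y N x y z" by auto
    show "(\<lambda>A. c * z A) \<in> {z. \<exists>N x y. represents X Y N x y z}" for c
      using represents_smult[OF X.seminormed_space_axioms z] by fast
    fix w assume "w \<in> {z. \<exists>N x y. represents X Y N x y z}"
    then obtain M x' y' where w: "represents X Y M x' y' w" by auto
    show "(\<lambda>A. z A + w A) \<in> {z. \<exists>N x y. represents X Y N x y z}"
      using represents_append[OF z w] by fast
  qed
next
  fix z assume "z \<in> carrier (alg_tensor X Y)"
  then obtain N x y where z: "represents X Y N x y z" by (auto simp: alg_tensor_def)
  show "vnorm (alg_tensor X Y) (c \<odot>\<^bsub>alg_tensor X Y\<^esub> z) = \<bar>c\<bar> * vnorm (alg_tensor X Y) z" for c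
  proof (cases "c = 0")
    case True
    have "0 \<le> proj_norm X Y (\<lambda>A. 0)"
      unfolding proj_norm_def
    proof (rule cInf_greatest)
      show "{(\<Sum>i<N. vnorm X (x i) * vnorm Y (y i)) | N x y. represents X Y N x y (\<lambda>A. 0)} \<noteq> {}"
        using represents_zero[of X Y] by blast
    qed (auto dest: cost_nonneg)
    then show ?thesis using True proj_norm_le[OF represents_zero] by (simp add: alg_tensor_def)
  next
    case False
    have "\<bar>c\<bar> * proj_norm X Y z = \<bar>c\<bar> * proj_norm X Y (\<lambda>A. (1/c) * (c * z A))" using False by simp
    also have "\<dots> \<le> \<bar>c\<bar> * (\<bar>1/c\<bar> * proj_norm X Y (\<lambda>A. c * z A))"
      by (intro mult_left_mono proj_norm_smult_le[OF represents_smult[OF X.seminormed_space_axioms z]]) auto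
    finally show ?thesis using False proj_norm_smult_le[OF z, of c] by (simp add: alg_tensor_def)
  qed
  fix w assume "w \<in> carrier (alg_tensor X Y)"
  then obtain M x' y' where w: "represents X Y M x' y' w" by (auto simp: alg_tensor_def)
  have "proj_norm X Y (\<lambda>A. z A + w A) \<le> proj_norm X Y z + proj_norm X Y w"
  proof (rule field_le_epsilon)
    fix e :: real assume "e > 0"
    then have lt: "proj_norm X Y z < proj_norm X Y z + e/2" "proj_norm X Y w < proj_norm X Y w + e/2"
      by auto
    obtain N1 x1 y1 where r1: "represents X Y N1 x1 y1 z"
      and l1: "(\<Sum>i<N1. vnorm X (x1 i) * vnorm Y (y1 i)) < proj_norm X Y z + e/2"
      using proj_norm_less[OF z lt(1)] by blast
    obtain N2 x2 y2 where r2: "represents X Y N2 x2 y2 w"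
      and l2: "(\<Sum>i<N2. vnorm X (x2 i) * vnorm Y (y2 i)) < proj_norm X Y w + e/2"
      using proj_norm_less[OF w lt(2)] by blast
    have "proj_norm X Y (\<lambda>A. z A + w A) \<le>
        (\<Sum>i<N1 + N2. vnorm X (if i < N1 then x1 i else x2 (i - N1)) *
          vnorm Y (if i < N1 then y1 i else y2 (i - N1)))"
      by (rule proj_norm_le[OF represents_append[OF r1 r2]])
    also have "\<dots> = (\<Sum>i<N1 + N2. if i < N1 then vnorm X (x1 i) * vnorm Y (y1 i)
        else vnorm X (x2 (i - N1)) * vnorm Y (y2 (i - N1)))"
      by (intro sum.cong) auto
    also have "\<dots> = (\<Sum>i<N1. vnorm X (x1 i) * vnorm Y (y1 i)) + (\<Sum>i<N2. vnorm X (x2 i) * vnorm Y (y2 i))"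
      by (rule sum_lessThan_append)
    finally show "proj_norm X Y (\<lambda>A. z A + w A) \<le> proj_norm X Y z + proj_norm X Y w + e"
      using l1 l2 by simp
  qed
  then show "vnorm (alg_tensor X Y) (z \<oplus>\<^bsub>alg_tensor X Y\<^esub> w) \<le>
      vnorm (alg_tensor X Y) z + vnorm (alg_tensor X Y) w"
    by (simp add: alg_tensor_def)
qed

theorem banach_proj_tensor: "banach_space (proj_tensor X Y)"
proof -
  interpret T: seminormed_space "alg_tensor X Y" by (rule seminormed_alg_tensor)
  show ?thesis unfolding proj_tensor_def by (rule T.banach_completion)
qed

definition bilinear_map :: "('a \<Rightarrow> 'b \<Rightarrow> 'w::real_vector) \<Rightarrow> bool" where
  "bilinear_map B \<longleftrightarrow>
     (\<forall>x\<in>carrier X. \<forall>x'\<in>carrier X. \<forall>y\<in>carrier Y. B (x \<oplus>\<^bsub>X\<^esub> x') y = B x y + B x' y) \<and>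
     (\<forall>x\<in>carrier X. \<forall>y\<in>carrier Y. \<forall>y'\<in>carrier Y. B x (y \<oplus>\<^bsub>Y\<^esub> y') = B x y + B x y') \<and>
     (\<forall>c. \<forall>x\<in>carrier X. \<forall>y\<in>carrier Y.
        B (c \<odot>\<^bsub>X\<^esub> x) y = c *\<^sub>R B x y \<and> B x (c \<odot>\<^bsub>Y\<^esub> y) = c *\<^sub>R B x y)"

lemma represents_bilinear_map:
  assumes B: "bilinear_map B" and r: "represents X Y N x y z" "represents X Y M x' y' z"
  shows "(\<Sum>i<N. B (x i) (y i)) = (\<Sum>i<M. B (x' i) (y' i))"
proof (rule ccontr)
  let ?d = "(\<Sum>i<N. B (x i) (y i)) - (\<Sum>i<M. B (x' i) (y' i))"
  assume "\<not> ?thesis"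
  then have "independent {?d}" by simp
  from linear_independent_extend[OF this, of "\<lambda>_. 1::real"]
  obtain f :: "'c \<Rightarrow> real" where f: "linear f" "f ?d = 1" by auto
  define A where "A x y = f (B x y)" for x y
  have A: "A \<in> bilinear_forms X Y"
    using B f(1) by (auto simp: A_def bilinear_forms_def bilinear_map_def linear_add linear_scale)
  have "z A = f (\<Sum>i<K. B (u i) (v i))" if "represents X Y K u v z" for K u v
    using that A f(1) by (simp add: represents_def elem_tensor_def A_def linear_sum)
  from this[OF r(1)] this[OF r(2)] show False using f by (simp add: linear_diff)
qed

theorem tensor_universal:
  assumes B: "bilinear_map B"
  shows "\<exists>L. (\<forall>z\<in>carrier (alg_tensor X Y). \<forall>w\<in>carrier (alg_tensor X Y).
              L (z \<oplus>\<^bsub>alg_tensor X Y\<^esub> w) = L z + L w) \<and>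
            (\<forall>c. \<forall>z\<in>carrier (alg_tensor X Y). L (c \<odot>\<^bsub>alg_tensor X Y\<^esub> z) = c *\<^sub>R L z) \<and>
            (\<forall>x\<in>carrier X. \<forall>y\<in>carrier Y. L (elem_tensor X Y x y) = B x y)"
proof -
  define L where "L z = (SOME w. \<exists>N x y. represents X Y N x y z \<and> w = (\<Sum>i<N. B (x i) (y i)))" for z
  have L: "L z = (\<Sum>i<N. B (x i) (y i))" if r: "represents X Y N x y z" for N x y z
    unfolding L_def
  proof (rule some_equality)
    show "\<exists>N' x' y'. represents X Y N' x' y' z \<and> (\<Sum>i<N. B (x i) (y i)) = (\<Sum>i<N'. B (x' i) (y' i))"
      using r by blast
    show "w = (\<Sum>i<N. B (x i) (y i))"
      if "\<exists>N x y. represents X Y N x y z \<and> w = (\<Sum>i<N. B (x i) (y i))" for w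
      using that represents_bilinear_map[OF B r] by auto
  qed
  show ?thesis
  proof (intro exI[of _ L] conjI ballI allI)
    fix z assume "z \<in> carrier (alg_tensor X Y)"
    then obtain N x y where z: "represents X Y N x y z" by (auto simp: alg_tensor_def)
    show "L (c \<odot>\<^bsub>alg_tensor X Y\<^esub> z) = c *\<^sub>R L z" for c
      using L[OF represents_smult[OF X.seminormed_space_axioms z]] L[OF z] z B
      by (simp add: alg_tensor_def represents_def bilinear_map_def scaleR_sum_right)
    fix w assume "w \<in> carrier (alg_tensor X Y)"
    then obtain M x' y' where w: "represents X Y M x' y' w" by (auto simp: alg_tensor_def)
    have "L (\<lambda>A. z A + w A) = (\<Sum>i<N + M. if i < N then B (x i) (y i) else B (x' (i - N)) (y' (i - N)))"
      unfolding L[OF represents_append[OF z w]] by (intro sum.cong) auto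
    also have "\<dots> = L z + L w"
      unfolding L[OF z] L[OF w] by (rule sum_lessThan_append)
    finally show "L (z \<oplus>\<^bsub>alg_tensor X Y\<^esub> w) = L z + L w" by (simp add: alg_tensor_def)
  next
    fix x y assume "x \<in> carrier X" "y \<in> carrier Y"
    then have "represents X Y 1 (\<lambda>_. x) (\<lambda>_. y) (elem_tensor X Y x y)"
      by (simp add: represents_def)
    from L[OF this] show "L (elem_tensor X Y x y) = B x y" by simp
  qed
qed

lemma elem_tensor_bilinear:
  assumes "x \<in> carrier X" "x' \<in> carrier X" "y \<in> carrier Y" "y' \<in> carrier Y"
  shows "elem_tensor X Y (x \<oplus>\<^bsub>X\<^esub> x') y =
      elem_tensor X Y x y \<oplus>\<^bsub>alg_tensor X Y\<^esub> elem_tensor X Y x' y"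
    and "elem_tensor X Y x (y \<oplus>\<^bsub>Y\<^esub> y') =
      elem_tensor X Y x y \<oplus>\<^bsub>alg_tensor X Y\<^esub> elem_tensor X Y x y'"
    and "elem_tensor X Y (c \<odot>\<^bsub>X\<^esub> x) y = c \<odot>\<^bsub>alg_tensor X Y\<^esub> elem_tensor X Y x y"
    and "elem_tensor X Y x (c \<odot>\<^bsub>Y\<^esub> y) = c \<odot>\<^bsub>alg_tensor X Y\<^esub> elem_tensor X Y x y"
  using assms by (auto simp: fun_eq_iff alg_tensor_def elem_tensor_def bilinear_forms_def)

end


section \<open>The sequence spaces are Banach spaces\<close>

locale lp =
  fixes p :: real
  assumes p: "1 \<le> p"
begin

abbreviation "L \<equiv> lp_space p"

lemma lp_carrier: "x \<in> carrier L \<longleftrightarrow> summable (\<lambda>n. \<bar>x n\<bar> powr p)"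
  by (simp add: lp_space_def)

lemma lp_norm: "vnorm L x = (\<Sum>n. \<bar>x n\<bar> powr p) powr (1 / p)"
  by (simp add: lp_space_def)

lemma lp_ops [simp]:
  "x \<oplus>\<^bsub>L\<^esub> y = (\<lambda>n. x n + y n)" "c \<odot>\<^bsub>L\<^esub> x = (\<lambda>n. c * x n)" "\<zero>\<^bsub>L\<^esub> = (\<lambda>n. 0)"
  by (simp_all add: lp_space_def)

lemma lp_norm_nonneg: "0 \<le> vnorm L x"
  by (simp add: lp_norm)

lemma lp_norm_powr:
  assumes "x \<in> carrier L" shows "vnorm L x powr p = (\<Sum>n. \<bar>x n\<bar> powr p)"
  using assms p by (simp add: lp_norm powr_powr lp_carrier suminf_nonneg)

lemma coord_le:
  assumes "x \<in> carrier L" shows "\<bar>x n\<bar> \<le> vnorm L x"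
proof -
  have "\<bar>x n\<bar> powr p \<le> (\<Sum>n. \<bar>x n\<bar> powr p)"
    using sum_le_suminf[of "\<lambda>n. \<bar>x n\<bar> powr p" "{n}"] assms by (simp add: lp_carrier)
  then have "\<bar>x n\<bar> powr p \<le> vnorm L x powr p" using assms by (simp add: lp_norm_powr)
  then show ?thesis using p lp_norm_nonneg[of x]
    by (meson abs_ge_zero linorder_not_less powr_less_mono2 less_le_trans zero_less_one)
qed

lemma partial_imp_norm:
  assumes "0 \<le> B" "\<And>N. (\<Sum>n<N. \<bar>x n\<bar> powr p) \<le> B powr p"
  shows "x \<in> carrier L" "vnorm L x \<le> B"
proof -
  have s: "summable (\<lambda>n. \<bar>x n\<bar> powr p)"
    by (rule summableI_nonneg_bounded[OF _ assms(2)]) auto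
  then show x: "x \<in> carrier L" by (simp add: lp_carrier)
  have "vnorm L x powr p \<le> B powr p"
    unfolding lp_norm_powr[OF x] by (rule suminf_le_const[OF s assms(2)])
  then show "vnorm L x \<le> B" using p assms(1)
    by (meson linorder_not_less powr_less_mono2 less_le_trans zero_less_one)
qed

lemma partial_le: 
  assumes "x \<in> carrier L" "vnorm L x \<le> B" shows "(\<Sum>n<N. \<bar>x n\<bar> powr p) \<le> B powr p"
proof -
  have "(\<Sum>n<N. \<bar>x n\<bar> powr p) \<le> vnorm L x powr p"
    unfolding lp_norm_powr[OF assms(1)] using assms(1) by (intro sum_le_suminf) (auto simp: lp_carrier)
  also have "\<dots> \<le> B powr p" using assms p lp_norm_nonneg by (intro powr_mono2) auto
  finally show ?thesis .
qed

lemma powr_convex_comb: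
  assumes "0 \<le> s" "0 \<le> t" "0 < a" "0 < b"
  shows "(s + t) powr p \<le>
    (a + b) powr p * (a / (a + b) * (s / a) powr p + b / (a + b) * (t / b) powr p)"
proof -
  have c: "(u * S + v * T) powr p \<le> u * S powr p + v * T powr p"
    if "0 < u" "0 < v" "u + v = 1" "0 \<le> S" "0 \<le> T" for u v S T :: real
  proof -
    consider "S = 0" | "T = 0" | "S > 0" "T > 0" using \<open>0 \<le> S\<close> \<open>0 \<le> T\<close> by linarith
    then show ?thesis
    proof cases
      case 1
      have "v powr p \<le> v powr 1" using powr_mono'[of 1 p v] that p by simp
      then have "v powr p * T powr p \<le> v * T powr p" using that by (intro mult_right_mono) simp_all
      then show ?thesis using 1 that p by (simp add: powr_mult)
    next
      case 2
      have "u powr p \<le> u powr 1" using powr_mono'[of 1 p u] that p by simp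
      then have "u powr p * S powr p \<le> u * S powr p" using that by (intro mult_right_mono) simp_all
      then show ?thesis using 2 that p by (simp add: powr_mult)
    next
      case 3
      have u: "u = 1 - v" using that by simp
      show ?thesis
        using convex_onD[OF powr_convex[OF p], of v S T] that 3 unfolding u by simp
    qed
  qed
  have "a / (a + b) * (s / a) = s / (a + b)" "b / (a + b) * (t / b) = t / (a + b)"
    using assms by simp_all
  then have "s + t = (a + b) * (a / (a + b) * (s / a) + b / (a + b) * (t / b))"
    using assms by (simp flip: add_divide_distrib)
  then have "(s + t) powr p = ((a + b) * (a / (a + b) * (s / a) + b / (a + b) * (t / b))) powr p"
    by (rule arg_cong)
  also have "\<dots> = (a + b) powr p * (a / (a + b) * (s / a) + b / (a + b) * (t / b)) powr p"
    using assms by (simp only: powr_mult)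
  also have "\<dots> \<le> (a + b) powr p * (a / (a + b) * (s / a) powr p + b / (a + b) * (t / b) powr p)"
  proof (rule mult_left_mono[OF c])
    show "a / (a + b) + b / (a + b) = 1" using assms by (simp flip: add_divide_distrib)
  qed (use assms in auto)
  finally show ?thesis .
qed

lemma lp_norm_eq_0: "x \<in> carrier L \<Longrightarrow> vnorm L x = 0 \<Longrightarrow> x = (\<lambda>n. 0)"
  using coord_le[of x] by (auto simp: fun_eq_iff)

lemma lp_triangle:
  assumes x: "x \<in> carrier L" and y: "y \<in> carrier L"
  shows "(\<lambda>n. x n + y n) \<in> carrier L \<and> vnorm L (\<lambda>n. x n + y n) \<le> vnorm L x + vnorm L y"
proof -
  consider "vnorm L x = 0" | "vnorm L y = 0" | "vnorm L x > 0" "vnorm L y > 0"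
    using lp_norm_nonneg by (metis less_eq_real_def)
  then show ?thesis
  proof cases
    case 1
    then show ?thesis using lp_norm_eq_0[OF x] y by simp
  next
    case 2
    then show ?thesis using lp_norm_eq_0[OF y] x by simp
  next
    case 3
    let ?a = "vnorm L x" and ?b = "vnorm L y"
    have "(\<Sum>n<N. \<bar>x n + y n\<bar> powr p) \<le> (?a + ?b) powr p" for N
    proof -
      have X: "(\<Sum>n<N. (\<bar>x n\<bar> / ?a) powr p) \<le> 1" and Y: "(\<Sum>n<N. (\<bar>y n\<bar> / ?b) powr p) \<le> 1"
        using partial_le[OF x order_refl, of N] partial_le[OF y order_refl, of N] 3
        by (simp_all add: powr_divide flip: sum_divide_distrib)
      have "(\<Sum>n<N. \<bar>x n + y n\<bar> powr p) \<le> (\<Sum>n<N. (\<bar>x n\<bar> + \<bar>y n\<bar>) powr p)"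
        using p by (intro sum_mono powr_mono2) auto
      also have "\<dots> \<le> (\<Sum>n<N. (?a + ?b) powr p *
          (?a / (?a + ?b) * (\<bar>x n\<bar> / ?a) powr p + ?b / (?a + ?b) * (\<bar>y n\<bar> / ?b) powr p))"
        using 3 by (intro sum_mono powr_convex_comb) auto
      also have "\<dots> = (?a + ?b) powr p * (?a / (?a + ?b) * (\<Sum>n<N. (\<bar>x n\<bar> / ?a) powr p) +
          ?b / (?a + ?b) * (\<Sum>n<N. (\<bar>y n\<bar> / ?b) powr p))"
        by (simp only: sum_distrib_left[symmetric] sum.distrib)
      also have "\<dots> \<le> (?a + ?b) powr p * (?a / (?a + ?b) * 1 + ?b / (?a + ?b) * 1)"
        using X Y 3 by (intro mult_left_mono add_mono) auto
      also have "\<dots> = (?a + ?b) powr p" using 3 by (simp flip: add_divide_distrib)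
      finally show ?thesis .
    qed
    from partial_imp_norm[OF _ this] show ?thesis using 3 by auto
  qed
qed

lemma lp_smult:
  assumes "x \<in> carrier L"
  shows "(\<lambda>n. c * x n) \<in> carrier L" "vnorm L (\<lambda>n. c * x n) = \<bar>c\<bar> * vnorm L x"
  using assms p
  by (auto simp: lp_carrier lp_norm abs_mult powr_mult suminf_mult powr_powr suminf_nonneg
      intro!: summable_mult)

lemma lp_zero: "(\<lambda>n. 0) \<in> carrier L"
  by (simp add: lp_carrier)

lemma seminormed_lp: "seminormed_space L"
proof (intro seminormed_space.intro seminormed_space_axioms.intro)
  show "Module.module real_field L"
    unfolding lp_space_def
    by (rule module_funs) (use lp_triangle lp_smult lp_zero in \<open>auto simp flip: lp_carrier\<close>)
qed (use lp_triangle lp_smult in auto)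

lemma lp_minus: "x \<in> carrier L \<Longrightarrow> y \<in> carrier L \<Longrightarrow> x \<ominus>\<^bsub>L\<^esub> y = (\<lambda>n. x n - y n)"
proof -
  interpret seminormed_space L by (rule seminormed_lp)
  assume "x \<in> carrier L" "y \<in> carrier L"
  then show ?thesis by (simp add: M.minus_eq uminus_smult)
qed

theorem banach_lp: "banach_space L"
proof (intro banach_space.intro normed_space.intro seminormed_lp
    normed_space_axioms.intro banach_space_axioms.intro)
  show "x = \<zero>\<^bsub>L\<^esub>" if "x \<in> carrier L" "vnorm L x = 0" for x
    using lp_norm_eq_0 that by simp
next
  fix S assume S: "cauchy_seq L S"
  have Sin: "S k \<in> carrier L" for k using S by (simp add: cauchy_seq_def)
  interpret seminormed_space L by (rule seminormed_lp)
  have C: "\<exists>N. \<forall>m\<ge>N. \<forall>n\<ge>N. vnorm L (\<lambda>i. S m i - S n i) < e" if "e > 0" for e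
    using CauD[OF S that] by (simp add: lp_minus Sin)
  have din: "(\<lambda>i. S m i - S n i) \<in> carrier L" for m n
    using M.minus_closed[OF Sin[of m] Sin[of n]] by (simp add: lp_minus Sin)
  have "convergent (\<lambda>k. S k i)" for i
  proof (rule Cauchy_convergent, rule metric_CauchyI)
    fix e :: real assume "e > 0"
    then obtain N where N: "\<And>m n. m \<ge> N \<Longrightarrow> n \<ge> N \<Longrightarrow> vnorm L (\<lambda>i. S m i - S n i) < e"
      using C by blast
    have "dist (S m i) (S n i) < e" if "m \<ge> N" "n \<ge> N" for m n
      using coord_le[OF din[of m n], of i] N[OF that] by (simp add: dist_real_def)
    then show "\<exists>N. \<forall>m\<ge>N. \<forall>n\<ge>N. dist (S m i) (S n i) < e" by blast
  qed
  then obtain l where l: "\<And>i. (\<lambda>k. S k i) \<longlonglongrightarrow> l i"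
    unfolding convergent_def by metis
  have key: "\<exists>N. \<forall>k\<ge>N. (\<lambda>i. S k i - l i) \<in> carrier L \<and> vnorm L (\<lambda>i. S k i - l i) \<le> e" if e: "e > 0" for e
  proof -
    obtain N where N: "\<And>m n. m \<ge> N \<Longrightarrow> n \<ge> N \<Longrightarrow> vnorm L (\<lambda>i. S m i - S n i) < e"
      using C[OF e] by blast
    have "(\<Sum>i<M. \<bar>S k i - l i\<bar> powr p) \<le> e powr p" if k: "k \<ge> N" for k M
    proof (rule LIMSEQ_le_const2)
      show "(\<lambda>m. \<Sum>i<M. \<bar>S k i - S m i\<bar> powr p) \<longlonglongrightarrow> (\<Sum>i<M. \<bar>S k i - l i\<bar> powr p)"
        using p by (intro tendsto_sum tendsto_powr' tendsto_rabs tendsto_diff tendsto_const l) auto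
      show "\<exists>m0. \<forall>m\<ge>m0. (\<Sum>i<M. \<bar>S k i - S m i\<bar> powr p) \<le> e powr p"
        using partial_le[OF din less_imp_le[OF N[OF k]]] by blast
    qed
    from partial_imp_norm[OF _ this] show ?thesis using e by (intro exI[of _ N]) auto
  qed
  obtain k where "(\<lambda>i. S k i - l i) \<in> carrier L" using key[of 1] by auto
  from M.minus_closed[OF Sin[of k] this] have lin: "l \<in> carrier L"
    by (simp add: lp_minus[OF Sin[of k] \<open>(\<lambda>i. S k i - l i) \<in> carrier L\<close>])
  show "\<exists>l\<in>carrier L. (\<lambda>n. vnorm L (S n \<ominus>\<^bsub>L\<^esub> l)) \<longlonglongrightarrow> 0"
  proof (rule bexI[OF _ lin], rule LIMSEQ_I)
    fix r :: real assume "r > 0"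
    then obtain N where "\<forall>k\<ge>N. vnorm L (\<lambda>i. S k i - l i) \<le> r / 2" using key[of "r/2"] by auto
    then show "\<exists>N. \<forall>n\<ge>N. norm (vnorm L (S n \<ominus>\<^bsub>L\<^esub> l) - 0) < r"
      using \<open>r > 0\<close> lp_norm_nonneg by (intro exI[of _ N]) (auto simp: lp_minus Sin lin intro: le_less_trans)
  qed
qed

end


end

(*
  Let t be the conjugate exponent of p. The space X consists of the infinite matrices x whose n x n
  truncations factor as x i j = <a i, b j> with the l_t-norms of (|a i|^2) and (|b j|^2) bounded by r,
  uniformly in n; the norm is the least such r. It interpolates between the trace norm (t = 1) and the
  Schur multiplier norm gamma_2 (t = infinity).

  X has cotype 2 t because its complexification is uniformly PL-convex: near-optimal factorizations of
  x + theta y, averaged over primitive eighth roots of unity theta, glue to a near-optimal factorization of x in which y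
  has to be small.

  The tensor product with l_p fails finite cotype by the argument of Briet, Naor and Regev. The forms
  (c, x) -> sum_w c_w x(sigma w, tau w), for injective sigma and tau, have norm at most 1 on l_p x X,
  while c (x) (a (x) b) has norm at most n for unimodular c, a, b of length n. A 3-query locally
  decodable code of length n encoding k bits therefore gives k tensors of norm at least a constant
  times n whose signed sums are the first order parts of a function on the cube with values of norm at most
  2 n. Extracting the first order part costs a factor polynomial in log n, and matching vector codes
  have k larger than any given power of log n.
*)

theory Submission
  imports Defs
begin

section \<open>Minkowski inequality and finite-dimensional Hermitian forms\<close>

text \<open>The exponent t serves two estimates at once: entries of x along a partial permutation
  are bounded in l_t and pair with c in l_p, and a unimodular rank-one tensor costs n^(1/p) *
  n^(1/t) = n. The cotype exponent 2 t is finite because p > 1 and blows up as p decreases to 1.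
  Primitive eighth roots are taken because their real and imaginary parts are independent signs over
  sqrt 2: a mean over them is a mean over two real signs, so complex convexity yields real cotype.
  Three queries match the three factors c, a, b. The modulus 35 is composite because, for a fixed
  prime modulus, the number of matching vectors is at most a fixed power of the dimension H, whereas
  refuting cotype q needs k to exceed H^(2 q) for every q. The first order part is a derivative at 0
  in a noise parameter. The function is a polynomial in that parameter of degree up to k, and a
  derivative formula of degree k would cost a power of k. So entries with more than L active phases,
  L of order log n, are set to 0; there the noisy function is at most n^(-2), and a bound by the sum
  of all entries suffices.\<close>

lemma lp_cutoff:
  assumes "1 \<le> p"
  shows "(\<lambda>i. if i < n then u i else 0) \<in> carrier (lp_space p)"
    and "vnorm (lp_space p) (\<lambda>i. if i < n then u i else 0) = (\<Sum>i<n. \<bar>u i\<bar> powr p) powr (1 / p)"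
proof -
  interpret lp p by unfold_locales fact
  have s: "(\<lambda>i. \<bar>if i < n then u i else 0\<bar> powr p) sums (\<Sum>i<n. \<bar>if i < n then u i else 0\<bar> powr p)"
    by (rule sums_finite) auto
  show "(\<lambda>i. if i < n then u i else 0) \<in> carrier (lp_space p)"
    using s by (simp add: lp_carrier sums_iff)
  show "vnorm (lp_space p) (\<lambda>i. if i < n then u i else 0) = (\<Sum>i<n. \<bar>u i\<bar> powr p) powr (1 / p)"
    using s by (simp add: lp_norm sums_iff)
qed

lemma powr_le_iff_base:
  fixes x y p :: real
  assumes "0 < p" "0 \<le> x" "0 \<le> y"
  shows "x powr p \<le> y powr p \<longleftrightarrow> x \<le> y"
  using assms by (meson linorder_not_less powr_less_mono2 powr_mono2 less_imp_le)

lemma minkowski_sum2: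
  fixes u v :: "nat \<Rightarrow> real"
  assumes "1 \<le> p" "\<And>i. i < n \<Longrightarrow> 0 \<le> u i" "\<And>i. i < n \<Longrightarrow> 0 \<le> v i"
  shows "(\<Sum>i<n. (u i + v i) powr p) powr (1 / p)
    \<le> (\<Sum>i<n. u i powr p) powr (1 / p) + (\<Sum>i<n. v i powr p) powr (1 / p)"
proof -
  interpret lp p by unfold_locales fact
  have e: "(\<lambda>i. (if i < n then u i else 0) + (if i < n then v i else 0)) = (\<lambda>i. if i < n then u i + v i else 0)"
    by auto
  have a: "(\<Sum>i<n. \<bar>w i\<bar> powr p) = (\<Sum>i<n. w i powr p)" if "\<And>i. i < n \<Longrightarrow> 0 \<le> w i" for w
    using that by (intro sum.cong) auto
  show ?thesis
    using lp_triangle[OF lp_cutoff(1)[OF assms(1)] lp_cutoff(1)[OF assms(1)], of n u n v]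
    unfolding e lp_cutoff(2)[OF assms(1)] using assms by (simp add: a)
qed

lemma minkowski_bound2:
  fixes u v :: "nat \<Rightarrow> real"
  assumes "1 \<le> p" "\<And>i. i < n \<Longrightarrow> 0 \<le> u i" "\<And>i. i < n \<Longrightarrow> 0 \<le> v i" "0 \<le> r" "0 \<le> s"
    and "(\<Sum>i<n. u i powr p) \<le> r powr p" "(\<Sum>i<n. v i powr p) \<le> s powr p"
  shows "(\<Sum>i<n. (u i + v i) powr p) \<le> (r + s) powr p"
proof -
  have root: "x powr (1 / p) \<le> y" if "x \<le> y powr p" "0 \<le> x" "0 \<le> y" for x y :: real
    using powr_mono2[OF _ that(2,1), of "1 / p"] assms(1) that by (simp add: powr_powr)
  have "(\<Sum>i<n. (u i + v i) powr p) powr (1 / p) \<le> r + s"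
    using minkowski_sum2[of p n u v] assms root[OF assms(6)] root[OF assms(7)]
    by (simp add: sum_nonneg)
  then have "((\<Sum>i<n. (u i + v i) powr p) powr (1 / p)) powr p \<le> (r + s) powr p"
    using assms by (intro powr_mono2) auto
  then show ?thesis using assms by (simp add: powr_powr sum_nonneg)
qed

text \<open>The hypotheses have the shape of the constraints in \<open>factors\<close>, so that the
  bounds of several factorizations add up when these are put side by side.\<close>

lemma minkowski_bound:
  fixes u :: "'k \<Rightarrow> nat \<Rightarrow> real"
  assumes "1 \<le> p" "finite T" "\<And>k i. k \<in> T \<Longrightarrow> i < n \<Longrightarrow> 0 \<le> u k i" "\<And>k. k \<in> T \<Longrightarrow> 0 \<le> r k"
    and "\<And>k. k \<in> T \<Longrightarrow> (\<Sum>i<n. u k i powr p) \<le> r k powr p"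
  shows "(\<Sum>i<n. (\<Sum>k\<in>T. u k i) powr p) \<le> (\<Sum>k\<in>T. r k) powr p"
  using assms(2-)
proof (induction T)
  case (insert k T)
  then show ?case
    using minkowski_bound2[OF assms(1), of n "u k" "\<lambda>i. \<Sum>k\<in>T. u k i" "r k" "\<Sum>k\<in>T. r k"]
    by (simp add: sum_nonneg)
qed simp

text \<open>Minkowski's inequality in \<open>\<ell>_s\<close> of dimension 2, for the mean of the vectors \<open>(u a, c)\<close>.\<close>

lemma mean_minkowski:
  fixes u :: "'k \<Rightarrow> real"
  assumes "1 \<le> s" "finite A" "A \<noteq> {}" "\<And>a. a \<in> A \<Longrightarrow> 0 \<le> u a" "0 \<le> c"
  shows "(((\<Sum>a\<in>A. u a) / card A) powr s + c powr s) powr (1 / s)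
    \<le> (\<Sum>a\<in>A. (u a powr s + c powr s) powr (1 / s)) / card A"
proof -
  have pos: "0 < card A" using assms by (simp add: card_gt_0_iff)
  define w where "w a i = (if i = 0 then u a else c)" for a and i :: nat
  define r where "r a = (u a powr s + c powr s) powr (1 / s)" for a
  have "(\<Sum>i<2. (\<Sum>a\<in>A. w a i) powr s) \<le> (\<Sum>a\<in>A. r a) powr s"
    by (rule minkowski_bound) (use assms in \<open>auto simp: w_def r_def powr_powr numeral_2_eq_2\<close>)
  then have "(\<Sum>a\<in>A. u a) powr s + (card A * c) powr s \<le> (\<Sum>a\<in>A. r a) powr s"
    by (simp add: w_def numeral_2_eq_2)
  then have "((\<Sum>a\<in>A. u a) powr s + (card A * c) powr s) / card A powr s \<le> (\<Sum>a\<in>A. r a) powr s / card A powr s"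
    by (rule divide_right_mono) simp
  then have "((\<Sum>a\<in>A. u a) / card A) powr s + c powr s \<le> ((\<Sum>a\<in>A. r a) / card A) powr s"
    using pos assms by (simp add: powr_divide powr_mult sum_nonneg r_def add_divide_distrib)
  then have "(((\<Sum>a\<in>A. u a) / card A) powr s + c powr s) powr (1/s) \<le> (((\<Sum>a\<in>A. r a) / card A) powr s) powr (1/s)"
    using assms by (intro powr_mono2) auto
  also have "\<dots> = (\<Sum>a\<in>A. r a) / card A"
    using assms by (simp add: powr_powr sum_nonneg r_def)
  finally show ?thesis by (simp add: r_def)
qed

section \<open>Hermitian forms over a finite index set\<close>

definition herm :: "'c set \<Rightarrow> ('c \<Rightarrow> complex) \<Rightarrow> ('c \<Rightarrow> complex) \<Rightarrow> complex" where
  "herm I u v = (\<Sum>m\<in>I. u m * cnj (v m))"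

definition nsq :: "'c set \<Rightarrow> ('c \<Rightarrow> complex) \<Rightarrow> real" where
  "nsq I u = (\<Sum>m\<in>I. (cmod (u m))\<^sup>2)"

lemma nsq_nonneg [simp]: "0 \<le> nsq I u"
  by (simp add: nsq_def sum_nonneg)

lemma herm_self: "herm I u u = of_real (nsq I u)"
  unfolding herm_def nsq_def of_real_sum by (intro sum.cong) (simp_all only: complex_norm_square)

lemma herm_cnj: "cnj (herm I u v) = herm I v u"
  by (simp add: herm_def mult.commute)

lemma herm_add_left: "herm I (\<lambda>m. u m + v m) w = herm I u w + herm I v w"
  by (simp add: herm_def distrib_right sum.distrib)

lemma herm_diff_left: "herm I (\<lambda>m. u m - v m) w = herm I u w - herm I v w"
  by (simp add: herm_def left_diff_distrib sum_subtractf)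

lemma herm_add_right: "herm I w (\<lambda>m. u m + v m) = herm I w u + herm I w v"
  by (simp add: herm_def distrib_left sum.distrib)

lemma herm_scale_left: "herm I (\<lambda>m. c * u m) w = c * herm I u w"
  by (simp add: herm_def sum_distrib_left mult.assoc)

lemma herm_scale_right: "herm I w (\<lambda>m. c * u m) = cnj c * herm I w u"
  by (simp add: herm_def sum_distrib_left mult_ac)

lemma herm_sum_left: "herm I (\<lambda>m. \<Sum>j\<in>J. c j * u j m) w = (\<Sum>j\<in>J. c j * herm I (u j) w)"
  by (simp add: herm_def sum_distrib_left sum_distrib_right mult.assoc sum.swap[of _ J])

lemma herm_sum_right: "herm I w (\<lambda>m. \<Sum>j\<in>J. c j * u j m) = (\<Sum>j\<in>J. cnj (c j) * herm I w (u j))"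
  by (simp add: herm_def sum_distrib_left mult_ac sum.swap[of _ J])

lemma nsq_eq_0: "finite I \<Longrightarrow> nsq I u = 0 \<Longrightarrow> m \<in> I \<Longrightarrow> u m = 0"
  by (simp add: nsq_def sum_nonneg_eq_0_iff)

lemma herm_eq_0: "finite I \<Longrightarrow> nsq I u = 0 \<Longrightarrow> herm I u v = 0 \<and> herm I v u = 0"
  by (auto simp: herm_def dest: nsq_eq_0 intro!: sum.neutral)

lemma nsq_add_orth:
  assumes "herm I u v = 0"
  shows "nsq I (\<lambda>m. u m + v m) = nsq I u + nsq I v"
proof -
  have "herm I v u = 0" using assms herm_cnj[of I u v] by simp
  then have "complex_of_real (nsq I (\<lambda>m. u m + v m)) = of_real (nsq I u + nsq I v)"
    using assms by (simp add: herm_self[symmetric] herm_add_left herm_add_right)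
  then show ?thesis by (simp only: of_real_eq_iff)
qed

lemma nsq_scale: "nsq I (\<lambda>m. c * u m) = (cmod c)\<^sup>2 * nsq I u"
  by (simp add: nsq_def norm_mult power_mult_distrib sum_distrib_left)

lemma herm_le: "cmod (herm I u v) \<le> sqrt (nsq I u) * sqrt (nsq I v)"
proof -
  have "cmod (herm I u v) \<le> (\<Sum>m\<in>I. \<bar>cmod (u m)\<bar> * \<bar>cmod (v m)\<bar>)"
    unfolding herm_def by (rule order_trans[OF norm_sum]) (simp add: norm_mult)
  also have "\<dots> \<le> sqrt (nsq I u) * sqrt (nsq I v)"
    using L2_set_mult_ineq[of "\<lambda>m. cmod (u m)" "\<lambda>m. cmod (v m)" I] by (simp add: L2_set_def nsq_def)
  finally show ?thesis .
qed

text \<open>Gram-Schmidt without linear independence. The induction is over all a because the step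
  projects both a and the new vector \<open>b n\<close> onto the span of the earlier ones.\<close>

lemma orthogonal_projection:
  assumes "finite I"
  shows "\<exists>c. \<forall>j<n. herm I (\<lambda>m. a m - (\<Sum>l<n. c l * b l m)) (b (j::nat)) = 0"
proof (induction n arbitrary: a)
  case (Suc n)
  obtain c where c: "\<And>j. j < n \<Longrightarrow> herm I (\<lambda>m. a m - (\<Sum>l<n. c l * b l m)) (b j) = 0"
    using Suc by blast
  obtain d where d: "\<And>j. j < n \<Longrightarrow> herm I (\<lambda>m. b n m - (\<Sum>l<n. d l * b l m)) (b j) = 0"
    using Suc by blast
  define e where "e m = b n m - (\<Sum>l<n. d l * b l m)" for m
  define r where "r m = a m - (\<Sum>l<n. c l * b l m)" for m
  have bn: "b n = (\<lambda>m. e m + (\<Sum>l<n. d l * b l m))" by (simp add: e_def)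
  have re: "herm I u (b n) = herm I u e" if "\<And>j. j < n \<Longrightarrow> herm I u (b j) = 0" for u
    unfolding bn herm_add_right herm_sum_right using that by simp
  \<comment> \<open>If \<open>b n\<close> depends on the earlier vectors, then
    \<open>nsq I e = 0\<close> and division by zero gives k = 0; this is right because e vanishes on
    I.\<close>
  define k where "k = herm I r e / of_real (nsq I e)"
  define c' where "c' l = (if l = n then k else c l - k * d l)" for l
  have eq: "(\<lambda>m. a m - (\<Sum>l<Suc n. c' l * b l m)) = (\<lambda>m. r m - k * e m)"
    by (simp add: c'_def r_def e_def left_diff_distrib right_diff_distrib sum_subtractf sum_distrib_left
        mult.assoc fun_eq_iff)
  have "herm I (\<lambda>m. r m - k * e m) (b j) = 0" if "j < Suc n" for j
  proof (cases "j = n")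
    case False
    then show ?thesis using that c[of j] d[of j]
      by (simp add: herm_diff_left herm_scale_left r_def[abs_def, symmetric] e_def[abs_def, symmetric])
  next
    case True
    have "herm I r e = k * herm I e e"
      using herm_eq_0[OF assms, of e r] by (simp add: k_def herm_self)
    then show ?thesis
      using True re[OF c] re[OF d]
      by (simp add: herm_diff_left herm_scale_left r_def[abs_def, symmetric] e_def[abs_def, symmetric])
  qed
  then show ?case using eq by (intro exI[of _ c']) simp
qed simp

section \<open>The factorization norm\<close>

text \<open>The dimension d is free, so factorizations can be glued to orthogonal direct sums. The
  bounds concern squared norms, so r scales like x although x is quadratic in the pair (a,
  b).\<close>

definition factors :: "real \<Rightarrow> nat \<Rightarrow> real \<Rightarrow> (nat \<Rightarrow> nat \<Rightarrow> complex) \<Rightarrow> bool" where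
  "factors t n r x \<longleftrightarrow> (\<exists>(d::nat) a b.
     (\<forall>i<n. \<forall>j<n. x i j = herm {..<d} (a i) (b j)) \<and>
     (\<Sum>i<n. nsq {..<d} (a i) powr t) \<le> r powr t \<and> (\<Sum>j<n. nsq {..<d} (b j) powr t) \<le> r powr t)"

definition fnorm :: "real \<Rightarrow> nat \<Rightarrow> (nat \<Rightarrow> nat \<Rightarrow> complex) \<Rightarrow> real" where
  "fnorm t n x = Inf {r. 0 \<le> r \<and> factors t n r x}"

text \<open>Arbitrary finite index sets are allowed here because direct sums are indexed by
  dependent pairs.\<close>

lemma factorsI:
  fixes I :: "'c set"
  assumes "finite I" "\<And>i j. i < n \<Longrightarrow> j < n \<Longrightarrow> x i j = herm I (a i) (b j)"
    and "(\<Sum>i<n. nsq I (a i) powr t) \<le> r powr t" "(\<Sum>j<n. nsq I (b j) powr t) \<le> r powr t"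
  shows "factors t n r x"
proof -
  obtain g where g: "bij_betw g {..<card I} I"
    using ex_bij_betw_nat_finite[OF assms(1)] by (auto simp: atLeast0LessThan)
  have h: "herm {..<card I} (\<lambda>m. u (g m)) (\<lambda>m. v (g m)) = herm I u v" for u v :: "'c \<Rightarrow> complex"
    unfolding herm_def by (rule sum.reindex_bij_betw[OF g])
  have q: "nsq {..<card I} (\<lambda>m. u (g m)) = nsq I u" for u :: "'c \<Rightarrow> complex"
    unfolding nsq_def by (rule sum.reindex_bij_betw[OF g])
  show ?thesis unfolding factors_def
    by (rule exI[of _ "card I"], rule exI[of _ "\<lambda>i m. a i (g m)"], rule exI[of _ "\<lambda>j m. b j (g m)"])
      (use assms in \<open>simp add: h q\<close>)
qed

lemma factors_cong: "factors t n r x \<Longrightarrow> (\<And>i j. i < n \<Longrightarrow> j < n \<Longrightarrow> x i j = y i j) \<Longrightarrow> factors t n r y"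
  by (simp add: factors_def)

lemma factors_mono:
  assumes "factors t n r x" "0 \<le> r" "r \<le> s" "0 \<le> t"
  shows "factors t n s x"
proof -
  have "r powr t \<le> s powr t" using assms by (intro powr_mono2) auto
  then show ?thesis using assms(1) unfolding factors_def by (meson order_trans)
qed

lemma factors_restrict:
  assumes "factors t n r x" "m \<le> n"
  shows "factors t m r x"
proof -
  have le: "(\<Sum>i<m. f i powr t) \<le> (\<Sum>i<n. f i powr t)" for f :: "nat \<Rightarrow> real"
    using assms(2) by (intro sum_mono2) auto
  from assms(1) obtain d :: nat and a b where
    "\<forall>i<n. \<forall>j<n. x i j = herm {..<d} (a i) (b j)"
    "(\<Sum>i<n. nsq {..<d} (a i) powr t) \<le> r powr t" "(\<Sum>j<n. nsq {..<d} (b j) powr t) \<le> r powr t"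
    unfolding factors_def by blast
  then show ?thesis unfolding factors_def using assms(2)
    by (intro exI[of _ d] exI[of _ a] exI[of _ b]) (auto intro: order_trans[OF le])
qed

text \<open>Factorizations of the summands act on orthogonal blocks. Forms and squared norms then
  add over the blocks, and Minkowski's inequality in l_t bounds the result.\<close>

lemma factors_sum:
  fixes x :: "'k \<Rightarrow> nat \<Rightarrow> nat \<Rightarrow> complex"
  assumes t: "1 \<le> t" and T: "finite T" "\<And>k. k \<in> T \<Longrightarrow> 0 \<le> r k" "\<And>k. k \<in> T \<Longrightarrow> factors t n (r k) (x k)"
  shows "factors t n (\<Sum>k\<in>T. r k) (\<lambda>i j. \<Sum>k\<in>T. x k i j)"
proof -
  obtain d a b where f: "\<And>k. k \<in> T \<Longrightarrow>
     (\<forall>i<n. \<forall>j<n. x k i j = herm {..<d k :: nat} (a k i) (b k j)) \<and>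
     (\<Sum>i<n. nsq {..<d k} (a k i) powr t) \<le> r k powr t \<and> (\<Sum>j<n. nsq {..<d k} (b k j) powr t) \<le> r k powr t"
    using T(3) unfolding factors_def by metis
  define I where "I = Sigma T (\<lambda>k. {..<d k})"
  have h: "herm I (\<lambda>(k,m). u k m) (\<lambda>(k,m). v k m) = (\<Sum>k\<in>T. herm {..<d k} (u k) (v k))" for u v
    unfolding herm_def I_def by (subst sum.Sigma) (auto simp: T(1) split_beta)
  have q: "nsq I (\<lambda>(k,m). u k m) = (\<Sum>k\<in>T. nsq {..<d k} (u k))" for u
    unfolding nsq_def I_def by (subst sum.Sigma) (auto simp: T(1) split_beta)
  show ?thesis
  proof (rule factorsI[of I])
    show "finite I" by (simp add: I_def T(1))
    show "(\<Sum>k\<in>T. x k i j) = herm I (\<lambda>(k,m). a k i m) (\<lambda>(k,m). b k j m)" if "i < n" "j < n" for i j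
      unfolding h using f that by (intro sum.cong) auto
    show "(\<Sum>i<n. nsq I (\<lambda>(k,m). a k i m) powr t) \<le> (\<Sum>k\<in>T. r k) powr t"
      unfolding q by (rule minkowski_bound[OF t T(1)]) (use f T(2) in auto)
    show "(\<Sum>i<n. nsq I (\<lambda>(k,m). b k i m) powr t) \<le> (\<Sum>k\<in>T. r k) powr t"
      unfolding q by (rule minkowski_bound[OF t T(1)]) (use f T(2) in auto)
  qed
qed

text \<open>Scaling a by l and b by 1 / l keeps the products; l is chosen so that both bounds become
  the geometric mean. If one bound is 0, then x vanishes.\<close>

lemma factors_unbalanced:
  fixes I :: "'c set"
  assumes t: "1 \<le> t" and I: "finite I" and x: "\<And>i j. i < n \<Longrightarrow> j < n \<Longrightarrow> x i j = herm I (a i) (b j)"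
    and a: "(\<Sum>i<n. nsq I (a i) powr t) \<le> \<alpha> powr t" "0 \<le> \<alpha>"
    and b: "(\<Sum>j<n. nsq I (b j) powr t) \<le> \<beta> powr t" "0 \<le> \<beta>"
  shows "factors t n (sqrt (\<alpha> * \<beta>)) x"
proof (cases "\<alpha> = 0 \<or> \<beta> = 0")
  case True
  have z: "nsq I (c i) = 0" if "(\<Sum>i<n. nsq I (c i) powr t) \<le> 0 powr t" "i < n" for i and c :: "nat \<Rightarrow> 'c \<Rightarrow> complex"
  proof -
    have "(\<Sum>i<n. nsq I (c i) powr t) = 0"
      using that(1) t sum_nonneg[of "{..<n}" "\<lambda>i. nsq I (c i) powr t"] by simp
    then show ?thesis using that(2) by (simp add: sum_nonneg_eq_0_iff)
  qed
  have "x i j = 0" if "i < n" "j < n" for i j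
    using True z[of a i] z[of b j] a b that herm_eq_0[OF I] by (auto simp: x)
  then show ?thesis
    by (intro factorsI[of "{}::nat set" _ _ "\<lambda>_ _. 0" "\<lambda>_ _. 0"]) (auto simp: herm_def nsq_def)
next
  case False
  then have pos: "0 < \<alpha>" "0 < \<beta>" using a b by auto
  \<comment> \<open>A fourth root, because squared norms scale by the square of l.\<close>
  define l where "l = sqrt (sqrt (\<beta> / \<alpha>))"
  have l: "0 < l" "l\<^sup>2 = sqrt (\<beta> / \<alpha>)" using pos by (auto simp: l_def)
  have e1: "l\<^sup>2 * \<alpha> = sqrt (\<alpha> * \<beta>)"
    using pos by (simp add: l real_sqrt_divide real_sqrt_mult real_div_sqrt field_simps)
  have e2: "(1 / l)\<^sup>2 * \<beta> = sqrt (\<alpha> * \<beta>)"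
    using pos by (simp add: power_divide l real_sqrt_divide real_sqrt_mult real_div_sqrt field_simps)
  have s: "(\<Sum>i<n. nsq I (\<lambda>m. of_real k * c i m) powr t) \<le> (k\<^sup>2 * \<gamma>) powr t"
    if "(\<Sum>i<n. nsq I (c i) powr t) \<le> \<gamma> powr t" "0 \<le> \<gamma>" for k \<gamma> and c :: "nat \<Rightarrow> 'c \<Rightarrow> complex"
    using that by (simp add: nsq_scale powr_mult mult_left_mono flip: sum_distrib_left)
  show ?thesis
  proof (rule factorsI[OF I])
    show "x i j = herm I (\<lambda>m. of_real l * a i m) (\<lambda>m. of_real (1 / l) * b j m)" if "i < n" "j < n" for i j
      unfolding herm_scale_left herm_scale_right x[OF that] using l by simp
    show "(\<Sum>i<n. nsq I (\<lambda>m. of_real l * a i m) powr t) \<le> sqrt (\<alpha> * \<beta>) powr t"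
      using s[OF a, of l] unfolding e1 .
    show "(\<Sum>i<n. nsq I (\<lambda>m. of_real (1 / l) * b i m) powr t) \<le> sqrt (\<alpha> * \<beta>) powr t"
      using s[OF b, of "1/l"] unfolding e2 .
  qed
qed

lemma factors_scale:
  assumes t: "1 \<le> t" and "factors t n r x" "0 \<le> r"
  shows "factors t n (cmod c * r) (\<lambda>i j. c * x i j)"
proof -
  obtain d :: nat and a b where f:
    "\<forall>i<n. \<forall>j<n. x i j = herm {..<d} (a i) (b j)"
    "(\<Sum>i<n. nsq {..<d} (a i) powr t) \<le> r powr t" "(\<Sum>j<n. nsq {..<d} (b j) powr t) \<le> r powr t"
    using assms unfolding factors_def by blast
  have "factors t n (sqrt (((cmod c)\<^sup>2 * r) * r)) (\<lambda>i j. c * x i j)"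
  proof (rule factors_unbalanced[OF t, of "{..<d}"])
    show "c * x i j = herm {..<d} (\<lambda>m. c * a i m) (b j)" if "i < n" "j < n" for i j
      using f that by (simp add: herm_scale_left)
    show "(\<Sum>i<n. nsq {..<d} (\<lambda>m. c * a i m) powr t) \<le> ((cmod c)\<^sup>2 * r) powr t"
      using f assms by (simp add: nsq_scale powr_mult mult_left_mono flip: sum_distrib_left)
  qed (use f assms in auto)
  moreover have "sqrt (((cmod c)\<^sup>2 * r) * r) = cmod c * r"
    using assms by (simp add: real_sqrt_mult mult.assoc)
  ultimately show ?thesis by simp
qed

lemma factors_unit:
  assumes "0 \<le> t"
  shows "factors t n 1 (\<lambda>i j. if i = k \<and> j = l then 1 else 0)"
proof (rule factorsI[of "{0::nat}" _ _ "\<lambda>i m. if i = k then 1 else 0" "\<lambda>j m. if j = l then 1 else 0"])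
  have "(\<Sum>i<n. (if i = k then 1 else 0::real) powr t) \<le> 1" for k
  proof -
    have "(\<Sum>i<n. (if i = k then 1 else 0::real) powr t) = (\<Sum>i<n. if i = k then 1 else 0)"
      by (intro sum.cong) auto
    also have "\<dots> \<le> 1" by simp
    finally show ?thesis .
  qed
  moreover have "(cmod (if P then 1 else 0))\<^sup>2 = (if P then 1 else 0)" for P by simp
  ultimately show "(\<Sum>i<n. nsq {0::nat} (\<lambda>m. if i = k then 1 else 0) powr t) \<le> 1 powr t"
    "(\<Sum>i<n. nsq {0::nat} (\<lambda>m. if i = l then 1 else 0) powr t) \<le> 1 powr t"
    by (simp_all add: nsq_def)
qed (auto simp: herm_def)

text \<open>Decomposition into matrix units. It makes the set in \<open>fnorm\<close> nonempty and
  later shows that \<open>fnorm\<close> is continuous under entrywise convergence.\<close>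

lemma factors_entries:
  assumes "1 \<le> t"
  shows "factors t n (\<Sum>k<n. \<Sum>l<n. cmod (x k l)) x"
proof -
  have "factors t n (\<Sum>(k,l)\<in>{..<n}\<times>{..<n}. cmod (x k l) * 1)
    (\<lambda>i j. \<Sum>(k,l)\<in>{..<n}\<times>{..<n}. x k l * (if i = k \<and> j = l then 1 else 0))"
    using factors_sum[OF assms, of "{..<n}\<times>{..<n}" "\<lambda>(k,l). cmod (x k l) * 1" n
        "\<lambda>(k,l) i j. x k l * (if i = k \<and> j = l then 1 else 0)"]
      factors_scale[OF assms factors_unit[of t n]] assms
    by (simp add: split_beta)
  then have "factors t n (\<Sum>k<n. \<Sum>l<n. cmod (x k l))
    (\<lambda>i j. \<Sum>k<n. \<Sum>l<n. x k l * (if i = k \<and> j = l then 1 else 0))"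
    by (simp add: sum.cartesian_product)
  then show ?thesis
  proof (rule factors_cong)
    fix i j assume ij: "i < n" "j < n"
    have "(\<Sum>k<n. \<Sum>l<n. x k l * (if i = k \<and> j = l then 1 else 0)) =
      (\<Sum>k<n. \<Sum>l<n. if j = l then if i = k then x k l else 0 else 0)"
      by (intro sum.cong) auto
    also have "\<dots> = x i j" using ij by simp
    finally show "(\<Sum>k<n. \<Sum>l<n. x k l * (if i = k \<and> j = l then 1 else 0)) = x i j" .
  qed
qed

section \<open>Seminorm properties of \<open>fnorm\<close>\<close>

lemma fnorm_le: "0 \<le> r \<Longrightarrow> factors t n r x \<Longrightarrow> fnorm t n x \<le> r"
  unfolding fnorm_def by (rule cInf_lower) (auto intro: bdd_belowI[of _ 0])

lemma fnorm_set_nonempty: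
  assumes "1 \<le> t" shows "{r. 0 \<le> r \<and> factors t n r x} \<noteq> {}"
proof -
  have "0 \<le> (\<Sum>k<n. \<Sum>l<n. cmod (x k l)) \<and> factors t n (\<Sum>k<n. \<Sum>l<n. cmod (x k l)) x"
    using factors_entries[OF assms] by (simp add: sum_nonneg)
  then show ?thesis by blast
qed

lemma fnorm_nonneg: "1 \<le> t \<Longrightarrow> 0 \<le> fnorm t n x"
  unfolding fnorm_def by (rule cInf_greatest[OF fnorm_set_nonempty]) auto

lemma fnorm_greatest: "1 \<le> t \<Longrightarrow> (\<And>r. 0 \<le> r \<Longrightarrow> factors t n r x \<Longrightarrow> b \<le> r) \<Longrightarrow> b \<le> fnorm t n x"
  unfolding fnorm_def by (rule cInf_greatest[OF fnorm_set_nonempty]) auto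

lemma fnorm_approx:
  assumes "1 \<le> t" "fnorm t n x < r" shows "factors t n r x"
proof -
  obtain s where "0 \<le> s" "factors t n s x" "s < r"
    using cInf_lessD[OF fnorm_set_nonempty[OF assms(1)]] assms(2) unfolding fnorm_def by blast
  then show ?thesis using factors_mono[of t n s x r] assms by simp
qed

lemma fnorm_entries: "1 \<le> t \<Longrightarrow> fnorm t n x \<le> (\<Sum>k<n. \<Sum>l<n. cmod (x k l))"
  by (intro fnorm_le factors_entries sum_nonneg) auto

lemma fnorm_mono: "1 \<le> t \<Longrightarrow> m \<le> n \<Longrightarrow> fnorm t m x \<le> fnorm t n x"
  by (intro fnorm_greatest fnorm_le) (auto dest: factors_restrict)

lemma fnorm_add:
  assumes t: "1 \<le> t"
  shows "fnorm t n (\<lambda>i j. x i j + y i j) \<le> fnorm t n x + fnorm t n y"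
proof (rule field_le_epsilon)
  fix e :: real assume "0 < e"
  then have f: "factors t n (fnorm t n x + e/2) x" "factors t n (fnorm t n y + e/2) y"
    using fnorm_approx[OF t] by simp_all
  have "factors t n (\<Sum>k\<in>(UNIV::bool set). if k then fnorm t n x + e/2 else fnorm t n y + e/2)
     (\<lambda>i j. \<Sum>k\<in>(UNIV::bool set). if k then x i j else y i j)"
    by (rule factors_sum[OF t, of UNIV _ n "\<lambda>k i j. if k then x i j else y i j"])
      (use f fnorm_nonneg[OF t] \<open>0 < e\<close> in \<open>auto simp: add_nonneg_nonneg\<close>)
  then have "factors t n ((fnorm t n x + e/2) + (fnorm t n y + e/2)) (\<lambda>i j. x i j + y i j)"
    by (simp add: UNIV_bool add_ac)
  then have "fnorm t n (\<lambda>i j. x i j + y i j) \<le> (fnorm t n x + e/2) + (fnorm t n y + e/2)"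
    using fnorm_nonneg[OF t, of n x] fnorm_nonneg[OF t, of n y] \<open>0 < e\<close> by (intro fnorm_le) auto
  then show "fnorm t n (\<lambda>i j. x i j + y i j) \<le> fnorm t n x + fnorm t n y + e" by simp
qed

lemma fnorm_scale_le:
  assumes t: "1 \<le> t"
  shows "fnorm t n (\<lambda>i j. c * x i j) \<le> cmod c * fnorm t n x"
proof (cases "c = 0")
  case True
  then show ?thesis using fnorm_entries[OF t, of n "\<lambda>i j. 0"] by simp
next
  case False
  have "fnorm t n (\<lambda>i j. c * x i j) / cmod c \<le> fnorm t n x"
  proof (rule fnorm_greatest[OF t])
    fix r assume "0 \<le> r" "factors t n r x"
    then have "fnorm t n (\<lambda>i j. c * x i j) \<le> cmod c * r"
      by (intro fnorm_le factors_scale[OF t]) auto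
    then show "fnorm t n (\<lambda>i j. c * x i j) / cmod c \<le> r" using False by (simp add: field_simps)
  qed
  then show ?thesis using False by (simp add: field_simps)
qed

lemma fnorm_scale:
  assumes t: "1 \<le> t"
  shows "fnorm t n (\<lambda>i j. c * x i j) = cmod c * fnorm t n x"
proof (cases "c = 0")
  case True
  then show ?thesis using fnorm_scale_le[OF t, of n c x] fnorm_nonneg[OF t] by (simp add: antisym)
next
  case False
  then have "cmod c * fnorm t n x = cmod c * fnorm t n (\<lambda>i j. (1 / c) * (c * x i j))" by simp
  also have "\<dots> \<le> cmod c * (cmod (1 / c) * fnorm t n (\<lambda>i j. c * x i j))"
    by (intro mult_left_mono fnorm_scale_le[OF t]) auto
  also have "\<dots> = fnorm t n (\<lambda>i j. c * x i j)" using False by (simp add: norm_divide)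
  finally show ?thesis using fnorm_scale_le[OF t, of n c x] by simp
qed

text \<open>By Cauchy-Schwarz and the inequality of arithmetic and geometric means, the t-th power
  of each entry is at most the mean of the t-th powers of the two squared norms. Injectivity uses
  every row and every column at most once, so the two sums stay below the budgets of the
  factorization.\<close>

lemma fnorm_permutation:
  assumes t: "1 \<le> t" and W: "finite W" "inj_on \<sigma> W" "inj_on \<tau> W" "\<sigma> ` W \<subseteq> {..<n}" "\<tau> ` W \<subseteq> {..<n}"
  shows "(\<Sum>w\<in>W. cmod (x (\<sigma> w) (\<tau> w)) powr t) \<le> fnorm t n x powr t"
proof -
  have "(\<Sum>w\<in>W. cmod (x (\<sigma> w) (\<tau> w)) powr t) powr (1 / t) \<le> fnorm t n x"
  proof (rule fnorm_greatest[OF t])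
    fix r assume r: "0 \<le> r" "factors t n r x"
    then obtain d :: nat and a b where f:
      "\<And>i j. i < n \<Longrightarrow> j < n \<Longrightarrow> x i j = herm {..<d} (a i) (b j)"
      "(\<Sum>i<n. nsq {..<d} (a i) powr t) \<le> r powr t" "(\<Sum>j<n. nsq {..<d} (b j) powr t) \<le> r powr t"
      unfolding factors_def by blast
    have p: "(\<Sum>w\<in>W. nsq {..<d} (c (\<pi> w)) powr t) \<le> r powr t"
      if "inj_on \<pi> W" "\<pi> ` W \<subseteq> {..<n}" "(\<Sum>i<n. nsq {..<d} (c i) powr t) \<le> r powr t" for \<pi> and c :: "nat \<Rightarrow> nat \<Rightarrow> complex"
    proof -
      have "(\<Sum>w\<in>W. nsq {..<d} (c (\<pi> w)) powr t) = (\<Sum>i\<in>\<pi> ` W. nsq {..<d} (c i) powr t)"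
        by (simp add: sum.reindex[OF that(1)])
      also have "\<dots> \<le> (\<Sum>i<n. nsq {..<d} (c i) powr t)"
        using that by (intro sum_mono2) auto
      finally show ?thesis using that by simp
    qed
    have "(\<Sum>w\<in>W. cmod (x (\<sigma> w) (\<tau> w)) powr t) \<le>
        (\<Sum>w\<in>W. (nsq {..<d} (a (\<sigma> w)) powr t + nsq {..<d} (b (\<tau> w)) powr t) / 2)"
    proof (rule sum_mono)
      fix w assume "w \<in> W"
      then have *: "\<sigma> w < n" "\<tau> w < n" using W by auto
      let ?u = "nsq {..<d} (a (\<sigma> w))" and ?v = "nsq {..<d} (b (\<tau> w))"
      have "cmod (x (\<sigma> w) (\<tau> w)) powr t \<le> (sqrt ?u * sqrt ?v) powr t"
        using herm_le[of "{..<d}" "a (\<sigma> w)" "b (\<tau> w)"] t by (intro powr_mono2) (auto simp: f(1)[OF *])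
      also have "\<dots> = sqrt (?u powr t) * sqrt (?v powr t)"
        by (simp add: powr_mult powr_powr flip: powr_half_sqrt)
      also have "\<dots> \<le> (?u powr t + ?v powr t) / 2"
        using arith_geo_mean_sqrt[of "?u powr t" "?v powr t"] by (simp add: real_sqrt_mult)
      finally show "cmod (x (\<sigma> w) (\<tau> w)) powr t \<le> (?u powr t + ?v powr t) / 2" .
    qed
    also have "\<dots> \<le> r powr t"
      using p[OF W(2,4) f(2)] p[OF W(3,5) f(3)] by (simp add: sum.distrib flip: sum_divide_distrib)
    finally have "(\<Sum>w\<in>W. cmod (x (\<sigma> w) (\<tau> w)) powr t) powr (1 / t) \<le> (r powr t) powr (1 / t)"
      using t by (intro powr_mono2) (auto intro: sum_nonneg)
    then show "(\<Sum>w\<in>W. cmod (x (\<sigma> w) (\<tau> w)) powr t) powr (1 / t) \<le> r"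
      using t r by (simp add: powr_powr)
  qed
  then have "((\<Sum>w\<in>W. cmod (x (\<sigma> w) (\<tau> w)) powr t) powr (1 / t)) powr t \<le> fnorm t n x powr t"
    using t by (intro powr_mono2) auto
  then show ?thesis using t by (simp add: powr_powr sum_nonneg)
qed

lemma fnorm_entry_le:
  assumes t: "1 \<le> t" and "i < n" "j < n"
  shows "cmod (x i j) \<le> fnorm t n x"
  using fnorm_permutation[OF t, of "{0::nat}" "\<lambda>_. i" "\<lambda>_. j" n x] assms
  by (simp add: powr_le_iff_base fnorm_nonneg)

section \<open>Complex uniform convexity of the factorization norm\<close>

text \<open>The primitive eighth roots of unity, written with independent signs as coordinates so
  that sums over them unfold into sums over two signs.\<close>

definition eighth_roots :: "complex set" where
  "eighth_roots = (\<lambda>(s, s'). Complex (s / sqrt 2) (s' / sqrt 2)) ` ({-1, 1} \<times> {-1, 1})"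

lemma inj_eighth: "inj_on (\<lambda>(s, s'). Complex (s / sqrt 2) (s' / sqrt 2)) A"
  by (auto simp: inj_on_def)

lemma sum_eighth: "(\<Sum>z\<in>eighth_roots. g z) =
    (\<Sum>s\<in>{-1,1}. \<Sum>s'\<in>{-1,1}. g (Complex (s / sqrt 2) (s' / sqrt 2)))"
  unfolding eighth_roots_def sum.reindex[OF inj_eighth] sum.cartesian_product by (simp only: o_def case_prod_unfold)

lemma sum_eighth4:
  "(\<Sum>z\<in>eighth_roots. g z) =
    g (Complex (- (1 / sqrt 2)) (- (1 / sqrt 2))) + g (Complex (- (1 / sqrt 2)) (1 / sqrt 2)) +
    (g (Complex (1 / sqrt 2) (- (1 / sqrt 2))) + g (Complex (1 / sqrt 2) (1 / sqrt 2)))"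
  unfolding sum_eighth by simp

lemma finite_eighth [simp]: "finite eighth_roots" and card_eighth: "card eighth_roots = 4"
  by (simp_all add: eighth_roots_def card_image[OF inj_eighth])

lemma cmod_eighth: "z \<in> eighth_roots \<Longrightarrow> cmod z = 1"
  by (auto simp: eighth_roots_def cmod_def power_divide)

text \<open>Exactly the moments that extract x, extract y and annihilate the cross term in the
  gluing argument.\<close>

lemma sum_eighth_cnj: "(\<Sum>z\<in>eighth_roots. z) = 0" "(\<Sum>z\<in>eighth_roots. cnj z) = 0"
    "(\<Sum>z\<in>eighth_roots. cnj z * cnj z) = 0" "(\<Sum>z\<in>eighth_roots. cnj z * z) = 4"
  unfolding sum_eighth4 by (auto simp: complex_eq_iff)

lemma powr_superadditive:
  fixes u v t :: real
  assumes "1 \<le> t" "0 \<le> u" "0 \<le> v"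
  shows "u powr t + v powr t \<le> (u + v) powr t"
proof (cases "u = 0 \<or> v = 0")
  case False
  then have pos: "0 < u" "0 < v" using assms by auto
  have e: "w powr t = w * w powr (t - 1)" if "0 < w" for w :: real
    using that powr_add[of w 1 "t - 1"] by simp
  have "u powr t + v powr t = u * u powr (t - 1) + v * v powr (t - 1)"
    using pos by (simp only: e)
  also have "\<dots> \<le> u * (u + v) powr (t - 1) + v * (u + v) powr (t - 1)"
    using pos assms by (intro add_mono mult_left_mono powr_mono2) auto
  also have "\<dots> = (u + v) powr t" using e[of "u + v"] pos by (simp add: distrib_right)
  finally show ?thesis .
qed auto

text \<open>
  The factorizations of \<open>x + \<theta> y\<close> are glued to one factorization \<open>(a, b)\<close> of x. Multiplication
  of the block of \<open>\<theta>\<close> by \<open>cnj \<theta>\<close> is a unitary K with \<open>\<langle>K a\<^sub>i, b\<^sub>j\<rangle> = y i j\<close> and \<open>\<langle>K b\<^sub>j, a\<^sub>i\<rangle> = 0\<close>,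
  because \<open>\<theta>\<close>, \<open>cnj \<theta>\<close> and \<open>(cnj \<theta>)\<^sup>2\<close> have mean 0. Split \<open>a = a' + a''\<close>, \<open>b = b' + b''\<close> with \<open>a'\<close> in the
  span of the b and \<open>b'\<close> in the span of the a. Then \<open>\<langle>K a', b'\<rangle> = 0\<close>, so y factors through \<open>a''\<close> and
  \<open>b''\<close>, and these are small if (a, b) is almost optimal for x, since \<open>x i j = \<langle>a'\<^sub>i, b\<^sub>j\<rangle> = \<langle>a\<^sub>i, b'\<^sub>j\<rangle>\<close>.
\<close>

lemma factors_complex_convexity:
  assumes t: "1 \<le> t" and r: "\<And>z. z \<in> eighth_roots \<Longrightarrow> 0 \<le> r z"
    and f: "\<And>z. z \<in> eighth_roots \<Longrightarrow> factors t n (r z) (\<lambda>i j. x i j + z * y i j)"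
  defines "R \<equiv> (\<Sum>z\<in>eighth_roots. r z) / 4"
  shows "fnorm t n x powr (2 * t) + (fnorm t n y / 2) powr (2 * t) \<le> R powr (2 * t)"
proof -
  let ?E = eighth_roots
  obtain d a0 b0 where ab: "\<And>z. z \<in> ?E \<Longrightarrow>
     (\<forall>i<n. \<forall>j<n. x i j + z * y i j = herm {..<d z :: nat} (a0 z i) (b0 z j)) \<and>
     (\<Sum>i<n. nsq {..<d z} (a0 z i) powr t) \<le> r z powr t \<and> (\<Sum>j<n. nsq {..<d z} (b0 z j) powr t) \<le> r z powr t"
    using f unfolding factors_def by metis
  define I where "I = Sigma ?E (\<lambda>z. {..<d z})"
  have I: "finite I" by (simp add: I_def)
  \<comment> \<open>Halving both a and b puts the weight 1/4 of a mean over four roots on each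
    block.\<close>
  define a where "a i = (\<lambda>(z, m). a0 z i m / 2)" for i
  define b where "b j = (\<lambda>(z, m). b0 z j m / 2)" for j
  define K where "K u = (\<lambda>(z, m). cnj z * u (z, m))" for u :: "complex \<times> nat \<Rightarrow> complex"
  have R0: "0 \<le> R" using r by (simp add: R_def sum_nonneg)
  have sumI: "(\<Sum>(z,m)\<in>I. g z m) = (\<Sum>z\<in>?E. \<Sum>m<d z. g z m)" for g :: "complex \<Rightarrow> nat \<Rightarrow> 'x::comm_monoid_add"
    unfolding I_def by (simp add: sum.Sigma)
  have hx: "herm I (a i) (b j) = x i j" if "i < n" "j < n" for i j
  proof -
    have "herm I (a i) (b j) = (\<Sum>z\<in>?E. herm {..<d z} (a0 z i) (b0 z j) / 4)"
      unfolding herm_def a_def b_def using sumI[of "\<lambda>z m. a0 z i m * cnj (b0 z j m) / 4"]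
      by (simp add: split_beta sum_divide_distrib)
    also have "\<dots> = (\<Sum>z\<in>?E. (x i j + z * y i j) / 4)"
      using ab that by (intro sum.cong) auto
    also have "\<dots> = x i j"
      by (simp add: add_divide_distrib sum.distrib card_eighth sum_eighth_cnj
          flip: sum_divide_distrib sum_distrib_right)
    finally show ?thesis .
  qed
  have hy: "herm I (K (a i)) (b j) = y i j" if "i < n" "j < n" for i j
  proof -
    have "herm I (K (a i)) (b j) = (\<Sum>z\<in>?E. cnj z * herm {..<d z} (a0 z i) (b0 z j) / 4)"
      unfolding herm_def a_def b_def K_def using sumI[of "\<lambda>z m. cnj z * (a0 z i m * cnj (b0 z j m)) / 4"]
      by (simp add: split_beta sum_divide_distrib sum_distrib_left mult.assoc)
    also have "\<dots> = (\<Sum>z\<in>?E. (cnj z * x i j + cnj z * z * y i j) / 4)"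
    proof (intro sum.cong refl)
      fix z assume "z \<in> ?E"
      then have e: "herm {..<d z} (a0 z i) (b0 z j) = x i j + z * y i j" using ab that by auto
      show "cnj z * herm {..<d z} (a0 z i) (b0 z j) / 4 = (cnj z * x i j + cnj z * z * y i j) / 4"
        unfolding e by (simp add: distrib_left mult.assoc)
    qed
    also have "\<dots> = y i j"
      by (simp add: add_divide_distrib sum.distrib sum_eighth_cnj
          flip: sum_divide_distrib sum_distrib_right)
    finally show ?thesis .
  qed
  have h0: "herm I (K (b j)) (a i) = 0" if "i < n" "j < n" for i j
  proof -
    have "herm I (K (b j)) (a i) = (\<Sum>z\<in>?E. cnj z * cnj (herm {..<d z} (a0 z i) (b0 z j)) / 4)"
      unfolding herm_cnj unfolding herm_def a_def b_def K_def
      using sumI[of "\<lambda>z m. cnj z * (b0 z j m * cnj (a0 z i m)) / 4"]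
      by (simp add: split_beta sum_divide_distrib sum_distrib_left mult.assoc)
    also have "\<dots> = (\<Sum>z\<in>?E. (cnj z * cnj (x i j) + cnj z * cnj z * cnj (y i j)) / 4)"
    proof (intro sum.cong refl)
      fix z assume "z \<in> ?E"
      then have e: "herm {..<d z} (a0 z i) (b0 z j) = x i j + z * y i j" using ab that by auto
      show "cnj z * cnj (herm {..<d z} (a0 z i) (b0 z j)) / 4 =
          (cnj z * cnj (x i j) + cnj z * cnj z * cnj (y i j)) / 4"
        unfolding e by (simp add: distrib_left mult.assoc)
    qed
    also have "\<dots> = 0"
      by (simp add: add_divide_distrib sum.distrib sum_eighth_cnj
          flip: sum_divide_distrib sum_distrib_right)
    finally show ?thesis .
  qed
  have nK: "nsq I (K u) = nsq I u" for u
    unfolding nsq_def K_def by (intro sum.cong) (auto simp: I_def norm_mult cmod_eighth)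
  have glue: "(\<Sum>i<n. nsq I (c i) powr t) \<le> R powr t"
    if c: "\<And>i. c i = (\<lambda>(z, m). w z i m / 2)"
      and w: "\<And>z. z \<in> ?E \<Longrightarrow> (\<Sum>i<n. nsq {..<d z} (w z i) powr t) \<le> r z powr t" for c w
  proof -
    have q: "nsq I (c i) = (\<Sum>z\<in>?E. nsq {..<d z} (w z i) / 4)" for i
      unfolding nsq_def c using sumI[of "\<lambda>z m. (cmod (w z i m))\<^sup>2 / 4"]
      by (simp add: split_beta sum_divide_distrib norm_divide power_divide)
    have "(\<Sum>i<n. (\<Sum>z\<in>?E. nsq {..<d z} (w z i) / 4) powr t) \<le> (\<Sum>z\<in>?E. r z / 4) powr t"
    proof (rule minkowski_bound[OF t finite_eighth])
      fix z assume z: "z \<in> ?E"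
      show "(\<Sum>i<n. (nsq {..<d z} (w z i) / 4) powr t) \<le> (r z / 4) powr t"
        using w[OF z] r[OF z] by (simp add: powr_divide divide_right_mono flip: sum_divide_distrib)
    qed (use r in auto)
    then show ?thesis unfolding q R_def by (simp add: sum_divide_distrib)
  qed
  have aR: "(\<Sum>i<n. nsq I (a i) powr t) \<le> R powr t" and bR: "(\<Sum>j<n. nsq I (b j) powr t) \<le> R powr t"
    by (rule glue[OF a_def], use ab in blast) (rule glue[OF b_def], use ab in blast)
  have "\<forall>i. \<exists>c. \<forall>j<n. herm I (\<lambda>m. a i m - (\<Sum>l<n. c l * b l m)) (b j) = 0"
    using orthogonal_projection[OF I] by blast
  then obtain ca where ca: "\<And>i j. j < n \<Longrightarrow> herm I (\<lambda>m. a i m - (\<Sum>l<n. ca i l * b l m)) (b j) = 0"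
    by metis
  have "\<forall>i. \<exists>c. \<forall>j<n. herm I (\<lambda>m. b i m - (\<Sum>l<n. c l * a l m)) (a j) = 0"
    using orthogonal_projection[OF I] by blast
  then obtain cb where cb: "\<And>i j. j < n \<Longrightarrow> herm I (\<lambda>m. b i m - (\<Sum>l<n. cb i l * a l m)) (a j) = 0"
    by metis
  define a1 where "a1 i m = (\<Sum>l<n. ca i l * b l m)" for i m
  define a2 where "a2 i m = a i m - a1 i m" for i m
  define b1 where "b1 i m = (\<Sum>l<n. cb i l * a l m)" for i m
  define b2 where "b2 i m = b i m - b1 i m" for i m
  have a2b: "herm I (a2 i) (b j) = 0" if "j < n" for i j
    using ca[OF that] unfolding a2_def[abs_def] a1_def[abs_def] .
  have b2a: "herm I (b2 i) (a j) = 0" if "j < n" for i j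
    using cb[OF that] unfolding b2_def[abs_def] b1_def[abs_def] .
  have asplit: "a i = (\<lambda>m. a1 i m + a2 i m)" and bsplit: "b i = (\<lambda>m. b1 i m + b2 i m)" for i
    by (simp_all add: a2_def b2_def)
  have "herm I (a2 i) (a1 i) = 0" for i
    unfolding a1_def herm_sum_right using a2b by simp
  then have "herm I (a1 i) (a2 i) = 0" for i
    by (metis herm_cnj complex_cnj_zero)
  from nsq_add_orth[OF this] have na: "nsq I (a i) = nsq I (a1 i) + nsq I (a2 i)" for i
    using asplit by metis
  have "herm I (b2 i) (b1 i) = 0" for i
    unfolding b1_def herm_sum_right using b2a by simp
  then have "herm I (b1 i) (b2 i) = 0" for i
    by (metis herm_cnj complex_cnj_zero)
  from nsq_add_orth[OF this] have nb: "nsq I (b i) = nsq I (b1 i) + nsq I (b2 i)" for i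
    using bsplit by metis
  have hxa: "x i j = herm I (a1 i) (b j)" if "i < n" "j < n" for i j
    using hx[OF that] a2b[OF that(2), of i] by (simp add: asplit[of i] herm_add_left)
  have hxb: "x i j = herm I (a i) (b1 j)" if "i < n" "j < n" for i j
  proof -
    have "herm I (a i) (b2 j) = 0" using b2a[OF that(1), of j] herm_cnj[of I "b2 j" "a i"] by simp
    then show ?thesis using hx[OF that] by (simp add: bsplit[of j] herm_add_right)
  qed
  have Ksum: "K (a1 i) = (\<lambda>m. \<Sum>l<n. ca i l * K (b l) m)" for i
    by (auto simp: K_def a1_def fun_eq_iff sum_distrib_left mult_ac)
  have K11: "herm I (K (a1 i)) (b1 j) = 0" for i j
    unfolding Ksum herm_sum_left b1_def herm_sum_right using h0 by simp
  have Kadd: "K (\<lambda>m. u m + v m) = (\<lambda>m. K u m + K v m)" for u v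
    by (auto simp: K_def fun_eq_iff distrib_left)
  have hyy: "y i j = herm I (K (a2 i)) (b1 j) + herm I (K (a i)) (b2 j)" if "i < n" "j < n" for i j
  proof -
    have "y i j = herm I (K (a i)) (b1 j) + herm I (K (a i)) (b2 j)"
      using hy[OF that] by (simp add: bsplit[of j] herm_add_right)
    moreover have "herm I (K (a i)) (b1 j) = herm I (K (a2 i)) (b1 j)"
      using K11[of i j] by (subst asplit[of i]) (simp add: Kadd herm_add_left)
    ultimately show ?thesis by simp
  qed
  define N where "N = fnorm t n x"
  have N0: "0 \<le> N" using fnorm_nonneg[OF t] by (simp add: N_def)
  define S where "S c = (\<Sum>i<n. nsq I (c i) powr t)" for c :: "nat \<Rightarrow> complex \<times> nat \<Rightarrow> complex"
  have S0: "0 \<le> S c" for c by (simp add: S_def sum_nonneg)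
  have Sroot: "(\<Sum>i<n. nsq I (c i) powr t) \<le> (S c powr (1/t)) powr t" for c
    using S0[of c] t by (simp add: powr_powr S_def[symmetric])
  have Ssplit: "S a1 + S a2 \<le> S a" "S b1 + S b2 \<le> S b"
    unfolding S_def sum.distrib[symmetric] na nb using t by (auto intro!: sum_mono powr_superadditive)
  have SR: "S a \<le> R powr t" "S b \<le> R powr t" using aR bR by (simp_all add: S_def)
  \<comment> \<open>If c can replace one factor of x while the other stays bounded by R, minimality
    of N forces S c to be large. With c = a1 and c = b1 this leaves little room for a2 and
    b2.\<close>
  have key: "N powr (2 * t) \<le> S c * R powr t"
    if "factors t n (sqrt (S c powr (1/t) * R)) x" for c
  proof -
    have "N \<le> sqrt (S c powr (1/t) * R)"
      unfolding N_def using that R0 by (intro fnorm_le) auto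
    then have "N powr (2 * t) \<le> sqrt (S c powr (1/t) * R) powr (2 * t)"
      using N0 t by (intro powr_mono2) auto
    also have "\<dots> = S c * R powr t"
      using R0 S0[of c] t by (simp add: powr_half_sqrt[symmetric] powr_powr powr_mult mult.commute)
    finally show ?thesis .
  qed
  have keya: "N powr (2 * t) \<le> S a1 * R powr t"
    by (rule key, rule factors_unbalanced[OF t I hxa Sroot _ bR R0]) auto
  have "factors t n (sqrt (R * S b1 powr (1/t))) x"
    by (rule factors_unbalanced[OF t I hxb aR R0 Sroot]) auto
  then have keyb: "N powr (2 * t) \<le> S b1 * R powr t"
    by (intro key) (simp add: mult.commute)
  \<comment> \<open>The deficit of optimality; it controls what a2 and b2 can contribute to
    y.\<close>
  define D where "D = R powr (2 * t) - N powr (2 * t)"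
  have RR: "R powr t * R powr t = R powr (2 * t)" by (simp add: powr_add[symmetric])
  have Da: "S a2 * R powr t \<le> D" "S b2 * R powr t \<le> D"
  proof -
    have "S a1 * R powr t + S a2 * R powr t \<le> R powr t * R powr t"
      using Ssplit(1) SR(1) by (simp add: mult_right_mono flip: distrib_right)
    then show "S a2 * R powr t \<le> D" using keya by (simp add: RR D_def)
    have "S b1 * R powr t + S b2 * R powr t \<le> R powr t * R powr t"
      using Ssplit(2) SR(2) by (simp add: mult_right_mono flip: distrib_right)
    then show "S b2 * R powr t \<le> D" using keyb by (simp add: RR D_def)
  qed
  have D0: "0 \<le> D" using Da(1) S0[of a2] by (meson mult_nonneg_nonneg order_trans powr_ge_zero)
  have half: "sqrt (S c powr (1/t) * R) \<le> D powr (1 / (2 * t))" if "S c * R powr t \<le> D" for c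
  proof -
    have "(S c * R powr t) powr (1 / (2 * t)) \<le> D powr (1 / (2 * t))"
      using that S0[of c] t by (intro powr_mono2) auto
    moreover have "(S c * R powr t) powr (1 / (2 * t)) = sqrt (S c powr (1/t) * R)"
      using R0 S0[of c] t by (simp add: powr_half_sqrt[symmetric] powr_powr powr_mult mult.commute)
    ultimately show ?thesis by simp
  qed
  have bR1: "(\<Sum>j<n. nsq I (b1 j) powr t) \<le> R powr t"
    using Ssplit(2) SR(2) S0[of b2] unfolding S_def by linarith
  \<comment> \<open>K is an isometry, so \<open>K (a2 i)\<close> is as small as \<open>a2 i\<close>,
    while the partner b1 is still bounded by R.\<close>
  have y1: "fnorm t n (\<lambda>i j. herm I (K (a2 i)) (b1 j)) \<le> D powr (1 / (2 * t))"
  proof (rule order_trans[OF fnorm_le half[OF Da(1)]])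
    show "factors t n (sqrt (S a2 powr (1/t) * R)) (\<lambda>i j. herm I (K (a2 i)) (b1 j))"
      by (rule factors_unbalanced[OF t I refl _ _ bR1 R0]) (use Sroot[of a2] in \<open>auto simp: nK\<close>)
  qed (use R0 in auto)
  have y2: "fnorm t n (\<lambda>i j. herm I (K (a i)) (b2 j)) \<le> D powr (1 / (2 * t))"
  proof (rule order_trans[OF fnorm_le half[OF Da(2)]])
    have "factors t n (sqrt (R * S b2 powr (1/t))) (\<lambda>i j. herm I (K (a i)) (b2 j))"
      by (rule factors_unbalanced[OF t I refl _ R0 Sroot]) (use aR in \<open>auto simp: nK\<close>)
    then show "factors t n (sqrt (S b2 powr (1/t) * R)) (\<lambda>i j. herm I (K (a i)) (b2 j))"
      by (simp add: mult.commute)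
  qed (use R0 in auto)
  have "fnorm t n y = fnorm t n (\<lambda>i j. herm I (K (a2 i)) (b1 j) + herm I (K (a i)) (b2 j))"
    unfolding fnorm_def factors_def using hyy by simp
  \<comment> \<open>The two summands are the source of the factor 1/2 at y in the statement.\<close>
  also have "\<dots> \<le> 2 * D powr (1 / (2 * t))"
    using fnorm_add[OF t, of n "\<lambda>i j. herm I (K (a2 i)) (b1 j)" "\<lambda>i j. herm I (K (a i)) (b2 j)"] y1 y2
    by linarith
  finally have "(fnorm t n y / 2) powr (2 * t) \<le> (D powr (1 / (2 * t))) powr (2 * t)"
    using t fnorm_nonneg[OF t, of n y] by (intro powr_mono2) auto
  also have "\<dots> = D" using t D0 by (simp add: powr_powr)
  finally show ?thesis by (simp add: D_def N_def)
qed

lemma fnorm_complex_convexity: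
  assumes t: "1 \<le> t"
  shows "(fnorm t n x powr (2 * t) + (fnorm t n y / 2) powr (2 * t)) powr (1 / (2 * t))
    \<le> (\<Sum>z\<in>eighth_roots. fnorm t n (\<lambda>i j. x i j + z * y i j)) / 4"
proof (rule field_le_epsilon)
  fix e :: real assume e: "0 < e"
  let ?r = "\<lambda>z. fnorm t n (\<lambda>i j. x i j + z * y i j) + e"
  have "fnorm t n x powr (2 * t) + (fnorm t n y / 2) powr (2 * t) \<le> ((\<Sum>z\<in>eighth_roots. ?r z) / 4) powr (2 * t)"
    by (rule factors_complex_convexity[OF t]) (use e fnorm_nonneg[OF t] fnorm_approx[OF t] in \<open>auto simp: add_nonneg_nonneg\<close>)
  then have "(fnorm t n x powr (2 * t) + (fnorm t n y / 2) powr (2 * t)) powr (1 / (2 * t))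
      \<le> (((\<Sum>z\<in>eighth_roots. ?r z) / 4) powr (2 * t)) powr (1 / (2 * t))"
    using t by (intro powr_mono2) auto
  also have "\<dots> = (\<Sum>z\<in>eighth_roots. ?r z) / 4"
    using t e fnorm_nonneg[OF t] by (simp add: powr_powr sum_nonneg add_nonneg_nonneg)
  also have "\<dots> = (\<Sum>z\<in>eighth_roots. fnorm t n (\<lambda>i j. x i j + z * y i j)) / 4 + e"
    by (simp add: sum.distrib card_eighth add_divide_distrib)
  finally show "(fnorm t n x powr (2 * t) + (fnorm t n y / 2) powr (2 * t)) powr (1 / (2 * t))
    \<le> (\<Sum>z\<in>eighth_roots. fnorm t n (\<lambda>i j. x i j + z * y i j)) / 4 + e" .
qed

section \<open>A Banach space of finite cotype\<close>

abbreviation signs :: "nat \<Rightarrow> (nat \<Rightarrow> real) set" where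
  "signs N \<equiv> {..<N} \<rightarrow>\<^sub>E {-1, 1}"

lemma finite_signs [simp]: "finite (signs N)" and signs_nonempty: "signs N \<noteq> {}"
  by (auto simp: finite_PiE PiE_eq_empty_iff)

lemma card_signs: "card (signs N) = 2 ^ N"
  by (simp add: card_PiE flip: numeral_2_eq_2)

lemma sum_signs_Suc:
  "(\<Sum>\<epsilon>\<in>signs (Suc N). g \<epsilon>) = (\<Sum>\<epsilon>\<in>signs N. \<Sum>s\<in>{-1,1}. g (\<epsilon>(N := s)))"
proof -
  have inj: "inj_on (\<lambda>(y, g). g(N := y)) ({-1, 1} \<times> signs N)"
    using inj_combinator[of N "{..<N}" "\<lambda>_. {-1, 1::real}"] by simp
  have "(\<Sum>\<epsilon>\<in>signs (Suc N). g \<epsilon>) = (\<Sum>(s, \<epsilon>)\<in>{-1, 1} \<times> signs N. g (\<epsilon>(N := s)))"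
    unfolding lessThan_Suc PiE_insert_eq sum.reindex[OF inj] by (simp only: o_def case_prod_unfold)
  also have "\<dots> = (\<Sum>s\<in>{-1,1}. \<Sum>\<epsilon>\<in>signs N. g (\<epsilon>(N := s)))"
    by (rule sum.cartesian_product[symmetric])
  finally show ?thesis by (simp only: sum.swap[of _ "{-1,1}"])
qed

lemma expectation_signs:
  "measure_pmf.expectation (pmf_of_set (signs N)) f = (\<Sum>\<epsilon>\<in>signs N. f \<epsilon>) / 2 ^ N"
  for f :: "(nat \<Rightarrow> real) \<Rightarrow> real"
  by (simp add: integral_pmf_of_set signs_nonempty card_signs)

lemma mean_le_rms_signs:
  "(\<Sum>\<epsilon>\<in>signs N. f \<epsilon>) / 2 ^ N \<le> sqrt ((\<Sum>\<epsilon>\<in>signs N. (f \<epsilon>)\<^sup>2) / 2 ^ N)"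
  for f :: "(nat \<Rightarrow> real) \<Rightarrow> real"
proof (rule real_le_rsqrt)
  have "(\<Sum>\<epsilon>\<in>signs N. f \<epsilon>)\<^sup>2 \<le> (\<Sum>\<epsilon>\<in>signs N. (f \<epsilon>)\<^sup>2) * 2 ^ N"
    using sum_squared_le_sum_of_squares[of "f" "signs N"] by (simp add: card_signs)
  then show "((\<Sum>\<epsilon>\<in>signs N. f \<epsilon>) / 2 ^ N)\<^sup>2 \<le> (\<Sum>\<epsilon>\<in>signs N. (f \<epsilon>)\<^sup>2) / 2 ^ N"
    by (simp add: power_divide power2_eq_square[of "2 ^ N :: real"] divide_le_eq)
qed

text \<open>Induction on N: complex convexity is applied to each signed partial sum and the next
  term. The outer norm is l_s of dimension 2 with s = 2 t, so no constant accumulates.\<close>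

lemma fnorm_eighth_cotype:
  fixes x :: "nat \<Rightarrow> nat \<Rightarrow> nat \<Rightarrow> complex"
  assumes t: "1 \<le> t"
  shows "(\<Sum>l<N. (fnorm t n (x l) / 2) powr (2 * t)) powr (1 / (2 * t)) \<le>
    (\<Sum>\<epsilon>\<in>signs N. \<Sum>\<delta>\<in>signs N.
       fnorm t n (\<lambda>i j. \<Sum>l<N. Complex (\<epsilon> l / sqrt 2) (\<delta> l / sqrt 2) * x l i j)) / 4 ^ N"
proof (induction N)
  case 0
  then show ?case using fnorm_nonneg[OF t] by simp
next
  case (Suc N)
  define s where "s = 2 * t"
  have s: "1 \<le> s" using t by (simp add: s_def)
  define c where "c l = fnorm t n (x l) / 2" for l
  have c0: "0 \<le> c l" for l using fnorm_nonneg[OF t] by (simp add: c_def)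
  define S where "S p i j = (\<Sum>l<N. Complex (fst p l / sqrt 2) (snd p l / sqrt 2) * x l i j)"
    for p :: "(nat \<Rightarrow> real) \<times> (nat \<Rightarrow> real)" and i j
  define A where "A = signs N \<times> signs N"
  have A: "finite A" "A \<noteq> {}" "real (card A) = 4 ^ N"
    by (auto simp: A_def signs_nonempty card_cartesian_product card_signs power_mult_distrib[symmetric])
  have "(\<Sum>l<N. c l powr s) powr (1 / s) \<le> (\<Sum>p\<in>A. fnorm t n (S p)) / card A"
    using Suc unfolding A(3) by (simp add: A_def s_def c_def S_def[abs_def] sum.cartesian_product case_prod_unfold)
  then have "((\<Sum>l<N. c l powr s) powr (1 / s)) powr s \<le> ((\<Sum>p\<in>A. fnorm t n (S p)) / card A) powr s"
    using s by (intro powr_mono2) auto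
  then have "(\<Sum>l<N. c l powr s) \<le> ((\<Sum>p\<in>A. fnorm t n (S p)) / card A) powr s"
    using s by (simp add: powr_powr sum_nonneg)
  then have "(\<Sum>l<Suc N. c l powr s) powr (1 / s) \<le>
      (((\<Sum>p\<in>A. fnorm t n (S p)) / card A) powr s + c N powr s) powr (1 / s)"
    using s by (intro powr_mono2) (auto simp: sum_nonneg)
  \<comment> \<open>Minkowski moves the mean over the earlier signs outside; afterwards the
    convexity estimate applies to each sign pattern separately.\<close>
  also have "\<dots> \<le> (\<Sum>p\<in>A. (fnorm t n (S p) powr s + c N powr s) powr (1 / s)) / card A"
    by (rule mean_minkowski[OF s A(1,2)]) (use fnorm_nonneg[OF t] c0 in auto)
  also have "\<dots> \<le> (\<Sum>p\<in>A. (\<Sum>z\<in>eighth_roots. fnorm t n (\<lambda>i j. S p i j + z * x N i j)) / 4) / card A"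
    using fnorm_complex_convexity[OF t] unfolding s_def c_def
    by (intro divide_right_mono sum_mono) auto
  also have "\<dots> = (\<Sum>p\<in>A. \<Sum>z\<in>eighth_roots. fnorm t n (\<lambda>i j. S p i j + z * x N i j)) / 4 ^ Suc N"
    by (simp add: A(3) flip: sum_divide_distrib)
  also have "(\<Sum>p\<in>A. \<Sum>z\<in>eighth_roots. fnorm t n (\<lambda>i j. S p i j + z * x N i j)) =
    (\<Sum>\<epsilon>\<in>signs N. \<Sum>\<delta>\<in>signs N. \<Sum>s\<in>{-1,1}. \<Sum>s'\<in>{-1,1}.
       fnorm t n (\<lambda>i j. S (\<epsilon>, \<delta>) i j + Complex (s / sqrt 2) (s' / sqrt 2) * x N i j))"
    by (simp only: sum_eighth A_def sum.cartesian_product')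
  also have "\<dots> = (\<Sum>\<epsilon>\<in>signs N. \<Sum>s\<in>{-1,1}. \<Sum>\<delta>\<in>signs N. \<Sum>s'\<in>{-1,1}.
       fnorm t n (\<lambda>i j. S (\<epsilon>, \<delta>) i j + Complex (s / sqrt 2) (s' / sqrt 2) * x N i j))"
    by (intro sum.cong refl sum.swap)
  also have "\<dots> = (\<Sum>\<epsilon>\<in>signs (Suc N). \<Sum>\<delta>\<in>signs (Suc N).
       fnorm t n (\<lambda>i j. \<Sum>l<Suc N. Complex (\<epsilon> l / sqrt 2) (\<delta> l / sqrt 2) * x l i j))"
  proof -
    have e: "S (\<epsilon>, \<delta>) i j + Complex (s / sqrt 2) (s' / sqrt 2) * x N i j =
      (\<Sum>l<Suc N. Complex ((\<epsilon>(N := s)) l / sqrt 2) ((\<delta>(N := s')) l / sqrt 2) * x l i j)" for \<epsilon> \<delta> s s' i j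
      unfolding S_def by simp
    show ?thesis unfolding e sum_signs_Suc ..
  qed
  finally show ?case unfolding s_def c_def .
qed

text \<open>Each complex coefficient is (epsilon + i delta) / sqrt 2. The triangle inequality
  separates the two sign patterns, whose contributions have equal means, and 2 / sqrt 2 = sqrt
  2.\<close>

lemma fnorm_cotype:
  fixes x :: "nat \<Rightarrow> nat \<Rightarrow> nat \<Rightarrow> complex"
  assumes t: "1 \<le> t"
  shows "(\<Sum>l<N. (fnorm t n (x l) / 2) powr (2 * t)) powr (1 / (2 * t)) \<le>
    sqrt 2 * ((\<Sum>\<epsilon>\<in>signs N. fnorm t n (\<lambda>i j. \<Sum>l<N. of_real (\<epsilon> l) * x l i j)) / 2 ^ N)"
proof -
  let ?f = "\<lambda>\<epsilon>. fnorm t n (\<lambda>i j. \<Sum>l<N. of_real (\<epsilon> l) * x l i j)"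
  have "fnorm t n (\<lambda>i j. \<Sum>l<N. Complex (\<epsilon> l / sqrt 2) (\<delta> l / sqrt 2) * x l i j) \<le>
    (?f \<epsilon> + ?f \<delta>) / sqrt 2" for \<epsilon> \<delta>
  proof -
    have c: "Complex (a / sqrt 2) (b / sqrt 2) = of_real (1 / sqrt 2) * of_real a + \<i> * of_real (1 / sqrt 2) * of_real b"
      for a b by (simp add: complex_eq_iff)
    have "(\<lambda>i j. \<Sum>l<N. Complex (\<epsilon> l / sqrt 2) (\<delta> l / sqrt 2) * x l i j) =
      (\<lambda>i j. of_real (1 / sqrt 2) * (\<Sum>l<N. of_real (\<epsilon> l) * x l i j) +
             (\<i> * of_real (1 / sqrt 2)) * (\<Sum>l<N. of_real (\<delta> l) * x l i j))"
      unfolding c distrib_right sum.distrib sum_distrib_left by (simp only: mult.assoc)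
    then have "fnorm t n (\<lambda>i j. \<Sum>l<N. Complex (\<epsilon> l / sqrt 2) (\<delta> l / sqrt 2) * x l i j) \<le>
      cmod (of_real (1 / sqrt 2)) * ?f \<epsilon> + cmod (\<i> * of_real (1 / sqrt 2)) * ?f \<delta>"
      using fnorm_add[OF t] unfolding fnorm_scale[OF t, symmetric] by simp
    then show ?thesis by (simp add: norm_mult norm_divide add_divide_distrib)
  qed
  then have "(\<Sum>\<epsilon>\<in>signs N. \<Sum>\<delta>\<in>signs N.
       fnorm t n (\<lambda>i j. \<Sum>l<N. Complex (\<epsilon> l / sqrt 2) (\<delta> l / sqrt 2) * x l i j)) / 4 ^ N
    \<le> (\<Sum>\<epsilon>\<in>signs N. \<Sum>\<delta>\<in>signs N. (?f \<epsilon> + ?f \<delta>) / sqrt 2) / 4 ^ N"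
    by (intro divide_right_mono sum_mono) auto
  also have "\<dots> = sqrt 2 * ((\<Sum>\<epsilon>\<in>signs N. ?f \<epsilon>) / 2 ^ N)"
  proof -
    have "(4::real) ^ N = 2 ^ N * 2 ^ N" by (simp flip: power_mult_distrib)
    moreover have "2 / sqrt 2 = sqrt 2" by (simp add: real_div_sqrt)
    ultimately show ?thesis
      by (simp add: sum.distrib card_signs field_simps flip: sum_divide_distrib sum_distrib_left)
  qed
  finally show ?thesis using fnorm_eighth_cotype[OF t, of n x N] by linarith
qed

section \<open>The space of infinite matrices with bounded truncations\<close>

definition mat :: "(nat \<Rightarrow> real) \<Rightarrow> nat \<Rightarrow> nat \<Rightarrow> complex" where
  "mat x i j = of_real (x (prod_encode (i, j)))"

text \<open>
  A supremum over truncations, rather than the completion of the finitely supported matrices, keeps the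
  carrier in \<^typ>\<open>nat \<Rightarrow> real\<close>.
\<close>

definition factor_space :: "real \<Rightarrow> (nat \<Rightarrow> real) nspace" where
  "factor_space t = mk_nspace {x. bdd_above (range (\<lambda>n. fnorm t n (mat x)))}
     (\<lambda>_. 0) (\<lambda>x y i. x i + y i) (\<lambda>c x i. c * x i) (\<lambda>x. SUP n. fnorm t n (mat x))"

locale factor =
  fixes t :: real
  assumes t: "1 \<le> t"
begin

abbreviation "X \<equiv> factor_space t"

lemma X_ops [simp]:
  "x \<oplus>\<^bsub>X\<^esub> y = (\<lambda>n. x n + y n)" "c \<odot>\<^bsub>X\<^esub> x = (\<lambda>n. c * x n)" "\<zero>\<^bsub>X\<^esub> = (\<lambda>n. 0)"
  by (simp_all add: factor_space_def)

lemma X_carrier: "x \<in> carrier X \<longleftrightarrow> bdd_above (range (\<lambda>n. fnorm t n (mat x)))"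
  by (simp add: factor_space_def)

lemma X_norm: "vnorm X x = (SUP n. fnorm t n (mat x))"
  by (simp add: factor_space_def)

lemma mat_add: "mat (\<lambda>n. x n + y n) = (\<lambda>i j. mat x i j + mat y i j)"
  by (simp add: mat_def fun_eq_iff)

lemma mat_scale: "mat (\<lambda>n. c * x n) = (\<lambda>i j. of_real c * mat x i j)"
  by (simp add: mat_def fun_eq_iff)

lemma fnorm_le_X: "x \<in> carrier X \<Longrightarrow> fnorm t n (mat x) \<le> vnorm X x"
  unfolding X_norm X_carrier by (rule cSUP_upper) auto

lemma X_leI:
  assumes "\<And>n. fnorm t n (mat x) \<le> B"
  shows "x \<in> carrier X" "vnorm X x \<le> B"
  unfolding X_carrier X_norm using assms by (auto intro!: cSUP_least bdd_aboveI[of _ B])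

lemma X_add:
  assumes "x \<in> carrier X" "y \<in> carrier X"
  shows "(\<lambda>n. x n + y n) \<in> carrier X" "vnorm X (\<lambda>n. x n + y n) \<le> vnorm X x + vnorm X y"
proof -
  have "fnorm t n (mat (\<lambda>n. x n + y n)) \<le> vnorm X x + vnorm X y" for n
    unfolding mat_add
    using fnorm_add[OF t, of n "mat x" "mat y"] fnorm_le_X[OF assms(1), of n] fnorm_le_X[OF assms(2), of n]
    by linarith
  from X_leI[OF this]
  show "(\<lambda>n. x n + y n) \<in> carrier X" "vnorm X (\<lambda>n. x n + y n) \<le> vnorm X x + vnorm X y" by auto
qed

lemma X_scale:
  assumes "x \<in> carrier X"
  shows "(\<lambda>n. c * x n) \<in> carrier X" "vnorm X (\<lambda>n. c * x n) = \<bar>c\<bar> * vnorm X x"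
proof -
  have le: "(\<lambda>n. c * x n) \<in> carrier X \<and> vnorm X (\<lambda>n. c * x n) \<le> \<bar>c\<bar> * vnorm X x"
    if x: "x \<in> carrier X" for c x
  proof -
    have "fnorm t n (mat (\<lambda>n. c * x n)) \<le> \<bar>c\<bar> * vnorm X x" for n
      unfolding mat_scale fnorm_scale[OF t] using fnorm_le_X[OF x, of n] by (simp add: mult_left_mono)
    from X_leI[OF this] show ?thesis by auto
  qed
  show c: "(\<lambda>n. c * x n) \<in> carrier X" using le[OF assms] by blast
  show "vnorm X (\<lambda>n. c * x n) = \<bar>c\<bar> * vnorm X x"
  proof (cases "c = 0")
    case True
    then show ?thesis using le[OF assms, of c] fnorm_le_X[OF c, of 0] fnorm_nonneg[OF t, of 0 "mat (\<lambda>n. c * x n)"]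
      by simp
  next
    case False
    have "vnorm X x = vnorm X (\<lambda>n. (1 / c) * (c * x n))" using False by simp
    also have "\<dots> \<le> \<bar>1 / c\<bar> * vnorm X (\<lambda>n. c * x n)" using le[OF c, of "1 / c"] by blast
    finally show ?thesis using le[OF assms, of c] False by (simp add: field_simps)
  qed
qed

lemma entry_le_X:
  assumes "x \<in> carrier X" shows "\<bar>x m\<bar> \<le> vnorm X x"
proof -
  obtain i j where m: "m = prod_encode (i, j)" by (metis prod_decode_inverse surj_pair)
  have "cmod (mat x i j) \<le> fnorm t (Suc (max i j)) (mat x)"
    by (rule fnorm_entry_le[OF t]) auto
  then show ?thesis using fnorm_le_X[OF assms, of "Suc (max i j)"] by (simp add: mat_def m)
qed

lemma seminormed_X: "seminormed_space X"
proof (intro seminormed_space.intro seminormed_space_axioms.intro)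
  have z: "(\<lambda>_. 0) \<in> carrier X"
    by (rule X_leI(1)[of _ 0]) (use fnorm_entries[OF t, of _ "mat (\<lambda>_. 0)"] in \<open>simp add: mat_def\<close>)
  show "Module.module real_field X"
    unfolding factor_space_def
    by (rule module_funs) (use X_add X_scale z in \<open>auto simp flip: X_carrier\<close>)
qed (use X_add X_scale in auto)

lemma X_minus: "x \<in> carrier X \<Longrightarrow> y \<in> carrier X \<Longrightarrow> x \<ominus>\<^bsub>X\<^esub> y = (\<lambda>n. x n - y n)"
proof -
  interpret seminormed_space X by (rule seminormed_X)
  assume "x \<in> carrier X" "y \<in> carrier X"
  then show ?thesis by (simp add: M.minus_eq uminus_smult)
qed

text \<open>For fixed n, \<open>fnorm\<close> is dominated by finitely many entries and hence passes
  to entrywise limits. The alternative \<open>k < K\<close> restricts the bound to late k.\<close>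

lemma fnorm_le_of_tendsto:
  assumes "\<And>m. (\<lambda>k. S k m) \<longlonglongrightarrow> l m" "\<And>k. fnorm t n (mat (\<lambda>i. x i - S k i)) \<le> e \<or> k < K"
  shows "fnorm t n (mat (\<lambda>i. x i - l i)) \<le> e"
proof -
  let ?d = "\<lambda>k. \<Sum>i<n. \<Sum>j<n. cmod (mat (\<lambda>m. S k m - l m) i j)"
  have "(\<lambda>k. e + ?d k) \<longlonglongrightarrow> e + (\<Sum>i<n. \<Sum>j<n. cmod (of_real (l (prod_encode (i,j)) - l (prod_encode (i,j))))) "
    unfolding mat_def by (intro tendsto_add tendsto_const tendsto_sum tendsto_norm tendsto_of_real tendsto_diff assms(1))
  then have lim: "(\<lambda>k. e + ?d k) \<longlonglongrightarrow> e" by simp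
  show ?thesis
  proof (rule LIMSEQ_le_const[OF lim], rule exI[of _ K], intro allI impI)
    fix k assume "k \<ge> K"
    have eq: "mat (\<lambda>i. x i - l i) = (\<lambda>i j. mat (\<lambda>i. x i - S k i) i j + mat (\<lambda>m. S k m - l m) i j)"
      by (simp add: mat_def fun_eq_iff)
    have "fnorm t n (mat (\<lambda>i. x i - l i)) \<le> fnorm t n (mat (\<lambda>i. x i - S k i)) + fnorm t n (mat (\<lambda>m. S k m - l m))"
      unfolding eq by (rule fnorm_add[OF t])
    then show "fnorm t n (mat (\<lambda>i. x i - l i)) \<le> e + ?d k"
      using fnorm_entries[OF t, of n "mat (\<lambda>m. S k m - l m)"] assms(2)[of k] \<open>k \<ge> K\<close> by linarith
  qed
qed

text \<open>Entries are bounded functionals, so a Cauchy sequence converges entrywise. The Cauchy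
  bounds hold for each truncation separately and survive the limit there.\<close>

theorem banach_X: "banach_space X"
proof (intro banach_space.intro normed_space.intro seminormed_X
    normed_space_axioms.intro banach_space_axioms.intro)
  show "x = \<zero>\<^bsub>X\<^esub>" if "x \<in> carrier X" "vnorm X x = 0" for x
    using entry_le_X[OF that(1)] that(2) by (auto simp: fun_eq_iff)
next
  fix S assume S: "cauchy_seq X S"
  interpret seminormed_space X by (rule seminormed_X)
  have Sin: "S k \<in> carrier X" for k using S by (simp add: cauchy_seq_def)
  have C: "\<exists>N. \<forall>m\<ge>N. \<forall>n\<ge>N. vnorm X (\<lambda>i. S m i - S n i) < e" if "e > 0" for e
    using CauD[OF S that] by (simp add: X_minus Sin)
  have din: "(\<lambda>i. S m i - S n i) \<in> carrier X" for m n
    using M.minus_closed[OF Sin[of m] Sin[of n]] by (simp add: X_minus Sin)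
  have "convergent (\<lambda>k. S k i)" for i
  proof (rule Cauchy_convergent, rule metric_CauchyI)
    fix e :: real assume "e > 0"
    then obtain N where N: "\<And>m n. m \<ge> N \<Longrightarrow> n \<ge> N \<Longrightarrow> vnorm X (\<lambda>i. S m i - S n i) < e"
      using C by blast
    have "dist (S m i) (S n i) < e" if "m \<ge> N" "n \<ge> N" for m n
      using entry_le_X[OF din[of m n], of i] N[OF that] by (simp add: dist_real_def)
    then show "\<exists>N. \<forall>m\<ge>N. \<forall>n\<ge>N. dist (S m i) (S n i) < e" by blast
  qed
  then obtain l where l: "\<And>i. (\<lambda>k. S k i) \<longlonglongrightarrow> l i"
    unfolding convergent_def by metis
  have key: "\<exists>N. \<forall>k\<ge>N. (\<lambda>i. S k i - l i) \<in> carrier X \<and> vnorm X (\<lambda>i. S k i - l i) \<le> e" if e: "e > 0" for e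
  proof -
    obtain N where N: "\<And>m n. m \<ge> N \<Longrightarrow> n \<ge> N \<Longrightarrow> vnorm X (\<lambda>i. S m i - S n i) < e"
      using C[OF e] by blast
    have "fnorm t n (mat (\<lambda>i. S k i - l i)) \<le> e" if "k \<ge> N" for k n
    proof (rule fnorm_le_of_tendsto[OF l])
      fix m
      have "fnorm t n (mat (\<lambda>i. S k i - S m i)) \<le> e" if "m \<ge> N"
        using fnorm_le_X[OF din[of k m], of n] N[OF \<open>k \<ge> N\<close> that] by linarith
      then show "fnorm t n (mat (\<lambda>i. S k i - S m i)) \<le> e \<or> m < N" by linarith
    qed
    from X_leI[OF this] show ?thesis by blast
  qed
  obtain k where k: "(\<lambda>i. S k i - l i) \<in> carrier X" using key[of 1] by auto
  from M.minus_closed[OF Sin[of k] this] have lin: "l \<in> carrier X"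
    by (simp add: X_minus[OF Sin[of k] k])
  show "\<exists>l\<in>carrier X. (\<lambda>n. vnorm X (S n \<ominus>\<^bsub>X\<^esub> l)) \<longlonglongrightarrow> 0"
  proof (rule bexI[OF _ lin], rule LIMSEQ_I)
    fix r :: real assume "r > 0"
    then obtain N where "\<forall>k\<ge>N. vnorm X (\<lambda>i. S k i - l i) \<le> r / 2" using key[of "r/2"] by auto
    then show "\<exists>N. \<forall>n\<ge>N. norm (vnorm X (S n \<ominus>\<^bsub>X\<^esub> l) - 0) < r"
      using \<open>r > 0\<close> norm_nonneg[OF M.minus_closed[OF Sin lin]]
      by (intro exI[of _ N]) (auto simp: X_minus Sin lin intro: le_less_trans)
  qed
qed

lemma finsum_X:
  assumes "finite A" "\<And>l. l \<in> A \<Longrightarrow> x l \<in> carrier X"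
  shows "(\<Oplus>\<^bsub>X\<^esub>l\<in>A. x l) = (\<lambda>m. \<Sum>l\<in>A. x l m)"
proof -
  interpret seminormed_space X by (rule seminormed_X)
  show ?thesis using assms
  proof (induction A)
    case (insert a A)
    then show ?case by (subst M.finsum_insert) auto
  qed simp
qed

theorem cotype_X: "finite_cotype X"
  unfolding finite_cotype_def has_cotype_def
proof (intro exI conjI allI impI)
  show "2 \<le> 2 * t" using t by simp
  \<comment> \<open>The 2 undoes the halving of y in complex convexity; sqrt 2 is the price of
    passing from eighth roots to real signs.\<close>
  show "(0::real) < 2 * sqrt 2" by simp
  fix N and x :: "nat \<Rightarrow> nat \<Rightarrow> real" assume "\<forall>l<N. x l \<in> carrier X"
  then have x: "\<And>l. l < N \<Longrightarrow> x l \<in> carrier X" by blast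
  interpret seminormed_space X by (rule seminormed_X)
  define f where "f \<epsilon> = vnorm X (\<Oplus>\<^bsub>X\<^esub>l\<in>{..<N}. \<epsilon> l \<odot>\<^bsub>X\<^esub> x l)" for \<epsilon>
  let ?M = "sqrt 2 * ((\<Sum>\<epsilon>\<in>signs N. f \<epsilon>) / 2 ^ N)"
  have n: "(\<Sum>l<N. (fnorm t n (mat (x l)) / 2) powr (2 * t)) powr (1 / (2 * t)) \<le> ?M" for n
  proof -
    have "fnorm t n (\<lambda>i j. \<Sum>l<N. of_real (\<epsilon> l) * mat (x l) i j) \<le> f \<epsilon>" for \<epsilon> :: "nat \<Rightarrow> real"
    proof -
      have "(\<Oplus>\<^bsub>X\<^esub>l\<in>{..<N}. \<epsilon> l \<odot>\<^bsub>X\<^esub> x l) \<in> carrier X"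
        by (intro M.finsum_closed) (auto intro: X_scale(1) x)
      moreover have e: "(\<Oplus>\<^bsub>X\<^esub>l\<in>{..<N}. \<epsilon> l \<odot>\<^bsub>X\<^esub> x l) = (\<lambda>m. \<Sum>l<N. \<epsilon> l * x l m)"
        by (subst finsum_X) (auto intro: X_scale(1) x)
      moreover have "mat (\<lambda>m. \<Sum>l<N. \<epsilon> l * x l m) = (\<lambda>i j. \<Sum>l<N. of_real (\<epsilon> l) * mat (x l) i j)"
        by (simp add: mat_def fun_eq_iff)
      ultimately show ?thesis unfolding f_def e using fnorm_le_X by metis
    qed
    then have "sqrt 2 * ((\<Sum>\<epsilon>\<in>signs N. fnorm t n (\<lambda>i j. \<Sum>l<N. of_real (\<epsilon> l) * mat (x l) i j)) / 2 ^ N) \<le> ?M"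
      by (intro mult_left_mono divide_right_mono sum_mono) auto
    then show ?thesis using fnorm_cotype[OF t, of n "\<lambda>l. mat (x l)" N] by linarith
  qed
  \<comment> \<open>Truncation norms increase with n, so the suprema are limits and all N of them
    are approached along the same n.\<close>
  have lim: "(\<lambda>n. fnorm t n (mat (x l))) \<longlonglongrightarrow> vnorm X (x l)" if "l < N" for l
    unfolding X_norm using x[OF that] fnorm_mono[OF t]
    by (intro LIMSEQ_incseq_SUP) (auto simp: X_carrier incseq_def)
  have "(\<lambda>n. (\<Sum>l<N. (fnorm t n (mat (x l)) / 2) powr (2 * t)) powr (1 / (2 * t)))
      \<longlonglongrightarrow> (\<Sum>l<N. (vnorm X (x l) / 2) powr (2 * t)) powr (1 / (2 * t))"
    using t by (intro tendsto_powr' tendsto_sum tendsto_divide tendsto_const lim)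
      (auto intro!: always_eventually sum_nonneg simp: fnorm_nonneg)
  then have "(\<Sum>l<N. (vnorm X (x l) / 2) powr (2 * t)) powr (1 / (2 * t)) \<le> ?M"
    by (rule LIMSEQ_le_const2) (use n in blast)
  also have "(\<Sum>l<N. (vnorm X (x l) / 2) powr (2 * t)) powr (1 / (2 * t)) =
      (\<Sum>l<N. vnorm X (x l) powr (2 * t)) powr (1 / (2 * t)) / 2"
    using t x by (simp add: powr_divide powr_powr sum_nonneg flip: sum_divide_distrib)
  finally have "(\<Sum>l<N. vnorm X (x l) powr (2 * t)) powr (1 / (2 * t)) \<le>
      2 * sqrt 2 * ((\<Sum>\<epsilon>\<in>signs N. f \<epsilon>) / 2 ^ N)" by (simp add: mult_ac)
  also have "\<dots> \<le> 2 * sqrt 2 * sqrt ((\<Sum>\<epsilon>\<in>signs N. (f \<epsilon>)\<^sup>2) / 2 ^ N)"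
    by (intro mult_left_mono mean_le_rms_signs) auto
  finally show "(\<Sum>i<N. vnorm X (x i) powr (2 * t)) powr (1 / (2 * t)) \<le> 2 * sqrt 2 *
      sqrt (measure_pmf.expectation (pmf_of_set (signs N)) (\<lambda>\<epsilon>. (vnorm X (\<Oplus>\<^bsub>X\<^esub>i\<in>{..<N}. \<epsilon> i \<odot>\<^bsub>X\<^esub> x i))\<^sup>2))"
    by (simp only: expectation_signs f_def)
qed

end

section \<open>Tensors with prescribed coordinates\<close>

text \<open>Young's inequality after normalizing by a and b; if one of them is 0, all products
  vanish.\<close>

lemma holder_finite:
  fixes u v :: "'k \<Rightarrow> real"
  assumes p: "1 < p" "1 < t" "1 / p + 1 / t = 1"
    and uv: "finite W" "(\<Sum>w\<in>W. \<bar>u w\<bar> powr p) \<le> a powr p" "(\<Sum>w\<in>W. \<bar>v w\<bar> powr t) \<le> b powr t" "0 \<le> a" "0 \<le> b"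
  shows "(\<Sum>w\<in>W. \<bar>u w\<bar> * \<bar>v w\<bar>) \<le> a * b"
proof (cases "a = 0 \<or> b = 0")
  case True
  have z: "f w = 0" if "(\<Sum>w\<in>W. \<bar>f w\<bar> powr s) \<le> 0" "w \<in> W" for f :: "'k \<Rightarrow> real" and s w
  proof -
    have "(\<Sum>w\<in>W. \<bar>f w\<bar> powr s) = 0" using that(1) sum_nonneg[of W "\<lambda>w. \<bar>f w\<bar> powr s"] by simp
    then show ?thesis using that(2) uv(1) by (simp add: sum_nonneg_eq_0_iff)
  qed
  have "u w * v w = 0" if "w \<in> W" for w
    using True z[of u p, OF _ that] z[of v t, OF _ that] uv by auto
  then have "(\<Sum>w\<in>W. \<bar>u w\<bar> * \<bar>v w\<bar>) = 0" by (intro sum.neutral) (auto simp flip: abs_mult)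
  then show ?thesis using uv by simp
next
  case False
  then have ab: "0 < a" "0 < b" using uv by auto
  have "(\<Sum>w\<in>W. (\<bar>u w\<bar> / a) * (\<bar>v w\<bar> / b)) \<le> (\<Sum>w\<in>W. (\<bar>u w\<bar> / a) powr p / p + (\<bar>v w\<bar> / b) powr t / t)"
    using ab by (intro sum_mono Youngs_inequality p) auto
  also have "\<dots> = (\<Sum>w\<in>W. \<bar>u w\<bar> powr p) / a powr p / p + (\<Sum>w\<in>W. \<bar>v w\<bar> powr t) / b powr t / t"
    using ab by (simp add: sum.distrib powr_divide flip: sum_divide_distrib)
  also have "\<dots> \<le> 1 / p + 1 / t"
    using uv ab p by (intro add_mono divide_right_mono) (auto simp: divide_le_eq_1)
  also have "\<dots> = 1" by (rule p)
  finally show ?thesis using ab by (simp add: field_simps flip: sum_divide_distrib)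
qed

lemma bilinear_zero:
  assumes "seminormed_space X" "A \<in> bilinear_forms X Y" "y \<in> carrier Y"
  shows "A \<zero>\<^bsub>X\<^esub> y = 0"
proof -
  interpret X: seminormed_space X by fact
  have "A (0 \<odot>\<^bsub>X\<^esub> \<zero>\<^bsub>X\<^esub>) y = 0 * A \<zero>\<^bsub>X\<^esub> y"
    using assms(2,3) X.M.zero_closed unfolding bilinear_forms_def by blast
  then show ?thesis using X.smult_l_null[of "\<zero>\<^bsub>X\<^esub>"] by simp
qed

context tensor_spaces
begin

abbreviation "T \<equiv> alg_tensor X Y"

lemma T_ops [simp]:
  "z \<oplus>\<^bsub>T\<^esub> w = (\<lambda>A. z A + w A)" "c \<odot>\<^bsub>T\<^esub> z = (\<lambda>A. c * z A)" "\<zero>\<^bsub>T\<^esub> = (\<lambda>A. 0)"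
  "vnorm T = proj_norm X Y"
  by (simp_all add: alg_tensor_def)

lemma T_sum:
  assumes "finite K" "\<And>k. k \<in> K \<Longrightarrow> z k \<in> carrier T"
  shows "(\<lambda>A. \<Sum>k\<in>K. z k A) \<in> carrier T"
    and "proj_norm X Y (\<lambda>A. \<Sum>k\<in>K. z k A) \<le> (\<Sum>k\<in>K. proj_norm X Y (z k))"
    and "(\<Oplus>\<^bsub>T\<^esub>k\<in>K. z k) = (\<lambda>A. \<Sum>k\<in>K. z k A)"
proof -
  interpret T: seminormed_space T by (rule seminormed_alg_tensor)
  have "(\<lambda>A. \<Sum>k\<in>K. z k A) \<in> carrier T \<and>
     proj_norm X Y (\<lambda>A. \<Sum>k\<in>K. z k A) \<le> (\<Sum>k\<in>K. proj_norm X Y (z k)) \<and>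
     (\<Oplus>\<^bsub>T\<^esub>k\<in>K. z k) = (\<lambda>A. \<Sum>k\<in>K. z k A)"
    using assms
  proof (induction K)
    case empty
    then show ?case using T.M.zero_closed T.norm_zero by simp
  next
    case (insert k K)
    have IH: "(\<lambda>A. \<Sum>k\<in>K. z k A) \<in> carrier T"
      "proj_norm X Y (\<lambda>A. \<Sum>k\<in>K. z k A) \<le> (\<Sum>k\<in>K. proj_norm X Y (z k))"
      "(\<Oplus>\<^bsub>T\<^esub>k\<in>K. z k) = (\<lambda>A. \<Sum>k\<in>K. z k A)"
      using insert by simp_all
    have "(\<lambda>A. z k A + (\<Sum>k\<in>K. z k A)) \<in> carrier T"
      using T.M.a_closed[of "z k", OF _ IH(1)] insert by simp
    moreover have "proj_norm X Y (\<lambda>A. z k A + (\<Sum>k\<in>K. z k A)) \<le> proj_norm X Y (z k) + (\<Sum>k\<in>K. proj_norm X Y (z k))"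
      using T.norm_triangle[of "z k", OF _ IH(1)] IH(2) insert by simp
    moreover have "(\<Oplus>\<^bsub>T\<^esub>k\<in>insert k K. z k) = z k \<oplus>\<^bsub>T\<^esub> (\<Oplus>\<^bsub>T\<^esub>k\<in>K. z k)"
      using insert by (intro T.M.finsum_insert) auto
    ultimately show ?case using insert IH(3) by simp
  qed
  then show "(\<lambda>A. \<Sum>k\<in>K. z k A) \<in> carrier T"
    and "proj_norm X Y (\<lambda>A. \<Sum>k\<in>K. z k A) \<le> (\<Sum>k\<in>K. proj_norm X Y (z k))"
    and "(\<Oplus>\<^bsub>T\<^esub>k\<in>K. z k) = (\<lambda>A. \<Sum>k\<in>K. z k A)" by auto
qed

lemma T_scale:
  assumes "z \<in> carrier T"
  shows "(\<lambda>A. c * z A) \<in> carrier T" "proj_norm X Y (\<lambda>A. c * z A) = \<bar>c\<bar> * proj_norm X Y z"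
proof -
  interpret T: seminormed_space T by (rule seminormed_alg_tensor)
  show "(\<lambda>A. c * z A) \<in> carrier T" using T.smult_closed'[OF assms, of c] by simp
  show "proj_norm X Y (\<lambda>A. c * z A) = \<bar>c\<bar> * proj_norm X Y z" using T.norm_smult[OF assms, of c] by simp
qed

lemma T_elem:
  assumes "x \<in> carrier X" "y \<in> carrier Y"
  shows "elem_tensor X Y x y \<in> carrier T" "proj_norm X Y (elem_tensor X Y x y) \<le> vnorm X x * vnorm Y y"
proof -
  have r: "represents X Y 1 (\<lambda>_. x) (\<lambda>_. y) (elem_tensor X Y x y)"
    using assms by (simp add: represents_def)
  then show "elem_tensor X Y x y \<in> carrier T" by (auto simp: alg_tensor_def)
  show "proj_norm X Y (elem_tensor X Y x y) \<le> vnorm X x * vnorm Y y"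
    using proj_norm_le[OF r] by simp
qed

text \<open>The lower bound by duality. Tensors are functionals on bilinear forms, so pairing z with
  A is just \<open>z A\<close>.\<close>

lemma proj_norm_ge:
  assumes z: "z \<in> carrier T" and A: "A \<in> bilinear_forms X Y"
    and bd: "\<And>x y. x \<in> carrier X \<Longrightarrow> y \<in> carrier Y \<Longrightarrow> \<bar>A x y\<bar> \<le> vnorm X x * vnorm Y y"
  shows "\<bar>z A\<bar> \<le> proj_norm X Y z"
  unfolding proj_norm_def
proof (rule cInf_greatest)
  show "{\<Sum>i<N. vnorm X (x i) * vnorm Y (y i) |N x y. represents X Y N x y z} \<noteq> {}"
    using z by (auto simp: alg_tensor_def)
  fix r assume "r \<in> {\<Sum>i<N. vnorm X (x i) * vnorm Y (y i) |N x y. represents X Y N x y z}"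
  then obtain N x y where r: "r = (\<Sum>i<N. vnorm X (x i) * vnorm Y (y i))" and R: "represents X Y N x y z"
    by blast
  have "z A = (\<Sum>i<N. A (x i) (y i))" using R A by (simp add: represents_def elem_tensor_def)
  then have "\<bar>z A\<bar> \<le> (\<Sum>i<N. \<bar>A (x i) (y i)\<bar>)" by simp
  also have "\<dots> \<le> r" unfolding r using R by (intro sum_mono bd) (auto simp: represents_def)
  finally show "\<bar>z A\<bar> \<le> r" .
qed

end

lemma bilinear_sum_left:
  fixes X :: "('m \<Rightarrow> real) nspace"
  assumes X: "seminormed_space X" and A: "A \<in> bilinear_forms X Y"
    and ops: "\<And>x y. x \<oplus>\<^bsub>X\<^esub> y = (\<lambda>m. x m + y m)" "\<And>c x. c \<odot>\<^bsub>X\<^esub> x = (\<lambda>m. c * x m)" "\<zero>\<^bsub>X\<^esub> = (\<lambda>m. 0)"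
    and K: "finite K" "\<And>k. k \<in> K \<Longrightarrow> u k \<in> carrier X" and y: "y \<in> carrier Y"
  shows "(\<lambda>m. \<Sum>k\<in>K. c k * u k m) \<in> carrier X \<and> A (\<lambda>m. \<Sum>k\<in>K. c k * u k m) y = (\<Sum>k\<in>K. c k * A (u k) y)"
  using K
proof (induction K)
  case empty
  interpret X: seminormed_space X by fact
  show ?case using bilinear_zero[OF X A y] X.M.zero_closed by (simp add: ops)
next
  case (insert k K)
  interpret X: seminormed_space X by fact
  have uk: "u k \<in> carrier X" using insert by simp
  have c: "(\<lambda>m. c k * u k m) \<in> carrier X" using X.smult_closed'[OF uk, of "c k"] by (simp add: ops)
  have IH: "(\<lambda>m. \<Sum>k\<in>K. c k * u k m) \<in> carrier X" "A (\<lambda>m. \<Sum>k\<in>K. c k * u k m) y = (\<Sum>k\<in>K. c k * A (u k) y)"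
    using insert by auto
  have "A ((\<lambda>m. c k * u k m) \<oplus>\<^bsub>X\<^esub> (\<lambda>m. \<Sum>k\<in>K. c k * u k m)) y =
      A (\<lambda>m. c k * u k m) y + A (\<lambda>m. \<Sum>k\<in>K. c k * u k m) y"
    using A c IH(1) y unfolding bilinear_forms_def by blast
  moreover have "A (c k \<odot>\<^bsub>X\<^esub> u k) y = c k * A (u k) y"
    using A uk y unfolding bilinear_forms_def by blast
  ultimately show ?case
    using insert IH(2) X.M.a_closed[OF c IH(1)] by (simp add: ops)
qed

lemma bilinear_flip: "A \<in> bilinear_forms X Y \<Longrightarrow> (\<lambda>y x. A x y) \<in> bilinear_forms Y X"
  unfolding bilinear_forms_def by blast

definition unit_vec :: "nat \<Rightarrow> nat \<Rightarrow> real" where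
  "unit_vec k m = (if m = k then 1 else 0)"

section \<open>Finite arrays as tensors over l_p and the factorization space\<close>

locale lp_factor =
  fixes p :: real
  assumes p1: "1 < p"
begin

definition t where "t = p / (p - 1)"

lemma t1: "1 < t" and conj: "1 / p + 1 / t = 1"
  using p1 by (auto simp: t_def field_simps)

sublocale L: lp p by unfold_locales (use p1 in simp)
sublocale F: factor t by unfold_locales (use t1 in simp)
sublocale TS: tensor_spaces "lp_space p" "factor_space t"
  by (intro tensor_spaces.intro L.seminormed_lp F.seminormed_X)

abbreviation "PN \<equiv> proj_norm (lp_space p) (factor_space t)"

definition cut_vec :: "nat \<Rightarrow> (nat \<Rightarrow> real) \<Rightarrow> nat \<Rightarrow> real" where
  "cut_vec n c i = (if i < n then c i else 0)"

definition cut_mat :: "nat \<Rightarrow> (nat \<Rightarrow> nat \<Rightarrow> real) \<Rightarrow> nat \<Rightarrow> real" where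
  "cut_mat n D m = (case prod_decode m of (i, j) \<Rightarrow> if i < n \<and> j < n then D i j else 0)"

text \<open>Reads an n x n x n array as a tensor, linearly in f, so that estimates for arrays of
  numbers turn into estimates for tensors.\<close>

definition tens :: "nat \<Rightarrow> (nat \<Rightarrow> nat \<Rightarrow> nat \<Rightarrow> real) \<Rightarrow> (nat \<Rightarrow> real, nat \<Rightarrow> real) tensor" where
  "tens n f = (\<lambda>A. \<Sum>(w, i, j)\<in>{..<n} \<times> {..<n} \<times> {..<n}.
     f w i j * elem_tensor (lp_space p) (factor_space t) (unit_vec w) (unit_vec (prod_encode (i, j))) A)"

lemma cut_vec_norm:
  assumes "\<And>i. i < n \<Longrightarrow> \<bar>c i\<bar> \<le> 1"
  shows "cut_vec n c \<in> carrier (lp_space p)" "vnorm (lp_space p) (cut_vec n c) \<le> real n powr (1 / p)"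
proof -
  have e: "cut_vec n c = (\<lambda>i. if i < n then c i else 0)" by (simp add: cut_vec_def fun_eq_iff)
  show "cut_vec n c \<in> carrier (lp_space p)" unfolding e using lp_cutoff(1) p1 by simp
  have "(\<Sum>i<n. \<bar>c i\<bar> powr p) \<le> (\<Sum>i<n. 1)"
    using assms p1 powr_mono2[of p _ 1] by (intro sum_mono) auto
  then show "vnorm (lp_space p) (cut_vec n c) \<le> real n powr (1 / p)"
    unfolding e using lp_cutoff(2)[of p n c] p1 by (simp add: powr_mono2 sum_nonneg)
qed

lemma unit_vec_lp: "unit_vec k \<in> carrier (lp_space p)" "vnorm (lp_space p) (unit_vec k) \<le> 1"
proof -
  have e: "unit_vec k = (\<lambda>i. if i < Suc k then if i = k then 1 else 0 else 0)"
    by (simp add: unit_vec_def fun_eq_iff)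
  have q: "(\<Sum>i<Suc k. \<bar>if i = k then 1 else 0\<bar> powr p) = 1" by simp
  show "unit_vec k \<in> carrier (lp_space p)" unfolding e using p1 by (intro lp_cutoff(1)) simp
  have "vnorm (lp_space p) (unit_vec k) = (\<Sum>i<Suc k. \<bar>if i = k then 1 else 0\<bar> powr p) powr (1 / p)"
    unfolding e using p1 by (intro lp_cutoff(2)) simp
  then show "vnorm (lp_space p) (unit_vec k) \<le> 1" unfolding q by simp
qed

lemma unit_vec_factor:
  "unit_vec k \<in> carrier (factor_space t)" "vnorm (factor_space t) (unit_vec k) \<le> 1"
proof -
  obtain i0 j0 where k: "k = prod_encode (i0, j0)" by (metis prod_decode_inverse surj_pair)
  have "mat (unit_vec k) = (\<lambda>i j. if i = i0 \<and> j = j0 then 1 else 0)"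
    by (auto simp: mat_def unit_vec_def k fun_eq_iff)
  then have "fnorm t n (mat (unit_vec k)) \<le> 1" for n
    using fnorm_le[OF _ factors_unit[of t n i0 j0]] t1 by simp
  from F.X_leI[OF this]
  show "unit_vec k \<in> carrier (factor_space t)" "vnorm (factor_space t) (unit_vec k) \<le> 1" .
qed

text \<open>Rows and columns are unit vectors, so each budget sums to at most n, that is r =
  n^(1/t). The index type \<open>bool\<close> gives dimension 2, which suffices for real and
  imaginary parts.\<close>

lemma cut_mat_norm:
  fixes u v :: "nat \<Rightarrow> bool \<Rightarrow> complex"
  assumes "\<And>i j. i < n \<Longrightarrow> j < n \<Longrightarrow> complex_of_real (D i j) = herm UNIV (u i) (v j)"
    and "\<And>i. i < n \<Longrightarrow> nsq UNIV (u i) = 1" "\<And>i. i < n \<Longrightarrow> nsq UNIV (v i) = 1"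
  shows "cut_mat n D \<in> carrier (factor_space t)" "vnorm (factor_space t) (cut_mat n D) \<le> real n powr (1 / t)"
proof -
  have s: "(\<Sum>i<N. nsq UNIV (if i < n then c i else (\<lambda>_. 0)) powr t) \<le> (real n powr (1 / t)) powr t"
    if "\<And>i. i < n \<Longrightarrow> nsq UNIV (c i) = 1" for c :: "nat \<Rightarrow> bool \<Rightarrow> complex" and N
  proof -
    have "(\<Sum>i<N. nsq UNIV (if i < n then c i else (\<lambda>_. 0)) powr t) = (\<Sum>i<N. if i < n then 1 else 0)"
      using that by (intro sum.cong) (auto simp: nsq_def[of _ "\<lambda>_. 0"])
    also have "\<dots> = real (card ({..<N} \<inter> {i. i < n}))" by (simp add: sum.If_cases)
    also have "\<dots> \<le> real (card {..<n})" by (intro of_nat_mono card_mono) auto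
    finally show ?thesis using t1 by (simp add: powr_powr)
  qed
  have "fnorm t N (mat (cut_mat n D)) \<le> real n powr (1 / t)" for N
  proof (rule fnorm_le)
    show "factors t N (real n powr (1 / t)) (mat (cut_mat n D))"
    proof (rule factorsI[OF _ _ s[of u] s[of v]])
      show "mat (cut_mat n D) i j = herm UNIV (if i < n then u i else (\<lambda>_. 0)) (if j < n then v j else (\<lambda>_. 0))" for i j
        using assms(1) by (simp add: mat_def cut_mat_def) (simp add: herm_def)
    qed (use assms in auto)
  qed simp
  from F.X_leI[OF this]
  show "cut_mat n D \<in> carrier (factor_space t)" "vnorm (factor_space t) (cut_mat n D) \<le> real n powr (1 / t)" .
qed

lemma tens_carrier: "tens n f \<in> carrier (alg_tensor (lp_space p) (factor_space t))"
  unfolding tens_def split_beta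
  by (intro TS.T_sum(1) TS.T_scale(1) TS.T_elem(1) unit_vec_lp unit_vec_factor) auto

lemma tens_scale: "tens n (\<lambda>w i j. c * f w i j) = (\<lambda>A. c * tens n f A)"
  unfolding tens_def split_beta by (simp add: sum_distrib_left mult.assoc)

lemma tens_sum: "tens n (\<lambda>w i j. \<Sum>k\<in>K. f k w i j) = (\<lambda>A. \<Sum>k\<in>K. tens n (f k) A)"
  unfolding tens_def split_beta by (simp add: sum_distrib_right sum.swap[of _ K])

lemma PN_tens_scale: "PN (tens n (\<lambda>w i j. c * f w i j)) = \<bar>c\<bar> * PN (tens n f)"
  unfolding tens_scale by (rule TS.T_scale(2)[OF tens_carrier])

lemma PN_tens_sum: "finite K \<Longrightarrow> PN (tens n (\<lambda>w i j. \<Sum>k\<in>K. f k w i j)) \<le> (\<Sum>k\<in>K. PN (tens n (f k)))"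
  unfolding tens_sum by (rule TS.T_sum(2)) (auto intro: tens_carrier)

lemma PN_tens_add: "PN (tens n (\<lambda>w i j. f w i j + g w i j)) \<le> PN (tens n f) + PN (tens n g)"
  using PN_tens_sum[of UNIV n "\<lambda>b. if b then f else g"] by (simp add: UNIV_bool add.commute)

text \<open>A wasteful bound, meant for arrays whose entries are all tiny.\<close>

lemma PN_tens_entries: "PN (tens n f) \<le> (\<Sum>w<n. \<Sum>i<n. \<Sum>j<n. \<bar>f w i j\<bar>)"
proof -
  let ?e = "\<lambda>w i j. elem_tensor (lp_space p) (factor_space t) (unit_vec w) (unit_vec (prod_encode (i, j)))"
  have e: "?e w i j \<in> carrier (alg_tensor (lp_space p) (factor_space t))" for w i j
    by (rule TS.T_elem(1)[OF unit_vec_lp(1) unit_vec_factor(1)])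
  have e1: "PN (?e w i j) \<le> 1" for w i j
  proof -
    have "PN (?e w i j) \<le> vnorm (lp_space p) (unit_vec w) * vnorm (factor_space t) (unit_vec (prod_encode (i, j)))"
      by (rule TS.T_elem(2)[OF unit_vec_lp(1) unit_vec_factor(1)])
    also have "\<dots> \<le> 1 * 1"
      using TS.Y.norm_nonneg[OF unit_vec_factor(1)] by (intro mult_mono unit_vec_lp unit_vec_factor) auto
    finally show ?thesis by simp
  qed
  have "PN (tens n f) \<le> (\<Sum>(w, i, j)\<in>{..<n} \<times> {..<n} \<times> {..<n}. PN (\<lambda>A. f w i j * ?e w i j A))"
    unfolding tens_def split_beta by (intro TS.T_sum(2) TS.T_scale(1) e) auto
  also have "\<dots> \<le> (\<Sum>(w, i, j)\<in>{..<n} \<times> {..<n} \<times> {..<n}. \<bar>f w i j\<bar>)"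
    unfolding split_beta TS.T_scale(2)[OF e] using e1 by (intro sum_mono mult_left_le) auto
  finally show ?thesis by (simp add: sum.cartesian_product)
qed

lemma elem_cut: 
  assumes "cut_mat n D \<in> carrier (factor_space t)"
  shows "elem_tensor (lp_space p) (factor_space t) (cut_vec n c) (cut_mat n D) = tens n (\<lambda>w i j. c w * D i j)"
proof
  fix A :: "(nat \<Rightarrow> real) \<Rightarrow> (nat \<Rightarrow> real) \<Rightarrow> real"
  show "elem_tensor (lp_space p) (factor_space t) (cut_vec n c) (cut_mat n D) A = tens n (\<lambda>w i j. c w * D i j) A"
  proof (cases "A \<in> bilinear_forms (lp_space p) (factor_space t)")
    case False
    then show ?thesis by (simp add: elem_tensor_def tens_def)
  next
    case True
    have cv: "cut_vec n c = (\<lambda>m. \<Sum>k<n. c k * unit_vec k m)"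
    proof
      fix m show "cut_vec n c m = (\<Sum>k<n. c k * unit_vec k m)"
        using sum.delta[of "{..<n}" m c] by (simp add: cut_vec_def unit_vec_def if_distrib cong: if_cong)
    qed
    have cm: "cut_mat n D = (\<lambda>m. \<Sum>k\<in>{..<n} \<times> {..<n}. D (fst k) (snd k) * unit_vec (prod_encode k) m)"
    proof
      fix m
      obtain i j where m: "m = prod_encode (i, j)" by (metis prod_decode_inverse surj_pair)
      have "(\<Sum>k\<in>{..<n} \<times> {..<n}. D (fst k) (snd k) * unit_vec (prod_encode k) m) =
          (\<Sum>k\<in>{..<n} \<times> {..<n}. if (i, j) = k then D (fst k) (snd k) else 0)"
        by (intro sum.cong) (auto simp: unit_vec_def m)
      also have "\<dots> = (if (i, j) \<in> {..<n} \<times> {..<n} then D i j else 0)"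
        by (simp only: sum.delta' finite_cartesian_product finite_lessThan fst_conv snd_conv)
      finally show "cut_mat n D m = (\<Sum>k\<in>{..<n} \<times> {..<n}. D (fst k) (snd k) * unit_vec (prod_encode k) m)"
        by (simp add: cut_mat_def m)
    qed
    have "A (cut_vec n c) (cut_mat n D) = (\<Sum>k<n. c k * A (unit_vec k) (cut_mat n D))"
      unfolding cv using bilinear_sum_left[OF L.seminormed_lp True, of "{..<n}" unit_vec "cut_mat n D" c]
        assms unit_vec_lp by simp
    also have "\<dots> = (\<Sum>w<n. c w * (\<Sum>k\<in>{..<n} \<times> {..<n}. D (fst k) (snd k) * A (unit_vec w) (unit_vec (prod_encode k))))"
      unfolding cm using bilinear_sum_left[OF F.seminormed_X bilinear_flip[OF True],
          of "{..<n} \<times> {..<n}" "\<lambda>k. unit_vec (prod_encode k)" _ "\<lambda>k. D (fst k) (snd k)"]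
        unit_vec_factor unit_vec_lp by simp
    also have "\<dots> = tens n (\<lambda>w i j. c w * D i j) A"
      unfolding tens_def using True
      by (simp add: sum_distrib_left sum.cartesian_product split_beta mult.assoc elem_tensor_def)
    finally show ?thesis using True by (simp add: elem_tensor_def)
  qed
qed

text \<open>The spaces are real, so Im (c a b) is split as Re c Im (a b) + Im c Re (a b). Each part
  is an elementary tensor of norm at most n^(1/p) * n^(1/t) = n.\<close>

lemma PN_rank_one:
  fixes a b c :: "nat \<Rightarrow> complex"
  assumes u: "\<And>w. w < n \<Longrightarrow> cmod (c w) = 1" "\<And>w. w < n \<Longrightarrow> cmod (a w) = 1" "\<And>w. w < n \<Longrightarrow> cmod (b w) = 1"
  shows "PN (tens n (\<lambda>w i j. Im (c w * a i * b j))) \<le> 2 * real n"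
proof -
  have np: "real n powr (1 / p) * real n powr (1 / t) = real n"
    using conj by (simp flip: powr_add)
  have one: "PN (tens n (\<lambda>w i j. k w * D i j)) \<le> real n"
    if "\<And>w. w < n \<Longrightarrow> \<bar>k w\<bar> \<le> 1" "cut_mat n D \<in> carrier (factor_space t)"
      "vnorm (factor_space t) (cut_mat n D) \<le> real n powr (1 / t)" for k D
  proof -
    have "PN (tens n (\<lambda>w i j. k w * D i j)) \<le> vnorm (lp_space p) (cut_vec n k) * vnorm (factor_space t) (cut_mat n D)"
      unfolding elem_cut[OF that(2), symmetric]
      by (intro TS.T_elem(2) cut_vec_norm(1) that)
    also have "\<dots> \<le> real n powr (1 / p) * real n powr (1 / t)"
      using cut_vec_norm(2)[OF that(1)] that(3) L.lp_norm_nonneg TS.Y.norm_nonneg[OF that(2)]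
      by (intro mult_mono) auto
    finally show ?thesis unfolding np .
  qed
  \<comment> \<open>U z is the plane vector (Re z, Im z), so \<open>herm UNIV (U z) (U w)\<close>
    equals Re (z * cnj w).\<close>
  define U where "U z s = (if s then complex_of_real (Re z) else complex_of_real (Im z))" for z and s :: bool
  have q: "nsq UNIV (U z) = (cmod z)\<^sup>2" for z
    by (simp add: nsq_def U_def UNIV_bool cmod_power2)
  have "complex_of_real (Im (a i * b j)) = herm UNIV (U (a i)) (U (\<i> * cnj (b j)))" for i j
    by (simp add: herm_def U_def UNIV_bool algebra_simps flip: of_real_mult of_real_add)
  then have 1: "cut_mat n (\<lambda>i j. Im (a i * b j)) \<in> carrier (factor_space t)"
    "vnorm (factor_space t) (cut_mat n (\<lambda>i j. Im (a i * b j))) \<le> real n powr (1 / t)"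
    by (rule cut_mat_norm; simp add: q u norm_mult)+
  have "complex_of_real (Re (a i * b j)) = herm UNIV (U (a i)) (U (cnj (b j)))" for i j
    by (simp add: herm_def U_def UNIV_bool algebra_simps flip: of_real_mult of_real_add)
  then have 2: "cut_mat n (\<lambda>i j. Re (a i * b j)) \<in> carrier (factor_space t)"
    "vnorm (factor_space t) (cut_mat n (\<lambda>i j. Re (a i * b j))) \<le> real n powr (1 / t)"
    by (rule cut_mat_norm; simp add: q u norm_mult)+
  have "PN (tens n (\<lambda>w i j. Im (c w * a i * b j))) =
      PN (tens n (\<lambda>w i j. Re (c w) * Im (a i * b j) + Im (c w) * Re (a i * b j)))"
    by (simp only: mult.assoc times_complex.simps)
  also have "\<dots> \<le> PN (tens n (\<lambda>w i j. Re (c w) * Im (a i * b j))) + PN (tens n (\<lambda>w i j. Im (c w) * Re (a i * b j)))"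
    by (rule PN_tens_add)
  also have "\<dots> \<le> real n + real n"
    using abs_Re_le_cmod abs_Im_le_cmod u(1) by (intro add_mono one 1 2) (metis)+
  finally show ?thesis by simp
qed

text \<open>The bilinear form that reads off a weighted matching has norm at most 1, by Hoelder and
  \<open>fnorm_permutation\<close>; \<open>proj_norm_ge\<close> then applies.\<close>

lemma PN_matching:
  fixes s :: "nat \<Rightarrow> real"
  assumes s: "\<And>w. w < n \<Longrightarrow> \<bar>s w\<bar> \<le> 1"
    and inj: "inj_on \<sigma> {..<n}" "inj_on \<tau> {..<n}" "\<sigma> ` {..<n} \<subseteq> {..<n}" "\<tau> ` {..<n} \<subseteq> {..<n}"
  shows "\<bar>\<Sum>w<n. s w * f w (\<sigma> w) (\<tau> w)\<bar> \<le> PN (tens n f)"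
proof -
  define B where "B c x = (\<Sum>w<n. s w * (c w * x (prod_encode (\<sigma> w, \<tau> w))))" for c x :: "nat \<Rightarrow> real"
  have B: "B \<in> bilinear_forms (lp_space p) (factor_space t)"
    unfolding bilinear_forms_def B_def
    by (simp add: algebra_simps sum.distrib sum_distrib_left)
  have "\<bar>B c x\<bar> \<le> vnorm (lp_space p) c * vnorm (factor_space t) x"
    if c: "c \<in> carrier (lp_space p)" and x: "x \<in> carrier (factor_space t)" for c x
  proof -
    have "\<bar>B c x\<bar> \<le> (\<Sum>w<n. \<bar>s w * (c w * x (prod_encode (\<sigma> w, \<tau> w)))\<bar>)" unfolding B_def by simp
    also have "\<dots> \<le> (\<Sum>w<n. \<bar>c w\<bar> * \<bar>x (prod_encode (\<sigma> w, \<tau> w))\<bar>)"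
      using s by (intro sum_mono) (auto simp: abs_mult intro!: mult_left_le_one_le)
    also have "\<dots> \<le> vnorm (lp_space p) c * vnorm (factor_space t) x"
    proof (rule holder_finite[OF p1 t1 conj])
      show "(\<Sum>w<n. \<bar>c w\<bar> powr p) \<le> vnorm (lp_space p) c powr p"
        using L.partial_le[OF c order_refl] .
      have "(\<Sum>w<n. \<bar>x (prod_encode (\<sigma> w, \<tau> w))\<bar> powr t) = (\<Sum>w<n. cmod (mat x (\<sigma> w) (\<tau> w)) powr t)"
        by (simp add: mat_def)
      also have "\<dots> \<le> fnorm t n (mat x) powr t"
        using t1 inj by (intro fnorm_permutation) auto
      also have "\<dots> \<le> vnorm (factor_space t) x powr t"
        using t1 F.fnorm_le_X[OF x] by (intro powr_mono2 fnorm_nonneg) auto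
      finally show "(\<Sum>w<n. \<bar>x (prod_encode (\<sigma> w, \<tau> w))\<bar> powr t) \<le> vnorm (factor_space t) x powr t" .
    qed (use L.lp_norm_nonneg TS.Y.norm_nonneg[OF x] in auto)
    finally show ?thesis .
  qed
  from TS.proj_norm_ge[OF tens_carrier B this, of n f]
  have "\<bar>tens n f B\<bar> \<le> PN (tens n f)" .
  also have "tens n f B = (\<Sum>w<n. s w * f w (\<sigma> w) (\<tau> w))"
  proof -
    have Bu: "B (unit_vec w) (unit_vec (prod_encode (i, j))) = (if i = \<sigma> w \<and> j = \<tau> w then s w else 0)"
      if "w < n" for w i j
    proof -
      have "B (unit_vec w) (unit_vec (prod_encode (i, j))) =
          (\<Sum>w'<n. if w' = w then if i = \<sigma> w \<and> j = \<tau> w then s w else 0 else 0)"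
        unfolding B_def by (intro sum.cong) (auto simp: unit_vec_def)
      then show ?thesis using that by simp
    qed
    have "tens n f B = (\<Sum>w<n. \<Sum>k\<in>{..<n} \<times> {..<n}. f w (fst k) (snd k) * B (unit_vec w) (unit_vec (prod_encode k)))"
      unfolding tens_def using B by (simp add: elem_tensor_def sum.cartesian_product split_beta)
    also have "\<dots> = (\<Sum>w<n. \<Sum>k\<in>{..<n} \<times> {..<n}. if k = (\<sigma> w, \<tau> w) then s w * f w (fst k) (snd k) else 0)"
      by (intro sum.cong refl) (auto simp: Bu split: if_splits)
    also have "\<dots> = (\<Sum>w<n. s w * f w (\<sigma> w) (\<tau> w))"
      using inj by (intro sum.cong refl) (auto simp: sum.delta)
    finally show ?thesis .
  qed
  finally show ?thesis .
qed

end

section \<open>Matching vectors and a three-query code\<close>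

text \<open>\<open>z choose e\<close> is 0 for z < e and 1 for z = e, so the system is triangular
  with unit diagonal and solvable over the integers.\<close>

lemma newton_interpolation:
  fixes f :: "nat \<Rightarrow> int"
  shows "\<exists>c. \<forall>z<e. (\<Sum>r<e. c r * int (z choose r)) = f z"
proof (induction e)
  case (Suc e)
  then obtain c where c: "\<And>z. z < e \<Longrightarrow> (\<Sum>r<e. c r * int (z choose r)) = f z" by blast
  define c' where "c' r = (if r = e then f e - (\<Sum>r<e. c r * int (e choose r)) else c r)" for r
  have "(\<Sum>r<Suc e. c' r * int (z choose r)) = f z" if "z < Suc e" for z
    using that c[of z] by (cases "z = e") (auto simp: c'_def)
  then show ?case by blast
qed simp

text \<open>k * (p^b choose k) is a multiple of p^b. If p did not divide the binomial, p^b would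
  divide k, which is smaller.\<close>

lemma prime_dvd_choose_prime_power:
  fixes p :: nat
  assumes p: "prime p" and k: "0 < k" "k < p ^ b"
  shows "p dvd (p ^ b choose k)"
proof (rule ccontr)
  assume "\<not> p dvd (p ^ b choose k)"
  then have "coprime (p ^ b) (p ^ b choose k)"
    using p by (simp add: prime_imp_coprime)
  moreover have "p ^ b dvd k * (p ^ b choose k)"
    using times_binomial_minus1_eq[OF k(1), of "p ^ b"] by simp
  ultimately have "p ^ b dvd k" by (simp add: coprime_dvd_mult_left_iff)
  then show False using k by (simp add: nat_dvd_not_less)
qed

text \<open>In Vandermonde's identity all terms but one carry a factor \<open>p ^ b choose k\<close>
  with 0 < k < p^b.\<close>

lemma choose_periodic:
  fixes p :: nat
  assumes p: "prime p" and r: "r < p ^ b"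
  shows "int p dvd int ((z + p ^ b) choose r) - int (z choose r)"
proof -
  have "(z + p ^ b) choose r = (\<Sum>k\<le>r. (p ^ b choose k) * (z choose (r - k)))"
    using vandermonde[of "p ^ b" z r] by (simp add: add.commute)
  also have "\<dots> = (z choose r) + (\<Sum>k\<in>{..r} - {0}. (p ^ b choose k) * (z choose (r - k)))"
    by (subst sum.remove[of _ 0]) auto
  finally have "int ((z + p ^ b) choose r) - int (z choose r) =
      int (\<Sum>k\<in>{..r} - {0}. (p ^ b choose k) * (z choose (r - k)))" by simp
  moreover have "p dvd (\<Sum>k\<in>{..r} - {0}. (p ^ b choose k) * (z choose (r - k)))"
    using r by (intro dvd_sum dvd_mult2 prime_dvd_choose_prime_power[OF p]) auto
  ultimately show ?thesis by (simp only: int_dvd_int_iff)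
qed

text \<open>Interpolation is exact on one period z < p^b, and modulo p both sides have period p^b in
  z.\<close>

lemma residue_indicator_binomial:
  fixes p d :: nat
  assumes p: "prime p"
  shows "\<exists>c. \<forall>z. int p dvd (\<Sum>r<p ^ b. c r * int (z choose r)) - (if z mod p ^ b = d mod p ^ b then 0 else 1)"
proof -
  define f where "f z = (if z mod p ^ b = d mod p ^ b then 0 else 1 :: int)" for z
  obtain c where c: "\<And>z. z < p ^ b \<Longrightarrow> (\<Sum>r<p ^ b. c r * int (z choose r)) = f z"
    using newton_interpolation by blast
  have pos: "0 < p ^ b" using p by (simp add: prime_gt_0_nat)
  have "int p dvd (\<Sum>r<p ^ b. c r * int (z choose r)) - f z" for z
  proof (induction z rule: less_induct)
    case (less z)
    show ?case
    proof (cases "z < p ^ b")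
      case True
      then show ?thesis by (simp add: c)
    next
      case False
      define y where "y = z - p ^ b"
      have z: "z = y + p ^ b" using False by (simp add: y_def)
      have "int p dvd (\<Sum>r<p ^ b. c r * (int (z choose r) - int (y choose r)))"
        unfolding z using choose_periodic[OF p] by (intro dvd_sum dvd_mult) auto
      then have "int p dvd (\<Sum>r<p ^ b. c r * (int (z choose r) - int (y choose r))) +
          ((\<Sum>r<p ^ b. c r * int (y choose r)) - f y)"
        using less[of y] pos z by (intro dvd_add) auto
      moreover have "f z = f y" by (simp add: f_def z)
      ultimately show ?thesis by (simp add: right_diff_distrib sum_subtractf)
    qed
  qed
  then show ?thesis unfolding f_def by blast
qed

text \<open>Chinese remaindering: 21 is 1 modulo 5 and 0 modulo 7, while 15 is 0 modulo 5 and 1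
  modulo 7. Modulo 35 the values are 0, 15, 21 and 36 = 1, and 0 occurs only if both residues
  agree.\<close>

lemma or_polynomial:
  fixes d :: nat
  shows "\<exists>c. \<forall>z. 35 dvd (\<Sum>r<7 ^ b. c r * int (z choose r)) -
    ((if z mod 5 ^ b = d mod 5 ^ b then 0 else 21) + (if z mod 7 ^ b = d mod 7 ^ b then 0 else 15))"
proof -
  have "prime (5::nat)" "prime (7::nat)" by simp_all
  then obtain c5 c7 where
    c5: "\<And>z. int 5 dvd (\<Sum>r<5 ^ b. c5 r * int (z choose r)) - (if z mod 5 ^ b = d mod 5 ^ b then 0 else 1)" and
    c7: "\<And>z. int 7 dvd (\<Sum>r<7 ^ b. c7 r * int (z choose r)) - (if z mod 7 ^ b = d mod 7 ^ b then 0 else 1)"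
    using residue_indicator_binomial[of 5 b d] residue_indicator_binomial[of 7 b d] by auto
  define c where "c r = 21 * (if r < 5 ^ b then c5 r else 0) + 15 * c7 r" for r
  have le: "(5::nat) ^ b \<le> 7 ^ b" by (rule power_mono) auto
  have "35 dvd (\<Sum>r<7 ^ b. c r * int (z choose r)) -
    ((if z mod 5 ^ b = d mod 5 ^ b then 0 else 21) + (if z mod 7 ^ b = d mod 7 ^ b then 0 else 15))" for z
  proof -
    have "(\<Sum>r<7 ^ b. (if r < 5 ^ b then c5 r else 0) * int (z choose r)) =
        (\<Sum>r<7 ^ b. if r \<in> {..<5 ^ b} then c5 r * int (z choose r) else 0)"
      by (intro sum.cong) auto
    also have "\<dots> = (\<Sum>r<5 ^ b. c5 r * int (z choose r))"
      using le by (subst sum.inter_restrict[symmetric]) (auto intro!: sum.cong)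
    finally have "(\<Sum>r<7 ^ b. c r * int (z choose r)) =
      21 * (\<Sum>r<5 ^ b. c5 r * int (z choose r)) + 15 * (\<Sum>r<7 ^ b. c7 r * int (z choose r))"
      unfolding c_def distrib_right sum.distrib mult.assoc sum_distrib_left[symmetric] by simp
    then have eq: "(\<Sum>r<7 ^ b. c r * int (z choose r)) -
        ((if z mod 5 ^ b = d mod 5 ^ b then 0 else 21) + (if z mod 7 ^ b = d mod 7 ^ b then 0 else 15)) =
      21 * ((\<Sum>r<5 ^ b. c5 r * int (z choose r)) - (if z mod 5 ^ b = d mod 5 ^ b then 0 else 1)) +
      15 * ((\<Sum>r<7 ^ b. c7 r * int (z choose r)) - (if z mod 7 ^ b = d mod 7 ^ b then 0 else 1))"
      by (simp add: algebra_simps)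
    have dv: "35 dvd 21 * A + 15 * B" if ab: "int 5 dvd A" "int 7 dvd B" for A B :: int
    proof -
      obtain a b where "A = 5 * a" "B = 7 * b" using ab by (auto simp: dvd_def)
      then have "21 * A + 15 * B = 35 * (3 * a + 3 * b)" by simp
      then show ?thesis by (rule dvdI)
    qed
    show ?thesis unfolding eq by (rule dv[OF c5 c7])
  qed
  then show ?thesis by blast
qed

section \<open>Matching vectors from sets of equal size\<close>

lemma sum_small_subsets:
  assumes "finite A"
  shows "(\<Sum>R | R \<subseteq> A \<and> card R < D. c (card R)) = (\<Sum>r<D. c r * int (card A choose r))"
proof -
  have fin: "finite {R. R \<subseteq> A \<and> card R < D}" using assms by simp
  have "(\<Sum>R | R \<subseteq> A \<and> card R < D. c (card R)) =
      (\<Sum>r<D. \<Sum>R\<in>{R \<in> {R. R \<subseteq> A \<and> card R < D}. card R = r}. c (card R))"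
    by (rule sum.group[symmetric, OF fin]) auto
  also have "\<dots> = (\<Sum>r<D. c r * int (card A choose r))"
  proof (intro sum.cong refl)
    fix r assume "r \<in> {..<D}"
    then have "{R \<in> {R. R \<subseteq> A \<and> card R < D}. card R = r} = {R. R \<subseteq> A \<and> card R = r}" by auto
    then show "(\<Sum>R\<in>{R \<in> {R. R \<subseteq> A \<and> card R < D}. card R = r}. c (card R)) = c r * int (card A choose r)"
      using n_subsets[OF assms, of r] by simp
  qed
  finally show ?thesis .
qed

lemma card_small_subsets:
  assumes "1 \<le> N"
  shows "card {R. R \<subseteq> {..<N} \<and> card R < D} \<le> D * N ^ D"
proof -
  have "int (card {R. R \<subseteq> {..<N} \<and> card R < D}) = (\<Sum>r<D. int (N choose r))"
    using sum_small_subsets[of "{..<N}" "\<lambda>_. 1" D] by simp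
  also have "\<dots> \<le> (\<Sum>r<D. int (N ^ D))"
  proof (intro sum_mono of_nat_mono)
    fix r assume "r \<in> {..<D}"
    then have "N ^ r \<le> N ^ D" using assms by (intro power_increasing) auto
    then show "N choose r \<le> N ^ D"
      using binomial_le_pow[of r N] by (cases "r \<le> N") (auto simp: binomial_eq_0)
  qed
  also have "\<dots> = int (D * N ^ D)" by simp
  finally show ?thesis by (simp only: of_nat_le_iff)
qed

text \<open>
  Grolmusz's construction: coordinates are the subsets R of {..<N} with fewer than \<open>7 ^ b\<close> elements,
  and the inner product of the vectors of x and y is the value of the polynomial of \<open>or_polynomial\<close>
  at \<open>card (x \<inter> y)\<close>. Modulo 35 it vanishes only for x = y, since \<open>d < 35 ^ b\<close>.
\<close>

lemma subset_matching_vectors: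
  fixes N :: nat
  assumes "d < 35 ^ b"
  defines "F \<equiv> {x. x \<subseteq> {..<N} \<and> card x = d}" and "S \<equiv> {R. R \<subseteq> {..<N} \<and> card R < 7 ^ b}"
  shows "\<exists>v u :: nat set \<Rightarrow> nat set \<Rightarrow> int. \<forall>x\<in>F. \<forall>y\<in>F.
     (\<Sum>R\<in>S. v y R * u x R) mod 35 \<in> (if x = y then {0} else {1, 15, 21})"
proof -
  obtain c where c: "\<And>z. 35 dvd (\<Sum>r<7 ^ b. c r * int (z choose r)) -
    ((if z mod 5 ^ b = d mod 5 ^ b then 0 else 21) + (if z mod 7 ^ b = d mod 7 ^ b then 0 else 15))"
    using or_polynomial[of b d] by blast
  define v where "v y R = (if R \<subseteq> y then 1 else 0 :: int)" for y R :: "nat set"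
  define u where "u x R = (if R \<subseteq> x then c (card R) else 0)" for x R :: "nat set"
  have "(\<Sum>R\<in>S. v y R * u x R) mod 35 \<in> (if x = y then {0} else {1, 15, 21})" if x: "x \<in> F" and y: "y \<in> F" for x y
  proof -
    have fin: "finite x" "finite y" using x y by (auto simp: F_def intro: finite_subset)
    have "(\<Sum>R\<in>S. v y R * u x R) = (\<Sum>R\<in>S. if R \<in> {R. R \<subseteq> x \<inter> y} then c (card R) else 0)"
      by (intro sum.cong) (auto simp: v_def u_def)
    also have "\<dots> = (\<Sum>R\<in>S \<inter> {R. R \<subseteq> x \<inter> y}. c (card R))"
      by (rule sum.inter_restrict[symmetric]) (simp add: S_def)
    also have "S \<inter> {R. R \<subseteq> x \<inter> y} = {R. R \<subseteq> x \<inter> y \<and> card R < 7 ^ b}"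
      using x by (auto simp: S_def F_def)
    finally have e: "(\<Sum>R\<in>S. v y R * u x R) = (\<Sum>r<7 ^ b. c r * int (card (x \<inter> y) choose r))"
      using sum_small_subsets[of "x \<inter> y" c "7 ^ b"] fin by simp
    let ?z = "card (x \<inter> y)"
    have m: "(\<Sum>R\<in>S. v y R * u x R) mod 35 =
      ((if ?z mod 5 ^ b = d mod 5 ^ b then 0 else 21) + (if ?z mod 7 ^ b = d mod 7 ^ b then 0 else 15)) mod 35"
      unfolding e using c[of ?z] by (simp only: mod_eq_dvd_iff)
    show ?thesis
    proof (cases "x = y")
      case True
      then have "?z = d" using x by (simp add: F_def)
      then show ?thesis using m True by simp
    next
      case False
      have "\<not> (?z mod 5 ^ b = d mod 5 ^ b \<and> ?z mod 7 ^ b = d mod 7 ^ b)"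
      proof
        assume *: "?z mod 5 ^ b = d mod 5 ^ b \<and> ?z mod 7 ^ b = d mod 7 ^ b"
        have "x \<inter> y \<subset> x"
        proof
          show "x \<inter> y \<noteq> x"
          proof
            assume "x \<inter> y = x"
            then have "x \<subseteq> y" by blast
            then show False using False card_subset_eq[of y x] fin x y by (auto simp: F_def)
          qed
        qed simp
        then have lt: "?z < d" using psubset_card_mono[OF fin(1)] x by (simp add: F_def)
        have "5 ^ b dvd d - ?z" "7 ^ b dvd d - ?z"
          using * lt by (metis mod_eq_dvd_iff_nat less_imp_le)+
        moreover have "coprime ((5::nat) ^ b) (7 ^ b)"
          using primes_coprime[of "5::nat" 7] by (simp add: coprime_power_left_iff coprime_power_right_iff)
        ultimately have "5 ^ b * 7 ^ b dvd d - ?z" by (rule divides_mult)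
        then have "35 ^ b dvd d - ?z" by (simp flip: power_mult_distrib)
        then show False using lt assms(1) by (auto dest!: dvd_imp_le)
      qed
      then show ?thesis using m False by auto
    qed
  qed
  then show ?thesis by blast
qed

text \<open>The dimension is at most D N^D, the number of vectors is N choose d, at least (N / d)^d,
  with d = (Q + 1) D. Two prime powers allow d up to 35^b although D is only 7^b, so d can be any
  prescribed multiple of D. One factor N^D is left to absorb the constants.\<close>

lemma matching_vectors:
  "\<exists>H k (v :: nat \<Rightarrow> nat \<Rightarrow> int) u. 1 \<le> H \<and> M * H ^ Q \<le> (k::nat) \<and>
     (\<forall>l<k. \<forall>j<k. (\<Sum>r<H. v j r * u l r) mod 35 \<in> (if l = j then {0} else {1, 15, 21}))"
proof -
  \<comment> \<open>This makes Q + 1 < 5^b, which keeps d = (Q + 1) 7^b below 35^b.\<close>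
  define b where "b = Suc Q"
  have b: "Suc Q < 5 ^ b"
  proof -
    have "Suc Q < 2 ^ Suc Q" by (rule less_exp)
    also have "(2::nat) ^ Suc Q \<le> 5 ^ Suc Q" by (rule power_mono) auto
    finally show ?thesis unfolding b_def .
  qed
  define D where "D = (7::nat) ^ b"
  define d where "d = Suc Q * D"
  have D: "1 \<le> D" by (simp add: D_def)
  have "d < 5 ^ b * 7 ^ b" unfolding d_def D_def using b by (intro mult_strict_right_mono) auto
  then have d: "d < 35 ^ b" by (simp flip: power_mult_distrib)
  have d1: "1 \<le> d" using D by (simp add: d_def)
  \<comment> \<open>The product absorbs all constants of the comparison; the summand d gives d \<le>
    N.\<close>
  define N where "N = M * D ^ Q * d ^ d + d"
  have N: "d \<le> N" "1 \<le> N" using d1 by (auto simp: N_def)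
  define F where "F = {x. x \<subseteq> {..<N} \<and> card x = d}"
  define S where "S = {R. R \<subseteq> {..<N} \<and> card R < D}"
  obtain v u :: "nat set \<Rightarrow> nat set \<Rightarrow> int" where vu: "\<And>x y. x \<in> F \<Longrightarrow> y \<in> F \<Longrightarrow>
     (\<Sum>R\<in>S. v y R * u x R) mod 35 \<in> (if x = y then {0} else {1, 15, 21})"
    using subset_matching_vectors[OF d, of N] unfolding F_def S_def D_def by blast
  have fin: "finite F" "finite S" by (auto simp: F_def S_def)
  obtain f where f: "bij_betw f {..<card F} F"
    using ex_bij_betw_nat_finite[OF fin(1)] by (auto simp: atLeast0LessThan)
  obtain g where g: "bij_betw g {..<card S} S"
    using ex_bij_betw_nat_finite[OF fin(2)] by (auto simp: atLeast0LessThan)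
  have "{} \<in> S" using D by (simp add: S_def)
  then have H: "1 \<le> card S" using fin by (auto simp: Suc_le_eq card_gt_0_iff)
  have kF: "card F = N choose d" using n_subsets[of "{..<N}" d] by (simp add: F_def)
  have "(real N / real d) ^ d \<le> real (N choose d)" by (rule binomial_ge_n_over_k_pow_k[OF N(1)])
  then have "real N ^ d \<le> real (N choose d) * real d ^ d" using d1 by (simp add: power_divide divide_le_eq)
  then have Nd: "N ^ d \<le> (N choose d) * d ^ d" by (simp flip: of_nat_power of_nat_mult)
  have "M * card S ^ Q * d ^ d \<le> M * (D * N ^ D) ^ Q * d ^ d"
    using card_small_subsets[OF N(2), of D] by (intro mult_right_mono mult_left_mono power_mono) (auto simp: S_def)
  also have "\<dots> = N ^ (D * Q) * (M * D ^ Q * d ^ d)" by (simp only: power_mult_distrib power_mult mult_ac)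
  also have "\<dots> \<le> N ^ (D * Q) * N ^ D"
  proof (rule mult_left_mono)
    have "N ^ 1 \<le> N ^ D" using N D by (intro power_increasing) auto
    then show "M * D ^ Q * d ^ d \<le> N ^ D" by (simp add: N_def)
  qed simp
  also have "\<dots> = N ^ d" 
  proof -
    have "d = D * Q + D" by (simp add: d_def)
    then show ?thesis by (simp only: power_add)
  qed
  also have "\<dots> \<le> (N choose d) * d ^ d" by (rule Nd)
  finally have k: "M * card S ^ Q \<le> card F" using d1 unfolding kF by simp
  have "(\<Sum>r<card S. v (f j) (g r) * u (f l) (g r)) mod 35 \<in> (if l = j then {0} else {1, 15, 21})"
    if "l < card F" "j < card F" for l j
  proof -
    have e: "(\<Sum>r<card S. v (f j) (g r) * u (f l) (g r)) = (\<Sum>R\<in>S. v (f j) R * u (f l) R)"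
      by (rule sum.reindex_bij_betw[OF g])
    have "f l \<in> F" "f j \<in> F" using f that by (auto simp: bij_betw_def)
    note * = vu[OF this]
    have i: "f l = f j \<longleftrightarrow> l = j" using f that by (auto simp: bij_betw_def inj_on_def)
    show ?thesis unfolding e using * unfolding i .
  qed
  then have "\<forall>l<card F. \<forall>j<card F.
      (\<Sum>r<card S. v (f j) (g r) * u (f l) (g r)) mod 35 \<in> (if l = j then {0} else {1, 15, 21})"
    by blast
  with H k show ?thesis
    by (intro exI[of _ "card S"] exI[of _ "card F"] exI[of _ "\<lambda>l r. v (f l) (g r)"]
        exI[of _ "\<lambda>l r. u (f l) (g r)"] conjI)
qed

section \<open>A character of the integers modulo 35 into the field of 71 elements\<close>

definition E71 :: "int \<Rightarrow> int" where
  "E71 m = 27 ^ nat (m mod 35) mod 71"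

text \<open>27^35 is 1 modulo 71. Hence \<open>E71\<close>, defined through
  \<open>nat (m mod 35)\<close> to cover negative m, turns sums into products.\<close>

lemma power27_mod: "(27::int) ^ k mod 71 = 27 ^ (k mod 35) mod 71"
proof -
  define P :: int where "P = 27 ^ 35"
  have P: "P mod 71 = 1" by (simp add: P_def)
  have "(27::int) ^ k = 27 ^ (35 * (k div 35) + k mod 35)" by simp
  also have "\<dots> = P ^ (k div 35) * 27 ^ (k mod 35)" by (simp only: power_add power_mult P_def)
  also have "\<dots> mod 71 = ((P mod 71) ^ (k div 35) mod 71) * 27 ^ (k mod 35) mod 71"
    by (simp only: power_mod mod_mult_left_eq)
  finally show ?thesis unfolding P by simp
qed

lemma E71_add: "E71 (m + n) = E71 m * E71 n mod 71"
proof -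
  have e: "nat ((m + n) mod 35) = (nat (m mod 35) + nat (n mod 35)) mod 35"
  proof -
    have "int (nat ((m + n) mod 35)) = int ((nat (m mod 35) + nat (n mod 35)) mod 35)"
      by (simp add: zmod_int mod_add_eq)
    then show ?thesis by (simp only: of_nat_eq_iff)
  qed
  show ?thesis unfolding E71_def e power27_mod[symmetric] by (simp add: power_add mod_mult_eq)
qed

lemma E71_mod: "m mod 35 = n mod 35 \<Longrightarrow> E71 m = E71 n"
  by (simp add: E71_def)

text \<open>\<open>E71 e\<close> factors out, which leaves the trinomial 13 + 5 X + 7 X^17 at 27^s;
  its three roots are checked by evaluation.\<close>

lemma E71_trinomial:
  assumes "s mod 35 \<in> {1, 15, 21}"
  shows "71 dvd 13 * E71 e + 5 * E71 (e + s) + 7 * E71 (e + 17 * s)"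
proof -
  have s: "E71 s = E71 (s mod 35)" "E71 (17 * s) = E71 (17 * (s mod 35))"
    by (auto intro!: E71_mod simp: mod_mult_right_eq)
  have "71 dvd 13 + 5 * E71 s + 7 * E71 (17 * s)"
    using assms unfolding s by (auto simp: E71_def)
  then have "(13 + 5 * E71 s + 7 * E71 (17 * s)) mod 71 = 0" by simp
  moreover have red: "(13 * a + 5 * (x mod 71) + 7 * (y mod 71)) mod 71 = (13 * a + 5 * x + 7 * y) mod 71" for a x y :: int
    by (intro mod_add_cong mod_mult_cong refl) simp_all
  moreover have "(13 * E71 e + 5 * E71 (e + s) + 7 * E71 (e + 17 * s)) mod 71 =
      E71 e * (13 + 5 * E71 s + 7 * E71 (17 * s)) mod 71"
    unfolding E71_add red by (simp add: algebra_simps)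
  ultimately show ?thesis by (metis dvd_eq_mod_eq_0 mod_mult_right_eq mult_zero_right mod_0)
qed

text \<open>All three values equal \<open>E71 e\<close>, a unit with inverse
  \<open>E71 (- e)\<close>, and the coefficients sum to 25, which is nonzero modulo 71.\<close>

lemma E71_trinomial_0:
  assumes "s mod 35 = 0"
  shows "\<not> 71 dvd 13 * E71 e + 5 * E71 (e + s) + 7 * E71 (e + 17 * s)"
proof
  have s: "E71 (e + s) = E71 e" "E71 (e + 17 * s) = E71 e"
  proof -
    obtain m where "s = 35 * m" using assms by (auto simp: mod_eq_0_iff_dvd)
    then have "e + s = e + m * 35" "e + 17 * s = e + (17 * m) * 35" by simp_all
    then show "E71 (e + s) = E71 e" "E71 (e + 17 * s) = E71 e"
      by (simp_all only: E71_def mod_mult_self1)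
  qed
  assume "71 dvd 13 * E71 e + 5 * E71 (e + s) + 7 * E71 (e + 17 * s)"
  then have "71 dvd 13 * E71 e + 5 * E71 e + 7 * E71 e" unfolding s .
  moreover have "13 * E71 e + 5 * E71 e + 7 * E71 e = 25 * E71 e" by simp
  ultimately have "71 dvd E71 (- e) * (25 * E71 e)" by (simp only: dvd_mult)
  then have "25 * (E71 (- e) * E71 e mod 71) mod 71 = 0"
    by (simp only: dvd_eq_mod_eq_0 mod_mult_right_eq mult.left_commute)
  moreover have "E71 (- e) * E71 e mod 71 = 1" unfolding E71_add[symmetric] by (simp add: E71_def)
  ultimately show False by simp
qed

text \<open>
  The code: positions are the vectors of \<open>\<int>\<^sub>3\<^sub>5\<^sup>H\<close>. The queries w, w + u, w + 17 u recover bit l, because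
  the trinomial \<open>13 + 5 X + 7 X\<^sup>1\<^sup>7\<close> over the field of 71 elements vanishes at \<open>27 ^ s\<close> for s = 1, 15, 21
  but not at 1, where 27 has order 35.
\<close>

lemma three_query_code:
  "\<exists>H k n (\<Phi> :: nat \<Rightarrow> nat \<Rightarrow> int) \<sigma> \<tau>. 1 \<le> H \<and> n = 35 ^ H \<and> M * H ^ Q \<le> (k::nat) \<and>
     (\<forall>l<k. inj_on (\<sigma> l) {..<n} \<and> inj_on (\<tau> l) {..<n} \<and> \<sigma> l ` {..<n} \<subseteq> {..<n} \<and> \<tau> l ` {..<n} \<subseteq> {..<n} \<and>
        (\<forall>j<k. \<forall>w<n. 71 dvd 13 * \<Phi> j w + 5 * \<Phi> j (\<sigma> l w) + 7 * \<Phi> j (\<tau> l w) \<longleftrightarrow> l \<noteq> j))"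
proof -
  obtain H k and v u :: "nat \<Rightarrow> nat \<Rightarrow> int" where H: "1 \<le> H" "M * H ^ Q \<le> k"
    and vu: "\<And>l j. l < k \<Longrightarrow> j < k \<Longrightarrow> (\<Sum>r<H. v j r * u l r) mod 35 \<in> (if l = j then {0} else {1, 15, 21})"
    using matching_vectors[of M Q] by blast
  define W where "W = {..<H} \<rightarrow>\<^sub>E {0..<35::int}"
  have W: "finite W" "card W = 35 ^ H" by (auto simp: W_def finite_PiE card_PiE)
  obtain g where g: "bij_betw g {..<(35::nat) ^ H} W"
    using ex_bij_betw_nat_finite[OF W(1)] W(2) by (auto simp: atLeast0LessThan)
  define h where "h = the_inv_into {..<35 ^ H} g"
  have h: "bij_betw h W {..<35 ^ H}" unfolding h_def by (rule bij_betw_the_inv_into[OF g])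
  have gh: "g (h x) = x" if "x \<in> W" for x
    unfolding h_def using f_the_inv_into_f_bij_betw[OF g] that by blast
  \<comment> \<open>The queries are translations of the group by multiples of u l, hence injective.
    The bijections g and h carry them over to {..<35 ^ H}.\<close>
  define shift where "shift a l w = (\<lambda>r\<in>{..<H}. (w r + a * u l r) mod 35)" for a l and w :: "nat \<Rightarrow> int"
  have shift_W: "shift a l w \<in> W" for a l w by (auto simp: shift_def W_def)
  have shift_inj: "inj_on (shift a l) W" for a l
  proof (rule inj_onI)
    fix w w' assume w: "w \<in> W" "w' \<in> W" and eq: "shift a l w = shift a l w'"
    have "w r = w' r" if "r < H" for r
    proof -
      have "(w r + a * u l r) mod 35 = (w' r + a * u l r) mod 35"
        using fun_cong[OF eq, of r] that by (simp add: shift_def)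
      then have "w r mod 35 = w' r mod 35" by (simp add: mod_eq_dvd_iff)
      moreover have "w r \<in> {0..<35}" "w' r \<in> {0..<35}"
        using w that unfolding W_def by (meson PiE_mem lessThan_iff)+
      ultimately show ?thesis by simp
    qed
    then show "w = w'" using w unfolding W_def by (intro PiE_ext) auto
  qed
  define \<Phi> where "\<Phi> j w = E71 (\<Sum>r<H. v j r * g w r)" for j w
  define \<rho> where "\<rho> a l w = h (shift a l (g w))" for a l w
  have inj: "inj_on (\<rho> a l) {..<35 ^ H}" for a l
  proof -
    have "inj_on (h \<circ> (shift a l \<circ> g)) {..<35 ^ H}"
      using g h shift_W shift_inj[of a l]
      by (intro comp_inj_on) (auto simp: bij_betw_def intro: inj_on_subset)
    then show ?thesis by (simp add: \<rho>_def[abs_def] o_def)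
  qed
  have img: "\<rho> a l ` {..<35 ^ H} \<subseteq> {..<35 ^ H}" for a l
    using h shift_W by (auto simp: \<rho>_def bij_betw_def)
  have \<Phi>\<rho>: "\<Phi> j (\<rho> a l w) = E71 ((\<Sum>r<H. v j r * g w r) + a * (\<Sum>r<H. v j r * u l r))" for j a l w
  proof -
    have "\<Phi> j (\<rho> a l w) = E71 (\<Sum>r<H. v j r * ((g w r + a * u l r) mod 35))"
      unfolding \<Phi>_def \<rho>_def gh[OF shift_W] by (simp add: shift_def)
    also have "\<dots> = E71 (\<Sum>r<H. v j r * (g w r + a * u l r))"
      by (rule E71_mod) (subst (1 2) mod_sum_eq[symmetric], simp add: mod_mult_right_eq)
    also have "(\<Sum>r<H. v j r * (g w r + a * u l r)) = (\<Sum>r<H. v j r * g w r) + a * (\<Sum>r<H. v j r * u l r)"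
      by (simp add: distrib_left sum.distrib sum_distrib_left mult_ac)
    finally show ?thesis .
  qed
  have "71 dvd 13 * \<Phi> j w + 5 * \<Phi> j (\<rho> 1 l w) + 7 * \<Phi> j (\<rho> 17 l w) \<longleftrightarrow> l \<noteq> j" if "l < k" "j < k" for l j w
  proof (cases "l = j")
    case True
    then have "(\<Sum>r<H. v j r * u l r) mod 35 = 0" using vu[OF that] by simp
    from E71_trinomial_0[OF this] show ?thesis using True by (simp add: \<Phi>\<rho>) (simp add: \<Phi>_def)
  next
    case False
    then have "(\<Sum>r<H. v j r * u l r) mod 35 \<in> {1, 15, 21}" using vu[OF that] by simp
    from E71_trinomial[OF this] show ?thesis using False by (simp add: \<Phi>\<rho>) (simp add: \<Phi>_def)
  qed
  then show ?thesis using H inj img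
    by (intro exI[of _ H] exI[of _ k] exI[of _ "35 ^ H"] exI[of _ \<Phi>] exI[of _ "\<rho> 1"] exI[of _ "\<rho> 17"]) auto
qed

section \<open>Quadrature for the derivative at 0\<close>

text \<open>A geometric sum over K-th roots of unity; the bound on j excludes all multiples of K
  except 0.\<close>

lemma sum_cis_multiples:
  fixes j :: int
  assumes "0 < K" "\<bar>j\<bar> < int K"
  shows "(\<Sum>r<K. cis (of_int j * (2 * pi * real r / real K))) = (if j = 0 then of_nat K else 0)"
proof (cases "j = 0")
  case False
  define x where "x = 2 * pi * of_int j / real K"
  define z where "z = cis x"
  have zr: "cis (of_int j * (2 * pi * real r / real K)) = z ^ r" for r
  proof -
    have "of_int j * (2 * pi * real r / real K) = real r * x" by (simp add: x_def)
    then show ?thesis by (simp only: z_def Complex.DeMoivre)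
  qed
  have "z \<noteq> 1"
  proof
    assume "z = 1"
    then have "cos x = 1" by (simp add: z_def complex_eq_iff)
    then obtain n :: int where "x = of_int n * 2 * pi" by (auto simp: cos_one_2pi_int)
    then have "of_int j = real_of_int (n * int K)" using assms by (simp add: x_def field_simps)
    then have "j = n * int K" by (simp only: of_int_eq_iff)
    then have "j = int K * n" by (simp only: mult.commute)
    then have "int K dvd j" by (rule dvdI)
    from dvd_imp_le_int[OF False this] show False using assms by linarith
  qed
  moreover have "z ^ K = 1"
  proof -
    have "z ^ K = cis (2 * pi * of_int j)" using assms by (simp add: z_def x_def Complex.DeMoivre)
    then show ?thesis by (simp add: complex_eq_iff cos_int_2pin sin_int_2pin)
  qed
  ultimately have "(\<Sum>r<K. z ^ r) = 0" by (simp add: sum_gp_strict)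
  then show ?thesis unfolding zr using False by simp
qed simp

text \<open>The Fourier coefficients of the kernel are proportional to the frequency, so pairing
  with it yields K times the derivative at 0 for degree at most L. With K = 2 L + 1 nodes, the
  frequencies q - m and q + m are at most 2 L in modulus and do not alias.\<close>

lemma sum_cis_derivative_kernel:
  fixes q :: int
  assumes q: "\<bar>q\<bar> \<le> int L"
  defines "K \<equiv> 2 * L + 1"
  shows "(\<Sum>r<K. cis (of_int q * (2 * pi * real r / real K)) *
      of_real (\<Sum>m=1..L. 2 * real m * sin (real m * (2 * pi * real r / real K)))) = \<i> * of_int q * of_nat K"
proof -
  define \<tau> where "\<tau> r = 2 * pi * real r / real K" for r
  have K: "0 < K" by (simp add: K_def)
  have s: "complex_of_real (2 * real m * sin (real m * x)) =
      \<i> * of_nat m * (cis (of_int (- int m) * x) - cis (of_int (int m) * x))" for m x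
    by (simp add: complex_eq_iff)
  have "(\<Sum>r<K. cis (of_int q * \<tau> r) * of_real (\<Sum>m=1..L. 2 * real m * sin (real m * \<tau> r))) =
      (\<Sum>r<K. \<Sum>m=1..L. \<i> * of_nat m * (cis (of_int (q - int m) * \<tau> r) - cis (of_int (q + int m) * \<tau> r)))"
    unfolding of_real_sum s sum_distrib_left
    by (intro sum.cong refl) (simp add: algebra_simps cis_mult)
  also have "\<dots> = (\<Sum>m=1..L. \<Sum>r<K. \<i> * of_nat m * (cis (of_int (q - int m) * \<tau> r) - cis (of_int (q + int m) * \<tau> r)))"
    by (rule sum.swap)
  also have "\<dots> = (\<Sum>m=1..L. \<i> * of_nat m * ((if q - int m = 0 then of_nat K else 0) - (if q + int m = 0 then of_nat K else 0)))"
  proof (intro sum.cong refl)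
    fix m assume "m \<in> {1..L}"
    then have "\<bar>q - int m\<bar> < int K" "\<bar>q + int m\<bar> < int K" using q by (auto simp: K_def)
    from this[THEN sum_cis_multiples[OF K]]
    show "(\<Sum>r<K. \<i> * of_nat m * (cis (of_int (q - int m) * \<tau> r) - cis (of_int (q + int m) * \<tau> r))) =
        \<i> * of_nat m * ((if q - int m = 0 then of_nat K else 0) - (if q + int m = 0 then of_nat K else 0))"
      by (simp add: \<tau>_def sum_subtractf flip: sum_distrib_left)
  qed
  also have "\<dots> = \<i> * of_int q * of_nat K"
  proof -
    have "(\<Sum>m=1..L. \<i> * of_nat m * ((if q - int m = 0 then of_nat K else 0) - (if q + int m = 0 then of_nat K else 0))) =
      (\<Sum>m=1..L. if m = nat \<bar>q\<bar> then \<i> * of_int q * of_nat K else 0)"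
      by (intro sum.cong) auto
    also have "\<dots> = \<i> * of_int q * of_nat K"
    proof (cases "q = 0")
      case False
      then have "nat \<bar>q\<bar> \<in> {1..L}" using q by auto
      then show ?thesis by (simp only: sum.delta finite_atLeastAtMost if_True)
    qed simp
    finally show ?thesis .
  qed
  finally show ?thesis unfolding \<tau>_def .
qed

lemma sin_power_cis:
  "complex_of_real (sin x ^ s) =
    (\<Sum>a\<le>s. (1 / (2 * \<i>)) ^ s * ((-1) ^ a * of_nat (s choose a)) * cis (of_int (int s - 2 * int a) * x))"
proof -
  have "complex_of_real (sin x) = - cis (- x) / (2 * \<i>) + cis x / (2 * \<i>)"
    by (simp add: complex_eq_iff)
  then have "complex_of_real (sin x ^ s) = (\<Sum>a\<le>s. of_nat (s choose a) * (- cis (- x) / (2 * \<i>)) ^ a * (cis x / (2 * \<i>)) ^ (s - a))"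
    by (simp only: of_real_power binomial_ring)
  also have "\<dots> = (\<Sum>a\<le>s. (1 / (2 * \<i>)) ^ s * ((-1) ^ a * of_nat (s choose a)) * cis (of_int (int s - 2 * int a) * x))"
  proof (intro sum.cong refl)
    fix a assume "a \<in> {..s}"
    then have a: "a \<le> s" by simp
    have e1: "(- cis (- x) / (2 * \<i>)) ^ a = (-1) ^ a * cis (- (real a * x)) * (1 / (2 * \<i>)) ^ a"
    proof -
      have "- cis (- x) / (2 * \<i>) = (-1 * cis (- x)) * (1 / (2 * \<i>))" by simp
      then show ?thesis by (simp only: power_mult_distrib Complex.DeMoivre mult_minus_right)
    qed
    have e2: "(cis x / (2 * \<i>)) ^ (s - a) = cis (real (s - a) * x) * (1 / (2 * \<i>)) ^ (s - a)"
    proof -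
      have "cis x / (2 * \<i>) = cis x * (1 / (2 * \<i>))" by simp
      then show ?thesis by (simp only: power_mult_distrib Complex.DeMoivre)
    qed
    have e3: "(1 / (2 * \<i>)) ^ a * (1 / (2 * \<i>)) ^ (s - a) = (1 / (2 * \<i>)) ^ s"
      using a by (simp flip: power_add)
    have e4: "cis (- (real a * x)) * cis (real (s - a) * x) = cis (of_int (int s - 2 * int a) * x)"
      using a by (simp add: cis_mult of_nat_diff algebra_simps)
    show "of_nat (s choose a) * (- cis (- x) / (2 * \<i>)) ^ a * (cis x / (2 * \<i>)) ^ (s - a) =
        (1 / (2 * \<i>)) ^ s * ((-1) ^ a * of_nat (s choose a)) * cis (of_int (int s - 2 * int a) * x)"
      unfolding e1 e2 e3[symmetric] e4[symmetric] by (simp only: mult_ac)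
  qed
  finally show ?thesis .
qed

text \<open>
  A quadrature formula for the derivative at 0 of a polynomial P of degree at most L, by nodes in
  [-1/2, 1/2]: it is the exact formula for the derivative at 0 of the trigonometric polynomial
  \<open>x \<mapsto> P (sin x / 2)\<close> from its values at the 2 L + 1 equispaced points.
\<close>

lemma derivative_quadrature:
  "\<exists>(\<rho> :: nat \<Rightarrow> real) (c :: nat \<Rightarrow> real) K. (\<forall>r<K. \<bar>\<rho> r\<bar> \<le> 1 / 2) \<and>
     (\<forall>s\<le>L. (\<Sum>r<K. c r * \<rho> r ^ s) = (if s = 1 then 1 else 0)) \<and> (\<Sum>r<K. \<bar>c r\<bar>) \<le> 4 * real L ^ 2"
proof -
  define K where "K = 2 * L + 1"
  define \<tau> where "\<tau> r = 2 * pi * real r / real K" for r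
  define h where "h r = (\<Sum>m=1..L. 2 * real m * sin (real m * \<tau> r))" for r
  \<comment> \<open>Halving keeps the noise parameter away from 1, which is what lets
    \<open>damped_small\<close> gain a factor; the 2 in c compensates for it.\<close>
  define \<rho> where "\<rho> r = sin (\<tau> r) / 2" for r
  define c where "c r = 2 / real K * h r" for r
  have K: "0 < K" by (simp add: K_def)
  have exact: "(\<Sum>r<K. h r * sin (\<tau> r) ^ s) = (if s = 1 then real K else 0)" if "s \<le> L" for s
  proof -
    have "complex_of_real (\<Sum>r<K. h r * sin (\<tau> r) ^ s) =
       (\<Sum>r<K. \<Sum>a\<le>s. (1 / (2 * \<i>)) ^ s * ((-1) ^ a * of_nat (s choose a)) *
         (cis (of_int (int s - 2 * int a) * \<tau> r) * of_real (h r)))"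
      unfolding of_real_sum of_real_mult sin_power_cis sum_distrib_left
      by (intro sum.cong refl) (simp only: mult_ac)
    also have "\<dots> = (\<Sum>a\<le>s. (1 / (2 * \<i>)) ^ s * ((-1) ^ a * of_nat (s choose a)) *
        (\<Sum>r<K. cis (of_int (int s - 2 * int a) * \<tau> r) * of_real (h r)))"
      by (subst sum.swap) (simp only: sum_distrib_left)
    also have "\<dots> = (\<Sum>a\<le>s. (1 / (2 * \<i>)) ^ s * ((-1) ^ a * of_nat (s choose a)) *
        (\<i> * of_int (int s - 2 * int a) * of_nat K))"
    proof (intro sum.cong refl)
      fix a assume "a \<in> {..s}"
      then have "\<bar>int s - 2 * int a\<bar> \<le> int L" using that by auto
      from sum_cis_derivative_kernel[OF this]
      show "(1 / (2 * \<i>)) ^ s * ((-1) ^ a * of_nat (s choose a)) *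
          (\<Sum>r<K. cis (of_int (int s - 2 * int a) * \<tau> r) * of_real (h r)) =
        (1 / (2 * \<i>)) ^ s * ((-1) ^ a * of_nat (s choose a)) * (\<i> * of_int (int s - 2 * int a) * of_nat K)"
        unfolding K_def[symmetric] \<tau>_def[symmetric] h_def by simp
    qed
    also have "\<dots> = (1 / (2 * \<i>)) ^ s * \<i> * of_nat K *
        (of_nat s * (\<Sum>a\<le>s. (-1) ^ a * of_nat (s choose a)) - 2 * (\<Sum>a\<le>s. (-1) ^ a * of_nat a * of_nat (s choose a)))"
      by (simp add: sum_distrib_left sum_subtractf[symmetric] algebra_simps)
    \<comment> \<open>This is K times the derivative of sin^s at 0. For s at least 2 both
      alternating binomial sums vanish.\<close>
    also have "\<dots> = (if s = 1 then of_nat K else 0)"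
    proof -
      consider "s = 0" | "s = 1" | "2 \<le> s" by linarith
      then show ?thesis
        by cases (simp_all add: choose_alternating_sum choose_alternating_linear_sum)
    qed
    finally have "complex_of_real (\<Sum>r<K. h r * sin (\<tau> r) ^ s) = of_real (if s = 1 then real K else 0)"
      by simp
    then show ?thesis by (simp only: of_real_eq_iff)
  qed
  have "(\<Sum>r<K. c r * \<rho> r ^ s) = (if s = 1 then 1 else 0)" if "s \<le> L" for s
  proof -
    have "(\<Sum>r<K. c r * \<rho> r ^ s) = 2 / real K * (1 / 2) ^ s * (\<Sum>r<K. h r * sin (\<tau> r) ^ s)"
      by (simp add: c_def \<rho>_def sum_distrib_left sum_divide_distrib power_divide mult_ac)
    then show ?thesis using exact[OF that] K by simp
  qed
  moreover have "\<bar>\<rho> r\<bar> \<le> 1 / 2" for r by (simp add: \<rho>_def abs_le_iff)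
  moreover have "(\<Sum>r<K. \<bar>c r\<bar>) \<le> 4 * real L ^ 2"
  proof -
    have "\<bar>h r\<bar> \<le> 2 * real L ^ 2" for r
    proof -
      have "\<bar>h r\<bar> \<le> (\<Sum>m=1..L. \<bar>2 * real m * sin (real m * \<tau> r)\<bar>)" unfolding h_def by (rule sum_abs)
      also have "\<dots> \<le> (\<Sum>m=1..L. 2 * real L * 1)"
        by (intro sum_mono) (auto simp: abs_mult intro!: order_trans[OF mult_left_le])
      also have "\<dots> = 2 * real L ^ 2" by (simp add: power2_eq_square)
      finally show ?thesis .
    qed
    then have "(\<Sum>r<K. \<bar>c r\<bar>) \<le> (\<Sum>r<K. 2 / real K * (2 * real L ^ 2))"
      unfolding c_def abs_mult by (intro sum_mono mult_mono) auto
    also have "\<dots> = 4 * real L ^ 2" using K by simp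
    finally show ?thesis .
  qed
  ultimately show ?thesis by blast
qed

section \<open>From codes to tensors\<close>

lemma coeff_prod_linear:
  fixes a b :: "'k \<Rightarrow> 'c::comm_ring_1"
  assumes "finite A"
  shows "coeff (\<Prod>l\<in>A. [:a l, b l:]) 0 = (\<Prod>l\<in>A. a l) \<and>
    coeff (\<Prod>l\<in>A. [:a l, b l:]) (Suc 0) = (\<Sum>l\<in>A. b l * (\<Prod>i\<in>A - {l}. a i))"
  using assms
proof (induction A)
  case (insert x A)
  have "(\<Sum>l\<in>A. b l * (\<Prod>i\<in>insert x A - {l}. a i)) = (\<Sum>l\<in>A. a x * (b l * (\<Prod>i\<in>A - {l}. a i)))"
  proof (intro sum.cong refl)
    fix l assume "l \<in> A"
    then have "insert x A - {l} = insert x (A - {l})" using insert by auto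
    then show "b l * (\<Prod>i\<in>insert x A - {l}. a i) = a x * (b l * (\<Prod>i\<in>A - {l}. a i))"
      using insert by (simp add: mult.left_commute)
  qed
  then show ?case using insert by (simp add: mult_pCons_left flip: sum_distrib_left)
qed simp

definition damped :: "nat \<Rightarrow> (nat \<Rightarrow> real) \<Rightarrow> real \<Rightarrow> (nat \<Rightarrow> real) \<Rightarrow> real" where
  "damped k \<phi> \<rho> \<epsilon> = Im (\<Prod>l<k. Complex (cos (\<phi> l)) (\<rho> * \<epsilon> l * sin (\<phi> l)))"

text \<open>
  \<^const>\<open>damped\<close> is the noise operator with parameter \<open>\<rho>\<close> applied to the function
  \<open>\<delta> \<mapsto> Im (\<Prod>l<k. cis (\<delta> l * \<phi> l))\<close> on the cube.
\<close>

lemma damped_average: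
  "damped k \<phi> \<rho> \<epsilon> =
    (\<Sum>\<delta>\<in>signs k. (\<Prod>l<k. (1 + \<rho> * \<epsilon> l * \<delta> l) / 2) * Im (\<Prod>l<k. cis (\<delta> l * \<phi> l)))"
proof -
  have "Complex (cos x) (r * sin x) = (\<Sum>s\<in>{-1,1}. of_real ((1 + r * s) / 2) * cis (s * x))" for r x
    by (simp add: complex_eq_iff field_simps)
  then have "(\<Prod>l<k. Complex (cos (\<phi> l)) (\<rho> * \<epsilon> l * sin (\<phi> l))) =
     (\<Sum>\<delta>\<in>signs k. \<Prod>l<k. of_real ((1 + \<rho> * \<epsilon> l * \<delta> l) / 2) * cis (\<delta> l * \<phi> l))"
    by (simp only:) (rule prod_sum_PiE; simp)
  also have "\<dots> = (\<Sum>\<delta>\<in>signs k. of_real (\<Prod>l<k. (1 + \<rho> * \<epsilon> l * \<delta> l) / 2) * (\<Prod>l<k. cis (\<delta> l * \<phi> l)))"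
    by (simp only: prod.distrib of_real_prod)
  finally have e: "(\<Prod>l<k. Complex (cos (\<phi> l)) (\<rho> * \<epsilon> l * sin (\<phi> l))) =
     (\<Sum>\<delta>\<in>signs k. of_real (\<Prod>l<k. (1 + \<rho> * \<epsilon> l * \<delta> l) / 2) * (\<Prod>l<k. cis (\<delta> l * \<phi> l)))" .
  have "Im (of_real a * b) = a * Im b" for a b by simp
  then show ?thesis unfolding damped_def e by (simp only: Im_sum)
qed

text \<open>The weights are the law of independent signs with means \<rho> * \<epsilon> l, so
  \<open>damped\<close> is a convex combination of its undamped values.\<close>

lemma damped_weights:
  assumes "\<bar>\<rho>\<bar> \<le> 1" "\<epsilon> \<in> signs k"
  shows "(\<Sum>\<delta>\<in>signs k. (\<Prod>l<k. (1 + \<rho> * \<epsilon> l * \<delta> l) / 2)) = 1"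
    and "\<delta> \<in> signs k \<Longrightarrow> 0 \<le> (\<Prod>l<k. (1 + \<rho> * \<epsilon> l * \<delta> l) / 2)"
proof -
  have "(\<Prod>l<k. \<Sum>s\<in>{-1,1}. (1 + \<rho> * \<epsilon> l * s) / 2) = (\<Sum>\<delta>\<in>signs k. (\<Prod>l<k. (1 + \<rho> * \<epsilon> l * \<delta> l) / 2))"
    by (rule prod_sum_PiE) auto
  moreover have "(\<Sum>s\<in>{-1,1}. (1 + \<rho> * \<epsilon> l * s) / 2) = 1" for l by (simp add: field_simps)
  ultimately show "(\<Sum>\<delta>\<in>signs k. (\<Prod>l<k. (1 + \<rho> * \<epsilon> l * \<delta> l) / 2)) = 1" by simp
  assume \<delta>: "\<delta> \<in> signs k"
  show "0 \<le> (\<Prod>l<k. (1 + \<rho> * \<epsilon> l * \<delta> l) / 2)"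
  proof (rule prod_nonneg)
    fix l assume "l \<in> {..<k}"
    then have "\<epsilon> l \<in> {-1, 1}" "\<delta> l \<in> {-1, 1}" using assms(2) \<delta> by (meson PiE_mem)+
    then show "0 \<le> (1 + \<rho> * \<epsilon> l * \<delta> l) / 2" using assms(1) by auto
  qed
qed

text \<open>As a polynomial in \<rho> the product has degree at most the number of nonzero sines, so
  the quadrature extracts its linear coefficient exactly. That coefficient is the part of first
  order in \<epsilon>.\<close>

lemma damped_quadrature:
  assumes L: "card {l. l < k \<and> sin (\<phi> l) \<noteq> 0} \<le> L"
    and quad: "\<And>s. s \<le> L \<Longrightarrow> (\<Sum>r<K. c r * \<rho> r ^ s) = (if s = 1 then 1 else 0)"
  shows "(\<Sum>r<K. c r * damped k \<phi> (\<rho> r) \<epsilon>) = (\<Sum>l<k. \<epsilon> l * (sin (\<phi> l) * (\<Prod>i\<in>{..<k} - {l}. cos (\<phi> i))))"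
proof -
  define b where "b l = \<i> * of_real (\<epsilon> l * sin (\<phi> l))" for l
  define P where "P = (\<Prod>l<k. [:of_real (cos (\<phi> l)), b l:])"
  have "degree P \<le> (\<Sum>l<k. degree [:of_real (cos (\<phi> l)), b l:])"
    unfolding P_def using degree_prod_sum_le[of "{..<k}" "\<lambda>l. [:of_real (cos (\<phi> l)), b l:]"] by (simp add: o_def)
  also have "\<dots> \<le> (\<Sum>l<k. if sin (\<phi> l) \<noteq> 0 then 1 else 0)"
    by (intro sum_mono) (auto simp: b_def)
  also have "\<dots> = card {l. l < k \<and> sin (\<phi> l) \<noteq> 0}"
    by (simp add: sum.If_cases Int_def conj_commute)
  finally have deg: "degree P \<le> L" using L by simp
  have poly: "poly P (of_real x) = (\<Prod>l<k. Complex (cos (\<phi> l)) (x * \<epsilon> l * sin (\<phi> l)))" for x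
    unfolding P_def poly_prod by (intro prod.cong refl) (simp add: b_def complex_eq_iff)
  have "(\<Sum>r<K. of_real (c r) * poly P (of_real (\<rho> r))) = (\<Sum>s\<le>degree P. coeff P s * of_real (\<Sum>r<K. c r * \<rho> r ^ s))"
    unfolding poly_altdef by (simp add: sum_distrib_left mult_ac sum.swap[of _ "{..<K}"])
  also have "\<dots> = (\<Sum>s\<le>degree P. if s = 1 then coeff P s else 0)"
    using quad deg by (intro sum.cong) auto
  also have "\<dots> = coeff P (Suc 0)"
    by (auto simp: coeff_eq_0)
  also have "\<dots> = (\<Sum>l<k. b l * (\<Prod>i\<in>{..<k} - {l}. of_real (cos (\<phi> i))))"
    unfolding P_def using coeff_prod_linear[of "{..<k}" "\<lambda>l. complex_of_real (cos (\<phi> l))" b] by simp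
  also have "\<dots> = \<i> * of_real (\<Sum>l<k. \<epsilon> l * (sin (\<phi> l) * (\<Prod>i\<in>{..<k} - {l}. cos (\<phi> i))))"
    by (simp add: b_def sum_distrib_left mult.assoc)
  finally have e: "(\<Sum>r<K. of_real (c r) * poly P (of_real (\<rho> r))) =
      \<i> * of_real (\<Sum>l<k. \<epsilon> l * (sin (\<phi> l) * (\<Prod>i\<in>{..<k} - {l}. cos (\<phi> i))))" .
  have "(\<Sum>r<K. c r * damped k \<phi> (\<rho> r) \<epsilon>) = Im (\<Sum>r<K. of_real (c r) * poly P (of_real (\<rho> r)))"
    by (simp add: poly damped_def)
  then show ?thesis unfolding e by (simp only: Im_i_times Re_complex_of_real)
qed

text \<open>A factor has squared modulus at most cos^2 + sin^2 / 4 = 1 - (3/4) sin^2, so every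
  active phase contributes a fixed gain.\<close>

lemma damped_small:
  assumes \<rho>: "\<bar>\<rho>\<bar> \<le> 1 / 2" and \<epsilon>: "\<epsilon> \<in> signs k" and J: "J \<subseteq> {..<k}" "L \<le> card J"
    and \<eta>: "0 \<le> \<eta>" "\<eta> \<le> 1" "\<And>l. l \<in> J \<Longrightarrow> \<eta> \<le> \<bar>sin (\<phi> l)\<bar>"
  shows "\<bar>damped k \<phi> \<rho> \<epsilon>\<bar> \<le> sqrt (1 - 3 / 4 * \<eta>\<^sup>2) ^ L"
proof -
  let ?\<kappa> = "sqrt (1 - 3 / 4 * \<eta>\<^sup>2)"
  have "\<eta>\<^sup>2 \<le> 1" using \<eta> by (simp add: power_le_one)
  then have \<kappa>: "0 \<le> ?\<kappa>" "?\<kappa> \<le> 1" by auto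
  have m: "cmod (Complex (cos (\<phi> l)) (\<rho> * \<epsilon> l * sin (\<phi> l))) \<le> sqrt (1 - 3 / 4 * (sin (\<phi> l))\<^sup>2)" if "l < k" for l
  proof -
    have "\<epsilon> l \<in> {-1, 1}" using \<epsilon> that by (meson PiE_mem lessThan_iff)
    then have "(\<epsilon> l)\<^sup>2 = 1" by auto
    moreover have "\<rho>\<^sup>2 \<le> (1 / 2)\<^sup>2" using \<rho> by (simp add: abs_le_square_iff[symmetric])
    ultimately have "(\<rho> * \<epsilon> l * sin (\<phi> l))\<^sup>2 \<le> (1 / 2)\<^sup>2 * (sin (\<phi> l))\<^sup>2"
      unfolding power_mult_distrib by (intro mult_right_mono) auto
    moreover have "(1 / 2 :: real)\<^sup>2 = 1 / 4" by (simp add: power2_eq_square)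
    ultimately have "(\<rho> * \<epsilon> l * sin (\<phi> l))\<^sup>2 \<le> 1 / 4 * (sin (\<phi> l))\<^sup>2" by (simp only:)
    then have "(cos (\<phi> l))\<^sup>2 + (\<rho> * \<epsilon> l * sin (\<phi> l))\<^sup>2 \<le> 1 - 3 / 4 * (sin (\<phi> l))\<^sup>2"
      using sin_cos_squared_add[of "\<phi> l"] by linarith
    then show ?thesis by (simp add: cmod_def)
  qed
  have "\<bar>damped k \<phi> \<rho> \<epsilon>\<bar> \<le> (\<Prod>l<k. cmod (Complex (cos (\<phi> l)) (\<rho> * \<epsilon> l * sin (\<phi> l))))"
    unfolding damped_def by (rule order_trans[OF abs_Im_le_cmod]) (simp add: prod_norm)
  also have "\<dots> \<le> (\<Prod>l<k. if l \<in> J then ?\<kappa> else 1)"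
  proof (rule prod_mono)
    fix l assume l: "l \<in> {..<k}"
    have "sqrt (1 - 3 / 4 * (sin (\<phi> l))\<^sup>2) \<le> (if l \<in> J then ?\<kappa> else 1)"
      using power_mono[OF \<eta>(3) \<eta>(1), of l 2] by auto
    then show "0 \<le> cmod (Complex (cos (\<phi> l)) (\<rho> * \<epsilon> l * sin (\<phi> l))) \<and>
      cmod (Complex (cos (\<phi> l)) (\<rho> * \<epsilon> l * sin (\<phi> l))) \<le> (if l \<in> J then ?\<kappa> else 1)"
      using m[of l] l by (auto intro: order_trans)
  qed
  also have "\<dots> = ?\<kappa> ^ card J"
    using J(1) by (simp add: prod.If_cases Int_absorb1 Collect_mem_eq)
  also have "\<dots> \<le> ?\<kappa> ^ L" using \<kappa> J(2) by (rule power_decreasing[rotated])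
  finally show ?thesis .
qed

text \<open>Only 70 nonzero residues occur, and since 71 is odd, 2 m / 71 is never an integer for
  them; the minimum is therefore positive.\<close>

lemma sin_seventyfirst:
  "\<exists>\<eta>>0. \<eta> \<le> 1 \<and> (\<forall>m::int. \<not> 71 dvd m \<longrightarrow> \<eta> \<le> \<bar>sin (2 * pi * of_int m / 71)\<bar>)"
proof -
  define S where "S = (\<lambda>m::int. \<bar>sin (2 * pi * of_int m / 71)\<bar>) ` {1..70}"
  have fin: "finite S" "S \<noteq> {}" by (auto simp: S_def)
  have "0 < x" if x: "x \<in> S" for x
  proof -
    obtain m :: int where m: "1 \<le> m" "m \<le> 70" "x = \<bar>sin (2 * pi * of_int m / 71)\<bar>"
      using x by (auto simp: S_def)
    have "sin (2 * pi * of_int m / 71) \<noteq> 0"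
    proof
      assume "sin (2 * pi * of_int m / 71) = 0"
      then obtain i :: int where "2 * pi * of_int m / 71 = of_int i * pi" by (auto simp: sin_zero_iff_int2)
      then have "real_of_int (2 * m) = of_int (71 * i)" by (simp add: field_simps)
      then have "2 * m = 71 * i" by (simp only: of_int_eq_iff)
      then show False using m by presburger
    qed
    then show ?thesis using m by simp
  qed
  then have pos: "0 < Min S" using fin by simp
  have le: "Min S \<le> \<bar>sin (2 * pi * of_int m / 71)\<bar>" if "\<not> 71 dvd m" for m :: int
  proof -
    have "2 * pi * of_int m / 71 = 2 * pi * of_int (m mod 71) / 71 + 2 * pi * of_int (m div 71)"
    proof -
      have "real_of_int m = of_int (71 * (m div 71) + m mod 71)" by simp
      then have r: "real_of_int m = 71 * of_int (m div 71) + of_int (m mod 71)"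
        by (simp only: of_int_add of_int_mult of_int_numeral)
      show ?thesis by (subst r) (simp add: field_simps)
    qed
    then have "sin (2 * pi * of_int m / 71) = sin (2 * pi * of_int (m mod 71) / 71)"
      by (simp only: sin_add sin_int_2pin cos_int_2pin mult_1_right mult_zero_right add_0_right)
    moreover have "m mod 71 \<in> {1..70}"
      using that pos_mod_sign[of 71 m] pos_mod_bound[of 71 m] by (auto simp: dvd_eq_mod_eq_0)
    ultimately show ?thesis using fin by (intro Min_le) (auto simp: S_def)
  qed
  have "Min S \<le> \<bar>sin (2 * pi * of_int 1 / 71)\<bar>" by (rule le) simp
  also have "\<dots> \<le> 1" by simp
  finally show ?thesis using pos le by blast
qed

section \<open>The tensors built from the code\<close>

context lp_factor
begin

text \<open>For a fixed sign pattern \<delta> the phases add, so the exponential splits into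
  unimodular functions of w, i and j and \<open>PN_rank_one\<close> applies. Averaging with
  probability weights keeps the bound.\<close>

lemma PN_damped:
  fixes \<alpha> \<beta> \<gamma> :: "nat \<Rightarrow> nat \<Rightarrow> real"
  assumes "\<bar>\<rho>\<bar> \<le> 1" "\<epsilon> \<in> signs k"
  shows "PN (tens n (\<lambda>w i j. damped k (\<lambda>l. \<alpha> l w + \<beta> l i + \<gamma> l j) \<rho> \<epsilon>)) \<le> 2 * real n"
proof -
  define q where "q \<delta> = (\<Prod>l<k. (1 + \<rho> * \<epsilon> l * \<delta> l) / 2)" for \<delta>
  define C where "C \<psi> \<delta> w = (\<Prod>l<k. cis (\<delta> l * \<psi> l w))" for \<psi> :: "nat \<Rightarrow> nat \<Rightarrow> real" and \<delta> w
  have e: "Im (\<Prod>l<k. cis (\<delta> l * (\<alpha> l w + \<beta> l i + \<gamma> l j))) = Im (C \<alpha> \<delta> w * C \<beta> \<delta> i * C \<gamma> \<delta> j)" for \<delta> w i j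
    by (simp add: C_def distrib_left flip: prod.distrib cis_mult)
  have C1: "cmod (C \<psi> \<delta> w) = 1" for \<psi> \<delta> w by (simp add: C_def flip: prod_norm)
  have "PN (tens n (\<lambda>w i j. damped k (\<lambda>l. \<alpha> l w + \<beta> l i + \<gamma> l j) \<rho> \<epsilon>)) =
      PN (tens n (\<lambda>w i j. \<Sum>\<delta>\<in>signs k. q \<delta> * Im (C \<alpha> \<delta> w * C \<beta> \<delta> i * C \<gamma> \<delta> j)))"
    unfolding damped_average e q_def ..
  also have "\<dots> \<le> (\<Sum>\<delta>\<in>signs k. PN (tens n (\<lambda>w i j. q \<delta> * Im (C \<alpha> \<delta> w * C \<beta> \<delta> i * C \<gamma> \<delta> j))))"
    by (rule PN_tens_sum) simp
  also have "\<dots> = (\<Sum>\<delta>\<in>signs k. q \<delta> * PN (tens n (\<lambda>w i j. Im (C \<alpha> \<delta> w * C \<beta> \<delta> i * C \<gamma> \<delta> j))))"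
    unfolding PN_tens_scale using damped_weights(2)[OF assms] by (intro sum.cong) (auto simp: q_def)
  also have "\<dots> \<le> (\<Sum>\<delta>\<in>signs k. q \<delta> * (2 * real n))"
    using damped_weights(2)[OF assms] by (intro sum_mono mult_left_mono PN_rank_one C1) (auto simp: q_def)
  also have "\<dots> = 2 * real n"
    using damped_weights(1)[OF assms] by (simp add: q_def flip: sum_distrib_right)
  finally show ?thesis .
qed

text \<open>Lower bound: on the l-th matching every phase but the l-th is a multiple of 2 pi, so
  each entry is a sine of modulus at least \<eta>. Upper bound: up to a small error the signed sum
  is a quadrature combination of damped arrays of norm at most 2 n.\<close>

lemma tensors_of_code:
  fixes \<Phi> :: "nat \<Rightarrow> nat \<Rightarrow> int"
  assumes inj: "\<And>l. l < k \<Longrightarrow> inj_on (\<sigma> l) {..<n} \<and> inj_on (\<tau> l) {..<n} \<and> \<sigma> l ` {..<n} \<subseteq> {..<n} \<and> \<tau> l ` {..<n} \<subseteq> {..<n}"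
    and code: "\<And>l j w. l < k \<Longrightarrow> j < k \<Longrightarrow> w < n \<Longrightarrow>
      71 dvd 13 * \<Phi> j w + 5 * \<Phi> j (\<sigma> l w) + 7 * \<Phi> j (\<tau> l w) \<longleftrightarrow> l \<noteq> j"
    and \<eta>: "0 < \<eta>" "\<eta> \<le> 1" "\<And>m::int. \<not> 71 dvd m \<Longrightarrow> \<eta> \<le> \<bar>sin (2 * pi * of_int m / 71)\<bar>"
    and L: "1 \<le> L" "(real n)\<^sup>2 * sqrt (1 - 3 / 4 * \<eta>\<^sup>2) ^ L \<le> 1"
  shows "\<exists>z. (\<forall>l<k. \<eta> * real n \<le> PN (tens n (z l))) \<and>
    (\<forall>\<epsilon>\<in>signs k. PN (tens n (\<lambda>w i j. \<Sum>l<k. \<epsilon> l * z l w i j)) \<le> 12 * (real L)\<^sup>2 * real n)"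
proof -
  define m where "m l w i j = 13 * \<Phi> l w + 5 * \<Phi> l i + 7 * \<Phi> l j" for l w i j
  define \<phi> where "\<phi> w i j l = 2 * pi * of_int (m l w i j) / 71" for w i j l
  define J where "J w i j = {l. l < k \<and> \<not> 71 dvd m l w i j}" for w i j
  \<comment> \<open>The cutoff is there because the quadrature is exact only up to degree L.
    Matching entries have exactly one active phase and survive it, as L is at least 1.\<close>
  define z where "z l w i j = (if card (J w i j) \<le> L
      then sin (\<phi> w i j l) * (\<Prod>l'\<in>{..<k} - {l}. cos (\<phi> w i j l')) else 0)" for l w i j
  have dv: "sin (\<phi> w i j l) = 0" "cos (\<phi> w i j l) = 1" if d: "71 dvd m l w i j" for w i j l
  proof -
    obtain q where "m l w i j = 71 * q" using d by (auto simp: dvd_def)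
    then have "\<phi> w i j l = 2 * pi * of_int q" by (simp add: \<phi>_def)
    then show "sin (\<phi> w i j l) = 0" "cos (\<phi> w i j l) = 1"
      by (simp_all only: sin_int_2pin cos_int_2pin)
  qed
  have "\<eta> * real n \<le> PN (tens n (z l))" if l: "l < k" for l
  proof -
    define f where "f w = z l w (\<sigma> l w) (\<tau> l w)" for w
    have f: "\<eta> \<le> \<bar>f w\<bar>" if w: "w < n" for w
    proof -
      have "J w (\<sigma> l w) (\<tau> l w) = {l}" using code[OF l _ w] l by (auto simp: J_def m_def)
      moreover have "(\<Prod>l'\<in>{..<k} - {l}. cos (\<phi> w (\<sigma> l w) (\<tau> l w) l')) = 1"
        using code[OF l _ w] by (intro prod.neutral ballI dv(2)) (auto simp: m_def)
      ultimately have fw: "f w = sin (2 * pi * of_int (m l w (\<sigma> l w) (\<tau> l w)) / 71)"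
        using L(1) by (simp add: f_def z_def \<phi>_def)
      have "\<not> 71 dvd m l w (\<sigma> l w) (\<tau> l w)" using code[OF l l w] by (simp add: m_def)
      then show ?thesis unfolding fw by (rule \<eta>(3))
    qed
    have "\<eta> * real n = (\<Sum>w<n. \<eta>)" by simp
    also have "\<dots> \<le> (\<Sum>w<n. \<bar>f w\<bar>)" using f by (intro sum_mono) auto
    also have "\<dots> = (\<Sum>w<n. sgn (f w) * z l w (\<sigma> l w) (\<tau> l w))"
      by (intro sum.cong refl) (simp add: f_def[symmetric] abs_sgn mult.commute)
    also have "\<dots> \<le> PN (tens n (z l))"
      using PN_matching[of n "\<lambda>w. sgn (f w)" "\<sigma> l" "\<tau> l" "z l"] inj[OF l] by (auto simp: abs_sgn_eq)
    finally show ?thesis .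
  qed
  moreover have "PN (tens n (\<lambda>w i j. \<Sum>l<k. \<epsilon> l * z l w i j)) \<le> 12 * (real L)\<^sup>2 * real n" if \<epsilon>: "\<epsilon> \<in> signs k" for \<epsilon>
  proof -
    obtain \<rho> c and K :: nat where \<rho>: "\<And>r. r < K \<Longrightarrow> \<bar>\<rho> r\<bar> \<le> 1 / 2"
      and quad: "\<And>s. s \<le> L \<Longrightarrow> (\<Sum>r<K. c r * \<rho> r ^ s) = (if s = 1 then 1 else 0)"
      and c: "(\<Sum>r<K. \<bar>c r\<bar>) \<le> 4 * real L ^ 2"
      using derivative_quadrature[of L] by blast
    define G where "G r w i j = damped k (\<phi> w i j) (\<rho> r) \<epsilon>" for r w i j
    \<comment> \<open>On the cut-off entries E cancels the quadrature sum; there more than L active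
      phases make it tiny.\<close>
    define E where "E w i j = (if card (J w i j) \<le> L then 0 else - (\<Sum>r<K. c r * G r w i j))" for w i j
    have dec: "(\<Sum>l<k. \<epsilon> l * z l w i j) = (\<Sum>r<K. c r * G r w i j) + E w i j" for w i j
    proof (cases "card (J w i j) \<le> L")
      case True
      have "{l. l < k \<and> sin (\<phi> w i j l) \<noteq> 0} \<subseteq> J w i j" using dv(1) by (auto simp: J_def)
      then have "card {l. l < k \<and> sin (\<phi> w i j l) \<noteq> 0} \<le> card (J w i j)"
        by (intro card_mono) (auto simp: J_def)
      with True have "card {l. l < k \<and> sin (\<phi> w i j l) \<noteq> 0} \<le> L" by simp
      from damped_quadrature[OF this quad] show ?thesis using True by (simp add: G_def E_def z_def)
    next
      case False
      then show ?thesis by (simp add: E_def z_def)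
    qed
    let ?\<kappa> = "sqrt (1 - 3 / 4 * \<eta>\<^sup>2)"
    have "\<eta>\<^sup>2 \<le> 1" using \<eta> by (simp add: power_le_one)
    then have \<kappa>: "0 \<le> ?\<kappa>" by auto
    have E: "\<bar>E w i j\<bar> \<le> 4 * real L ^ 2 * ?\<kappa> ^ L" for w i j
    proof (cases "card (J w i j) \<le> L")
      case True
      then show ?thesis using \<kappa> by (simp add: E_def)
    next
      case False
      have "\<bar>G r w i j\<bar> \<le> ?\<kappa> ^ L" if "r < K" for r
        unfolding G_def
        by (rule damped_small[OF \<rho>[OF that] \<epsilon>, of "J w i j"])
          (use False \<eta> in \<open>auto simp: J_def \<phi>_def\<close>)
      then have "(\<Sum>r<K. \<bar>c r\<bar> * \<bar>G r w i j\<bar>) \<le> (\<Sum>r<K. \<bar>c r\<bar> * ?\<kappa> ^ L)"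
        by (intro sum_mono mult_left_mono) auto
      moreover have "\<bar>E w i j\<bar> \<le> (\<Sum>r<K. \<bar>c r\<bar> * \<bar>G r w i j\<bar>)"
        using False sum_abs[of "\<lambda>r. c r * G r w i j" "{..<K}"] by (simp add: E_def abs_mult)
      moreover have "(\<Sum>r<K. \<bar>c r\<bar> * ?\<kappa> ^ L) \<le> 4 * real L ^ 2 * ?\<kappa> ^ L"
        unfolding sum_distrib_right[symmetric] using c \<kappa>
        by (intro mult_right_mono) auto
      ultimately show ?thesis by linarith
    qed
    have G: "PN (tens n (G r)) \<le> 2 * real n" if "r < K" for r
    proof -
      have "\<bar>\<rho> r\<bar> \<le> 1" using \<rho>[OF that] by simp
      from PN_damped[OF this \<epsilon>, of n "\<lambda>l w. 2 * pi * of_int (13 * \<Phi> l w) / 71"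
          "\<lambda>l w. 2 * pi * of_int (5 * \<Phi> l w) / 71" "\<lambda>l w. 2 * pi * of_int (7 * \<Phi> l w) / 71"]
      show ?thesis unfolding G_def[abs_def] \<phi>_def[abs_def] m_def
        by (simp only: of_int_add distrib_left add_divide_distrib)
    qed
    have "PN (tens n (\<lambda>w i j. \<Sum>l<k. \<epsilon> l * z l w i j)) \<le>
        PN (tens n (\<lambda>w i j. \<Sum>r<K. c r * G r w i j)) + PN (tens n E)"
      unfolding dec by (rule PN_tens_add)
    also have "PN (tens n (\<lambda>w i j. \<Sum>r<K. c r * G r w i j)) \<le> (\<Sum>r<K. PN (tens n (\<lambda>w i j. c r * G r w i j)))"
      by (rule PN_tens_sum) simp
    also have "(\<Sum>r<K. PN (tens n (\<lambda>w i j. c r * G r w i j))) \<le> (\<Sum>r<K. \<bar>c r\<bar> * (2 * real n))"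
      unfolding PN_tens_scale using G by (intro sum_mono mult_left_mono) auto
    also have "\<dots> \<le> 4 * real L ^ 2 * (2 * real n)"
      unfolding sum_distrib_right[symmetric] using c by (intro mult_right_mono) auto
    also have "PN (tens n E) \<le> (\<Sum>w<n. \<Sum>i<n. \<Sum>j<n. \<bar>E w i j\<bar>)" by (rule PN_tens_entries)
    also have "\<dots> \<le> (\<Sum>w<n. \<Sum>i<n. \<Sum>j<n. 4 * real L ^ 2 * ?\<kappa> ^ L)" using E by (intro sum_mono)
    \<comment> \<open>Of the n^3 error entries a factor n^2 is paid for by the damping, so the error
      costs 4 L^2 n beside the main term 8 L^2 n.\<close>
    also have "\<dots> = 4 * real L ^ 2 * real n * ((real n)\<^sup>2 * ?\<kappa> ^ L)" by (simp add: power2_eq_square)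
    also have "\<dots> \<le> 4 * real L ^ 2 * real n * 1" using L(2) by (intro mult_left_mono) auto
    finally show ?thesis by (simp add: mult_ac)
  qed
  ultimately show ?thesis by blast
qed

end

section \<open>Failure of cotype\<close>

context seminormed_space
begin

lemma completion_const:
  assumes "x \<in> carrier V"
  shows "cls (\<lambda>_. x) \<in> carrier (norm_completion V)" "vnorm (norm_completion V) (cls (\<lambda>_. x)) = vnorm V x"
proof -
  show "cls (\<lambda>_. x) \<in> carrier (norm_completion V)"
    using Cau_const[OF assms] completion_carrier by blast
  show "vnorm (norm_completion V) (cls (\<lambda>_. x)) = vnorm V x"
    using completion_norm[OF Cau_const[OF assms]] LIMSEQ_unique tendsto_const by blast
qed

lemma completion_finsum_const:
  assumes "finite A" "\<And>l. l \<in> A \<Longrightarrow> x l \<in> carrier V"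
  shows "(\<Oplus>\<^bsub>norm_completion V\<^esub>l\<in>A. cls (\<lambda>_. x l)) = cls (\<lambda>_. \<Oplus>l\<in>A. x l)"
proof -
  interpret W: seminormed_space "norm_completion V" by (rule seminormed_completion)
  show ?thesis using assms
  proof (induction A)
    case empty
    then show ?case by (simp add: completion_zero)
  next
    case (insert a A)
    have c: "(\<Oplus>l\<in>A. x l) \<in> carrier V" using insert by (intro M.finsum_closed) auto
    have "(\<Oplus>\<^bsub>norm_completion V\<^esub>l\<in>insert a A. cls (\<lambda>_. x l)) =
        cls (\<lambda>_. x a) \<oplus>\<^bsub>norm_completion V\<^esub> (\<Oplus>\<^bsub>norm_completion V\<^esub>l\<in>A. cls (\<lambda>_. x l))"
      using insert completion_const(1) by (intro W.M.finsum_insert) auto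
    also have "\<dots> = cls (\<lambda>_. x a \<oplus> (\<Oplus>l\<in>A. x l))"
      using insert c by (simp add: completion_add)
    also have "x a \<oplus> (\<Oplus>l\<in>A. x l) = (\<Oplus>l\<in>insert a A. x l)"
      using insert by (intro M.finsum_insert[symmetric]) auto
    finally show ?case .
  qed
qed

text \<open>Elements of V sit isometrically in the completion as constant sequences. The inequality
  is tested on vectors of norm at least a all of whose signed sums have norm at most b.\<close>

lemma has_cotype_completion_bound:
  assumes q: "has_cotype (norm_completion V) q" "0 < q"
  obtains C where "0 < C"
    "\<And>N x a b. (\<And>l. l < N \<Longrightarrow> x l \<in> carrier V \<and> a \<le> vnorm V (x l)) \<Longrightarrow> 0 \<le> a \<Longrightarrow> 0 \<le> b \<Longrightarrow>
      (\<And>\<epsilon>. \<epsilon> \<in> signs N \<Longrightarrow> vnorm V (\<Oplus>l\<in>{..<N}. \<epsilon> l \<odot> x l) \<le> b) \<Longrightarrow> real N powr (1 / q) * a \<le> C * b"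
proof -
  let ?W = "norm_completion V"
  interpret W: seminormed_space ?W by (rule seminormed_completion)
  obtain C where C: "C > 0" and cot: "\<And>N x. (\<forall>i<N. x i \<in> carrier ?W) \<Longrightarrow>
     (\<Sum>i<N. vnorm ?W (x i) powr q) powr (1 / q)
       \<le> C * sqrt (measure_pmf.expectation (pmf_of_set (signs N))
             (\<lambda>\<epsilon>. (vnorm ?W (\<Oplus>\<^bsub>?W\<^esub>i\<in>{..<N}. \<epsilon> i \<odot>\<^bsub>?W\<^esub> x i))\<^sup>2))"
    using q unfolding has_cotype_def by blast
  show thesis
  proof (rule that[OF C])
    fix N a b and x :: "nat \<Rightarrow> 'a"
    assume x: "\<And>l. l < N \<Longrightarrow> x l \<in> carrier V \<and> a \<le> vnorm V (x l)" and a: "0 \<le> a" and b: "0 \<le> b"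
      and bd: "\<And>\<epsilon>. \<epsilon> \<in> signs N \<Longrightarrow> vnorm V (\<Oplus>l\<in>{..<N}. \<epsilon> l \<odot> x l) \<le> b"
    let ?z = "\<lambda>l. cls (\<lambda>_. x l)"
    have fs: "(\<Oplus>\<^bsub>?W\<^esub>l\<in>{..<N}. \<epsilon> l \<odot>\<^bsub>?W\<^esub> ?z l) = cls (\<lambda>_. \<Oplus>l\<in>{..<N}. \<epsilon> l \<odot> x l)" for \<epsilon>
    proof -
      have "(\<Oplus>\<^bsub>?W\<^esub>l\<in>{..<N}. \<epsilon> l \<odot>\<^bsub>?W\<^esub> ?z l) = (\<Oplus>\<^bsub>?W\<^esub>l\<in>{..<N}. cls (\<lambda>_. \<epsilon> l \<odot> x l))"
      proof (rule W.M.finsum_cong')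
        show "(\<lambda>l. cls (\<lambda>_. \<epsilon> l \<odot> x l)) \<in> {..<N} \<rightarrow> carrier ?W"
          using x completion_const(1) by auto
        show "\<epsilon> l \<odot>\<^bsub>?W\<^esub> ?z l = cls (\<lambda>_. \<epsilon> l \<odot> x l)" if "l \<in> {..<N}" for l
          using completion_smult[OF Cau_const, of "x l" "\<epsilon> l"] x that by auto
      qed simp
      also have "\<dots> = cls (\<lambda>_. \<Oplus>l\<in>{..<N}. \<epsilon> l \<odot> x l)"
        using x by (intro completion_finsum_const) auto
      finally show ?thesis .
    qed
    have nrm: "vnorm ?W (cls (\<lambda>_. \<Oplus>l\<in>{..<N}. \<epsilon> l \<odot> x l)) = vnorm V (\<Oplus>l\<in>{..<N}. \<epsilon> l \<odot> x l)"
      and cl: "(\<Oplus>l\<in>{..<N}. \<epsilon> l \<odot> x l) \<in> carrier V" for \<epsilon>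
    proof -
      show cl: "(\<Oplus>l\<in>{..<N}. \<epsilon> l \<odot> x l) \<in> carrier V" using x by (intro M.finsum_closed) auto
      show "vnorm ?W (cls (\<lambda>_. \<Oplus>l\<in>{..<N}. \<epsilon> l \<odot> x l)) = vnorm V (\<Oplus>l\<in>{..<N}. \<epsilon> l \<odot> x l)"
        by (rule completion_const(2)[OF cl])
    qed
    have "(\<Sum>\<epsilon>\<in>signs N. (vnorm V (\<Oplus>l\<in>{..<N}. \<epsilon> l \<odot> x l))\<^sup>2) \<le> (\<Sum>\<epsilon>\<in>signs N. b\<^sup>2)"
      using bd norm_nonneg[OF cl] by (intro sum_mono power_mono) auto
    then have "(\<Sum>\<epsilon>\<in>signs N. (vnorm V (\<Oplus>l\<in>{..<N}. \<epsilon> l \<odot> x l))\<^sup>2) / 2 ^ N \<le> b\<^sup>2"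
      by (simp add: card_signs divide_le_eq mult.commute)
    then have rhs: "sqrt (measure_pmf.expectation (pmf_of_set (signs N))
        (\<lambda>\<epsilon>. (vnorm ?W (\<Oplus>\<^bsub>?W\<^esub>i\<in>{..<N}. \<epsilon> i \<odot>\<^bsub>?W\<^esub> ?z i))\<^sup>2)) \<le> b"
      unfolding fs nrm expectation_signs using b by (simp add: real_le_lsqrt)
    have "real N * a powr q = (\<Sum>i<N. a powr q)" by simp
    also have "\<dots> \<le> (\<Sum>i<N. vnorm ?W (?z i) powr q)"
      using x a q by (intro sum_mono powr_mono2) (auto simp: completion_const(2))
    finally have "(real N * a powr q) powr (1 / q) \<le> (\<Sum>i<N. vnorm ?W (?z i) powr q) powr (1 / q)"
      using q by (intro powr_mono2) auto
    also have "\<dots> \<le> C * sqrt (measure_pmf.expectation (pmf_of_set (signs N))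
             (\<lambda>\<epsilon>. (vnorm ?W (\<Oplus>\<^bsub>?W\<^esub>i\<in>{..<N}. \<epsilon> i \<odot>\<^bsub>?W\<^esub> ?z i))\<^sup>2))"
      using x completion_const(1) by (intro cot) auto
    also have "\<dots> \<le> C * b" using C rhs by (intro mult_left_mono) auto
    finally show "real N powr (1 / q) * a \<le> C * b"
      using a q by (simp add: powr_mult powr_powr)
  qed
qed

end

context lp_factor
begin

text \<open>As n = 35^H, a length proportional to H, hence to log n, brings the damping below
  n^(-2): L0 only has to beat the factor 35^2 per unit of H.\<close>

lemma damping_length:
  assumes "0 < \<eta>" "\<eta> \<le> 1"
  obtains L0 :: nat where "1 \<le> L0" "\<And>H. (real (35 ^ H))\<^sup>2 * sqrt (1 - 3 / 4 * \<eta>\<^sup>2) ^ (L0 * H) \<le> 1"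
proof -
  let ?\<kappa> = "sqrt (1 - 3 / 4 * \<eta>\<^sup>2)"
  have "\<eta>\<^sup>2 \<le> 1" "0 < \<eta>\<^sup>2" using assms by (auto simp: power_le_one)
  then have \<kappa>: "0 \<le> ?\<kappa>" "?\<kappa> < 1" by auto
  obtain L where L: "?\<kappa> ^ L < 1 / 35\<^sup>2" using real_arch_pow_inv[of "1 / 35\<^sup>2" ?\<kappa>] \<kappa> by auto
  have "?\<kappa> ^ Suc L \<le> ?\<kappa> ^ L" using \<kappa> by (intro power_decreasing) auto
  with L have S: "35\<^sup>2 * ?\<kappa> ^ Suc L \<le> 1" by simp
  show thesis
  proof (rule that[of "Suc L"])
    fix H
    have "(real (35 ^ H))\<^sup>2 * ?\<kappa> ^ (Suc L * H) = (35\<^sup>2 * ?\<kappa> ^ Suc L) ^ H"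
      by (simp only: power_mult_distrib power_mult of_nat_power of_nat_numeral) (simp only: power_mult[symmetric] mult.commute)
    also have "\<dots> \<le> 1" using S \<kappa> by (intro power_le_one) auto
    finally show "(real (35 ^ H))\<^sup>2 * ?\<kappa> ^ (Suc L * H) \<le> 1" .
  qed simp
qed

theorem not_finite_cotype_tensor: "\<not> finite_cotype (proj_tensor (lp_space p) (factor_space t))"
proof
  assume "finite_cotype (proj_tensor (lp_space p) (factor_space t))"
  then obtain q where q: "2 \<le> q" "has_cotype (norm_completion TS.T) q"
    unfolding finite_cotype_def proj_tensor_def by blast
  interpret T: seminormed_space TS.T by (rule TS.seminormed_alg_tensor)
  have q0: "0 < q" using q(1) by simp
  show False
  proof (rule T.has_cotype_completion_bound[OF q(2) q0])
    fix C :: real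
    assume C: "0 < C" and cot:
      "\<And>N x a b. (\<And>l. l < N \<Longrightarrow> x l \<in> carrier TS.T \<and> a \<le> vnorm TS.T (x l)) \<Longrightarrow> 0 \<le> a \<Longrightarrow> 0 \<le> b \<Longrightarrow>
        (\<And>\<epsilon>. \<epsilon> \<in> signs N \<Longrightarrow> vnorm TS.T (\<Oplus>\<^bsub>TS.T\<^esub>l\<in>{..<N}. \<epsilon> l \<odot>\<^bsub>TS.T\<^esub> x l) \<le> b) \<Longrightarrow>
        real N powr (1 / q) * a \<le> C * b"
    obtain \<eta> where \<eta>: "0 < \<eta>" "\<eta> \<le> 1" "\<And>m::int. \<not> 71 dvd m \<Longrightarrow> \<eta> \<le> \<bar>sin (2 * pi * of_int m / 71)\<bar>"
      using sin_seventyfirst by blast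
    obtain L0 where L0: "1 \<le> L0" "\<And>H. (real (35 ^ H))\<^sup>2 * sqrt (1 - 3 / 4 * \<eta>\<^sup>2) ^ (L0 * H) \<le> 1"
      using damping_length[OF \<eta>(1,2)] by blast
    \<comment> \<open>Collects the constants, so that cotype q reads k^(1/q) \<le> A * H^2.\<close>
    define A where "A = C * 12 * (real L0)\<^sup>2 / \<eta>"
    have A: "0 < A" using C L0 \<eta> by (simp add: A_def)
    \<comment> \<open>Q and M make M * H^Q exceed the resulting bound A^q * H^(2 q) on k.\<close>
    define Q where "Q = nat \<lceil>2 * q\<rceil>"
    define M where "M = Suc (nat \<lceil>A powr q\<rceil>)"
    have Q: "2 * q \<le> real Q" unfolding Q_def by linarith
    have M: "A powr q < real M" unfolding M_def by linarith
    obtain H k n and \<Phi> :: "nat \<Rightarrow> nat \<Rightarrow> int" and \<sigma> \<tau> where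
      *: "1 \<le> H \<and> n = 35 ^ H \<and> M * H ^ Q \<le> k \<and>
       (\<forall>l<k. inj_on (\<sigma> l) {..<n} \<and> inj_on (\<tau> l) {..<n} \<and> \<sigma> l ` {..<n} \<subseteq> {..<n} \<and> \<tau> l ` {..<n} \<subseteq> {..<n} \<and>
          (\<forall>j<k. \<forall>w<n. 71 dvd 13 * \<Phi> j w + 5 * \<Phi> j (\<sigma> l w) + 7 * \<Phi> j (\<tau> l w) \<longleftrightarrow> l \<noteq> j))"
      using three_query_code[of M Q] by (elim exE) (rule that)
    then have H: "1 \<le> H" "n = 35 ^ H" "M * H ^ Q \<le> k" by (simp_all only:)
    note code = *[THEN conjunct2, THEN conjunct2, THEN conjunct2, rule_format]
    have n: "0 < real n" by (simp add: H(2))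
    have L: "1 \<le> L0 * H" using L0(1) H(1) by simp
    have inj: "inj_on (\<sigma> l) {..<n} \<and> inj_on (\<tau> l) {..<n} \<and> \<sigma> l ` {..<n} \<subseteq> {..<n} \<and> \<tau> l ` {..<n} \<subseteq> {..<n}"
      if "l < k" for l
      using code[OF that] by (intro conjI; elim conjE)
    have dvd: "71 dvd 13 * \<Phi> j w + 5 * \<Phi> j (\<sigma> l w) + 7 * \<Phi> j (\<tau> l w) \<longleftrightarrow> l \<noteq> j"
      if "l < k" "j < k" "w < n" for l j w
      using code[OF that(1)] that(2,3) by (elim conjE allE impE)
    have Ln: "(real n)\<^sup>2 * sqrt (1 - 3 / 4 * \<eta>\<^sup>2) ^ (L0 * H) \<le> 1" unfolding H(2) by (rule L0(2))
    from tensors_of_code[of k \<sigma> n \<tau> \<Phi>, OF inj dvd \<eta> L Ln]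
    obtain z where z: "\<And>l. l < k \<Longrightarrow> \<eta> * real n \<le> PN (tens n (z l))"
      "\<And>\<epsilon>. \<epsilon> \<in> signs k \<Longrightarrow> PN (tens n (\<lambda>w i j. \<Sum>l<k. \<epsilon> l * z l w i j)) \<le> 12 * (real (L0 * H))\<^sup>2 * real n"
      by blast
    have "real k powr (1 / q) * (\<eta> * real n) \<le> C * (12 * (real (L0 * H))\<^sup>2 * real n)"
    proof (rule cot[of k "\<lambda>l. tens n (z l)"])
      show "tens n (z l) \<in> carrier TS.T \<and> \<eta> * real n \<le> vnorm TS.T (tens n (z l))" if "l < k" for l
        using tens_carrier z(1)[OF that] by simp
      fix \<epsilon> assume \<epsilon>: "\<epsilon> \<in> signs k"
      have "(\<Oplus>\<^bsub>TS.T\<^esub>l\<in>{..<k}. \<epsilon> l \<odot>\<^bsub>TS.T\<^esub> tens n (z l)) = (\<lambda>B. \<Sum>l<k. (\<epsilon> l \<odot>\<^bsub>TS.T\<^esub> tens n (z l)) B)"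
        by (intro TS.T_sum(3) T.smult_closed' tens_carrier) auto
      also have "\<dots> = tens n (\<lambda>w i j. \<Sum>l<k. \<epsilon> l * z l w i j)"
        unfolding tens_sum tens_scale by simp
      finally show "vnorm TS.T (\<Oplus>\<^bsub>TS.T\<^esub>l\<in>{..<k}. \<epsilon> l \<odot>\<^bsub>TS.T\<^esub> tens n (z l)) \<le> 12 * (real (L0 * H))\<^sup>2 * real n"
        using z(2)[OF \<epsilon>] by simp
    qed (use \<eta> in auto)
    then have "real k powr (1 / q) * \<eta> * real n \<le> C * 12 * (real (L0 * H))\<^sup>2 * real n" by (simp add: mult_ac)
    then have "real k powr (1 / q) * \<eta> \<le> C * 12 * (real (L0 * H))\<^sup>2" using n by simp
    then have "real k powr (1 / q) \<le> A * (real H)\<^sup>2"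
      using \<eta> by (simp add: A_def field_simps power_mult_distrib)
    then have "(real k powr (1 / q)) powr q \<le> (A * (real H)\<^sup>2) powr q"
      using q by (intro powr_mono2) auto
    then have "real k \<le> A powr q * real H powr (2 * q)"
      using q A by (simp add: powr_powr powr_mult flip: powr_numeral)
    also have "\<dots> < real M * real H powr (2 * q)"
      using M H(1) by (intro mult_strict_right_mono) auto
    also have "\<dots> \<le> real M * real H powr real Q"
      using Q H(1) by (intro mult_left_mono powr_mono) auto
    also have "\<dots> = real (M * H ^ Q)" using H(1) by (simp add: powr_realpow)
    also have "\<dots> \<le> real k" using H(3) by (simp only: of_nat_le_iff)
    finally show False by simp
  qed
qed

end

theorem mainTheorem2:
  fixes p :: real
  assumes "1 < p"
  shows "\<exists>X :: (nat \<Rightarrow> real) nspace.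
           banach_space X \<and> finite_cotype X \<and> \<not> finite_cotype (proj_tensor (lp_space p) X)"
proof -
  interpret lp_factor p by unfold_locales fact
  show ?thesis using F.banach_X F.cotype_X not_finite_cotype_tensor by blast
qed

end
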